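(* Let $F$ be a topological field. There is a dual adjunction between the category $\mathsf{KH}_F$ of compact $F$-Tychonoff spaces (with continuous maps) and the category $\mathsf{A}_F$ of $F$-algebras $A$ (with unital $F$-algebra morphisms) such that: (i) $A$ is Gelfand; (iii) the spectrum $\sigma(a)$ of every $a\in A$ is compact; (iv) every prime ideal of $A$ is contained in a unique maximal ideal. The adjunction is given by the contravariant functors $\mathsf{C}_F:\mathsf{KH}_F\to\mathsf{A}_F$ and $\mathsf{M}_F:\mathsf{A}_F\to\mathsf{KH}_F$, with units the natural transformations $G_X:X\to\mathsf{M}_F\mathsf{C}_F(X)$ and $I_A:A\to\mathsf{C}_F\mathsf{M}_F(A)$; that is, $\mathsf{C}_F(G_X)\circ I_{\mathsf{C}_F(X)}=\mathrm{id}_{\mathsf{C}_F(X)}$ and $\mathsf{M}_F(I_A)\circ G_{\mathsf{M}_F(A)}=\mathrm{id}_{\mathsf{M}_F(A)}$ for all $X\in\mathsf{KH}_F$ and $A\in\mathsf{A}_F$.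
   Context: Topological fields have continuous addition, multiplication and inversion and are proper (not indiscrete), hence Hausdorff. $F$-algebras are commutative and unital; morphisms preserve $1$. A space $X$ is $F$-Tychonoff if it is $T_1$ and for every closed $C\subset X$ and $x\in X\setminus C$ there is a continuous $f:X\to F$ with $f(x)=1$ and $f|_C=0$. $A$ is Gelfand if for every maximal ideal $M$ of $A$ the canonical map $F\to A/M$ is an isomorphism (so $a+M$ is regarded as an element of $F$). The spectrum is $\sigma(a)=\{\lambda\in F: a-\lambda\cdot1\text{ is not invertible}\}$. $\mathsf{C}_F(X)=C(X,F)$ is the algebra of continuous $F$-valued functions, and $\mathsf{C}_F(f)=f^*:\varphi\mapsto\varphi\circ f$. $\mathsf{M}_F(A)=\mathrm{Max}(A)$ is the set of maximal ideals with the Zariski topology (basic open sets $D(a)=\{M: a\notin M\}$), and $\mathsf{M}_F(\psi)(M)=\psi^{-1}(M)$. $G_X(x)=M_x=\{f\in C(X,F): f(x)=0\}$, and $I_A(a)=ev_a$ with $ev_a(M)=a+M\in F$. *)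

theory Defs
  imports "HOL-Analysis.T1_Spaces" "HOL-Algebra.Module" "HOL-Algebra.QuotRing"
begin

section \<open>Topological fields\<close>

locale topological_field = field F
  for F :: "'f ring" (structure) and T :: "'f topology" +
  assumes topspace_eq: "topspace T = carrier F"
    and continuous_add: "continuous_map (prod_topology T T) T (\<lambda>(a, b). a \<oplus> b)"
    and continuous_mult: "continuous_map (prod_topology T T) T (\<lambda>(a, b). a \<otimes> b)"
    and continuous_inv: "continuous_map (subtopology T (carrier F - {\<zero>})) T (\<lambda>a. inv a)"
    and not_indiscrete: "\<exists>U. openin T U \<and> U \<noteq> {} \<and> U \<noteq> carrier F"

section \<open>The category of compact \<open>F\<close>-Tychonoff spaces\<close>

definition F_Tychonoff :: "'f ring \<Rightarrow> 'f topology \<Rightarrow> 'x topology \<Rightarrow> bool" where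
  "F_Tychonoff F T X \<longleftrightarrow> t1_space X \<and>
     (\<forall>C x. closedin X C \<longrightarrow> x \<in> topspace X - C \<longrightarrow>
        (\<exists>f. continuous_map X T f \<and> f x = \<one>\<^bsub>F\<^esub> \<and> (\<forall>y\<in>C. f y = \<zero>\<^bsub>F\<^esub>)))"

definition KH_obj :: "'f ring \<Rightarrow> 'f topology \<Rightarrow> 'x topology \<Rightarrow> bool" where
  "KH_obj F T X \<longleftrightarrow> compact_space X \<and> F_Tychonoff F T X"

text \<open>Arrows of both categories are extensional functions, so that equality in HOL is equality
  of maps on the underlying set; identities are \<open>\<lambda>x\<in>S. x\<close> and composition is
  \<^const>\<open>compose\<close>.\<close>

definition KH_hom :: "'x topology \<Rightarrow> 'y topology \<Rightarrow> ('x \<Rightarrow> 'y) set" where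
  "KH_hom X Y = {f \<in> extensional (topspace X). continuous_map X Y f}"

section \<open>The category of \<open>F\<close>-algebras\<close>

definition Max_ideals :: "('f, 'a) module \<Rightarrow> 'a set set" where
  "Max_ideals A = {M. maximalideal M A}"

definition residue_map :: "('f, 'a) module \<Rightarrow> 'a set \<Rightarrow> 'f \<Rightarrow> 'a set" where
  "residue_map A M c = M +>\<^bsub>A\<^esub> (c \<odot>\<^bsub>A\<^esub> \<one>\<^bsub>A\<^esub>)"

definition Gelfand :: "'f ring \<Rightarrow> ('f, 'a) module \<Rightarrow> bool" where
  "Gelfand F A \<longleftrightarrow> (\<forall>M\<in>Max_ideals A. residue_map A M \<in> ring_iso F (A Quot M))"

definition spectrum :: "'f ring \<Rightarrow> ('f, 'a) module \<Rightarrow> 'a \<Rightarrow> 'f set" where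
  "spectrum F A a = {c \<in> carrier F. a \<ominus>\<^bsub>A\<^esub> (c \<odot>\<^bsub>A\<^esub> \<one>\<^bsub>A\<^esub>) \<notin> Units A}"

text \<open>The zero algebra is not excluded; it is the algebra of functions on the empty space.\<close>

definition AF_obj :: "'f ring \<Rightarrow> 'f topology \<Rightarrow> ('f, 'a) module \<Rightarrow> bool" where
  "AF_obj F T A \<longleftrightarrow> algebra F A \<and> Gelfand F A
     \<and> (\<forall>a\<in>carrier A. compactin T (spectrum F A a))
     \<and> (\<forall>P. primeideal P A \<longrightarrow> (\<exists>!M. M \<in> Max_ideals A \<and> P \<subseteq> M))"

definition AF_hom :: "'f ring \<Rightarrow> ('f, 'a) module \<Rightarrow> ('f, 'b) module \<Rightarrow> ('a \<Rightarrow> 'b) set" where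
  "AF_hom F A B = {h \<in> extensional (carrier A). h \<in> ring_hom A B \<and>
     (\<forall>c\<in>carrier F. \<forall>a\<in>carrier A. h (c \<odot>\<^bsub>A\<^esub> a) = c \<odot>\<^bsub>B\<^esub> h a)}"

section \<open>The functors\<close>

definition CF :: "'f ring \<Rightarrow> 'f topology \<Rightarrow> 'x topology \<Rightarrow> ('f, 'x \<Rightarrow> 'f) module" where
  "CF F T X =
    \<lparr>carrier = {f \<in> extensional (topspace X). continuous_map X T f},
     monoid.mult = (\<lambda>f g. \<lambda>x\<in>topspace X. f x \<otimes>\<^bsub>F\<^esub> g x),
     one = (\<lambda>x\<in>topspace X. \<one>\<^bsub>F\<^esub>),
     zero = (\<lambda>x\<in>topspace X. \<zero>\<^bsub>F\<^esub>),
     add = (\<lambda>f g. \<lambda>x\<in>topspace X. f x \<oplus>\<^bsub>F\<^esub> g x),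
     smult = (\<lambda>c f. \<lambda>x\<in>topspace X. c \<otimes>\<^bsub>F\<^esub> f x)\<rparr>"

definition CF_map ::
  "'f ring \<Rightarrow> 'f topology \<Rightarrow> 'x topology \<Rightarrow> 'y topology \<Rightarrow> ('x \<Rightarrow> 'y) \<Rightarrow> ('y \<Rightarrow> 'f) \<Rightarrow> 'x \<Rightarrow> 'f" where
  "CF_map F T X Y f = (\<lambda>\<phi>\<in>carrier (CF F T Y). compose (topspace X) \<phi> f)"

text \<open>The sets \<open>D(a)\<close> are closed under finite intersections and cover \<open>Max_ideals A\<close>, so generating
  by them as a subbase makes them a base.\<close>

definition MF :: "('f, 'a) module \<Rightarrow> 'a set topology" where
  "MF A = topology_generated_by ((\<lambda>a. {M \<in> Max_ideals A. a \<notin> M}) ` carrier A)"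

definition MF_map ::
  "('f, 'a) module \<Rightarrow> ('f, 'b) module \<Rightarrow> ('a \<Rightarrow> 'b) \<Rightarrow> 'b set \<Rightarrow> 'a set" where
  "MF_map A B \<psi> = (\<lambda>M\<in>Max_ideals B. {a \<in> carrier A. \<psi> a \<in> M})"

section \<open>The units\<close>

definition G_unit :: "'f ring \<Rightarrow> 'f topology \<Rightarrow> 'x topology \<Rightarrow> 'x \<Rightarrow> ('x \<Rightarrow> 'f) set" where
  "G_unit F T X = (\<lambda>x\<in>topspace X. {f \<in> carrier (CF F T X). f x = \<zero>\<^bsub>F\<^esub>})"

definition ev :: "'f ring \<Rightarrow> ('f, 'a) module \<Rightarrow> 'a \<Rightarrow> 'a set \<Rightarrow> 'f" where
  "ev F A a = (\<lambda>M\<in>Max_ideals A. inv_into (carrier F) (residue_map A M) (M +>\<^bsub>A\<^esub> a))"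

definition I_unit :: "'f ring \<Rightarrow> ('f, 'a) module \<Rightarrow> 'a \<Rightarrow> 'a set \<Rightarrow> 'f" where
  "I_unit F A = (\<lambda>a\<in>carrier A. ev F A a)"

end

theory Submission
  imports Defs "HOL-Analysis.Urysohn" "HOL-Algebra.Ring_Divisibility"
begin

text \<open>Through the Gelfand condition, the maximal ideals of an algebra \<open>A\<close> are the kernels of its
  characters, the unital algebra morphisms \<open>A \<rightarrow> F\<close>, and \<open>ev a M\<close> is the value at \<open>a\<close> of the
  character with kernel \<open>M\<close> (\<open>ev_iff\<close>, \<open>ev_kernel\<close>). In these terms \<open>M\<^sub>F\<close> acts by precomposition on
  characters, \<open>C\<^sub>F\<close> acts by precomposition on functions, and both units are evaluations; so
  functoriality, naturality and the triangle identities are pointwise calculations. What has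
  content is that the two functors are well defined on objects.

  \<^emph>\<open>From algebras to spaces\<close> (\<open>MF_obj\<close>). The characters of \<open>A\<close> form a closed subset of the product of the
  compact spectra of the elements of \<open>A\<close>, so they are a compact space for pointwise convergence.
  Taking kernels is a continuous bijection onto the maximal ideals with the Zariski topology. The
  latter is Hausdorff because no prime ideal lies in two maximal ideals (\<open>MF_Hausdorff\<close>), so the
  bijection is a homeomorphism and every \<open>ev a\<close> is continuous. The basic open sets of \<open>Max A\<close> are the
  sets where some \<open>ev a\<close> does not vanish, which is the \<open>F\<close>-Tychonoff property.

  \<^emph>\<open>From spaces to algebras\<close> (\<open>CF_obj\<close>). It has to be shown that a proper ideal of \<open>C(X, F)\<close> vanishes
  at a point (\<open>CF_ideal_fixed\<close>). For real functions one adds squares, for complex functions one uses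
  conjugation; a general \<open>F\<close> offers neither. The substitute is that a compact \<open>F\<close>-Tychonoff space is
  \<open>F\<close>-normal (\<open>KH_F_normal\<close>): a continuous function \<open>X \<rightarrow> F\<close> that is \<open>1\<close> on one and \<open>0\<close> on the other of
  two given disjoint closed sets exists. With it, an ideal that does not vanish at \<open>x\<close> contains a
  function that is \<open>1\<close> near \<open>x\<close>, and finitely many of these combine to the constant \<open>1\<close>. The proof of
  \<open>F\<close>-normality distinguishes three kinds of fields.

  \<^item> If \<open>F\<close> is disconnected, then it is totally disconnected, because affine maps move any two points to
    any two others. As functions \<open>X \<rightarrow> F\<close> separate points, \<open>X\<close> is totally disconnected too, and
    indicator functions of clopen sets suffice.

  \<^item> If \<open>F\<close> is not locally compact, then for functions \<open>f\<close> and \<open>g\<close> without common zero on a compact set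
    some \<open>f - t g\<close> has no zero there; otherwise the quotients \<open>f / g\<close> would fill a compact
    neighbourhood of \<open>0\<close>. So linear combinations do the work of sums of squares.

  \<^item> If \<open>F\<close> is connected and locally compact, then \<open>F\<close> contains a path from \<open>0\<close> to \<open>1\<close>
    (\<open>connected_locally_compact_imp_path\<close>), and Urysohn's real function can be composed with it. In
    detail, let \<open>V\<close> be a compact neighbourhood of \<open>0\<close>. If the multiples of every nonzero element leave \<open>V\<close>,
    the walks \<open>0, a, 2a, \<dots>\<close> up to the first exit converge, as \<open>a\<close> tends to \<open>0\<close> and along a suitable
    subnet, to an additive path. If the multiples of some nonzero element stay in \<open>V\<close>, then the
    integers are bounded in \<open>F\<close>, and so is the ring \<open>Z[p]\<close> for small \<open>p\<close>. As \<open>V\<close> is covered by finitely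
    many translates \<open>v\<^sub>i + p V\<close>, the closure of \<open>\<Sum> Z[p] v\<^sub>i\<close> is a compact additive group that contains
    \<open>V\<close>. It is open, hence all of the connected field \<open>F\<close>, but a compact \<open>F\<close> would be discrete.\<close>

section \<open>Topological fields: continuity, separation, boundedness\<close>

context topological_field
begin

lemma continuous_map_carrier:
  "continuous_map X T f \<Longrightarrow> x \<in> topspace X \<Longrightarrow> f x \<in> carrier F"
  using continuous_map_funspace topspace_eq by fastforce

lemma cont_const: "c \<in> carrier F \<Longrightarrow> continuous_map X T (\<lambda>x. c)"
  by (simp add: topspace_eq)

lemma cont_add:
  assumes "continuous_map X T f" "continuous_map X T g"
  shows "continuous_map X T (\<lambda>x. f x \<oplus> g x)"
  using continuous_map_compose[OF continuous_map_pairedI[OF assms] continuous_add]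
  by (simp add: o_def)

lemma cont_mult:
  assumes "continuous_map X T f" "continuous_map X T g"
  shows "continuous_map X T (\<lambda>x. f x \<otimes> g x)"
  using continuous_map_compose[OF continuous_map_pairedI[OF assms] continuous_mult]
  by (simp add: o_def)

lemma cont_minus:
  assumes "continuous_map X T f"
  shows "continuous_map X T (\<lambda>x. \<ominus> f x)"
proof -
  have "continuous_map X T (\<lambda>x. (\<ominus> \<one>) \<otimes> f x)"
    by (intro cont_mult cont_const assms) auto
  then show ?thesis
    by (rule continuous_map_eq) (use continuous_map_carrier[OF assms] in \<open>auto simp: l_minus\<close>)
qed

lemma cont_diff:
  assumes "continuous_map X T f" "continuous_map X T g"
  shows "continuous_map X T (\<lambda>x. f x \<ominus> g x)"
  unfolding a_minus_def by (intro cont_add cont_minus assms)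

lemma cont_inv:
  assumes "continuous_map X T f" "\<And>x. x \<in> topspace X \<Longrightarrow> f x \<noteq> \<zero>"
  shows "continuous_map X T (\<lambda>x. inv (f x))"
proof -
  have "continuous_map X (subtopology T (carrier F - {\<zero>})) f"
    using assms continuous_map_carrier by (auto simp: continuous_map_in_subtopology)
  from continuous_map_compose[OF this continuous_inv] show ?thesis
    by (simp add: o_def)
qed

lemma cont_multiple:
  assumes "continuous_map X T f"
  shows "continuous_map X T (\<lambda>x. [(n::nat)] \<cdot> f x)"
proof (induction n)
  case 0
  have "continuous_map X T (\<lambda>x. \<zero>)" by (intro cont_const) simp
  then show ?case by simp
next
  case (Suc n)
  then show ?case
    by (simp add: cont_add assms)
qed

lemmas cont_intros = cont_const cont_add cont_mult cont_minus cont_diff cont_inv cont_multiple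
  continuous_map_id[unfolded id_def]

lemma diff_eq_zero: "a \<in> carrier F \<Longrightarrow> b \<in> carrier F \<Longrightarrow> a \<ominus> b = \<zero> \<longleftrightarrow> a = b"
  by (metis a_minus_def add.inv_closed add.inv_equality minus_equality r_neg minus_minus)

lemma diff_self: "a \<in> carrier F \<Longrightarrow> a \<ominus> a = \<zero>"
  by (simp add: a_minus_def r_neg)

lemma inv_closed: "a \<in> carrier F \<Longrightarrow> a \<noteq> \<zero> \<Longrightarrow> inv a \<in> carrier F"
  using field_Units by auto

lemma inv_right: "a \<in> carrier F \<Longrightarrow> a \<noteq> \<zero> \<Longrightarrow> a \<otimes> inv a = \<one>"
  using field_Units by auto

lemma inv_left: "a \<in> carrier F \<Longrightarrow> a \<noteq> \<zero> \<Longrightarrow> inv a \<otimes> a = \<one>"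
  using field_Units by auto

text \<open>The affine maps \<open>z \<mapsto> x + (z - a) s\<close> move any pair of distinct points to any pair of points. This
  is what makes separation and connectedness properties of a topological field uniform.\<close>

lemma affine_slope:
  assumes "a \<in> carrier F" "b \<in> carrier F" "a \<noteq> b" "d \<in> carrier F"
  shows "\<exists>s\<in>carrier F. (b \<ominus> a) \<otimes> s = d"
proof -
  have "b \<ominus> a \<noteq> \<zero>" using assms diff_eq_zero by blast
  then have i: "inv (b \<ominus> a) \<in> carrier F" "(b \<ominus> a) \<otimes> inv (b \<ominus> a) = \<one>"
    using assms inv_closed inv_right by auto
  have "(b \<ominus> a) \<otimes> (inv (b \<ominus> a) \<otimes> d) = ((b \<ominus> a) \<otimes> inv (b \<ominus> a)) \<otimes> d"
    using assms i(1) by (simp add: m_assoc)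
  then have "(b \<ominus> a) \<otimes> (inv (b \<ominus> a) \<otimes> d) = d"
    using assms i(2) by simp
  then show ?thesis using assms i by blast
qed

lemma add_diff_cancel: "a \<in> carrier F \<Longrightarrow> b \<in> carrier F \<Longrightarrow> a \<oplus> (b \<ominus> a) = b"
  by algebra

lemma open_vimage:
  "continuous_map X T f \<Longrightarrow> openin T U \<Longrightarrow> openin X {x \<in> topspace X. f x \<in> U}"
  by (rule openin_continuous_map_preimage)

lemma open_vimage_self:
  "continuous_map T T f \<Longrightarrow> openin T U \<Longrightarrow> openin T {x \<in> carrier F. f x \<in> U}"
  using open_vimage topspace_eq by metis

lemma open_carrier: "openin T U \<Longrightarrow> x \<in> U \<Longrightarrow> x \<in> carrier F"
  using openin_subset topspace_eq by blast

text \<open>A single proper nonempty open set, moved around by affine maps, separates all pairs of points; so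
  points are closed, and the diagonal is the inverse image of \<open>{\<zero>}\<close> under subtraction.\<close>

theorem Hausdorff: "Hausdorff_space T"
proof -
  obtain U where U: "openin T U" "U \<noteq> {}" "U \<noteq> carrier F"
    using not_indiscrete by blast
  then obtain u w where u: "u \<in> U" and w: "w \<in> carrier F" "w \<notin> U"
    using open_carrier by blast
  have uc: "u \<in> carrier F" and wu: "w \<ominus> u \<noteq> \<zero>"
    using U u w open_carrier diff_eq_zero by blast+
  have "\<exists>V. openin T V \<and> a \<in> V \<and> b \<notin> V" if ab: "a \<in> carrier F" "b \<in> carrier F" "a \<noteq> b" for a b
  proof -
    obtain s where s: "s \<in> carrier F" and sb: "(b \<ominus> a) \<otimes> s = w \<ominus> u"
      using affine_slope[of a b "w \<ominus> u"] ab uc w by auto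
    let ?V = "{x \<in> carrier F. u \<oplus> (x \<ominus> a) \<otimes> s \<in> U}"
    have "openin T ?V"
      by (intro open_vimage_self cont_intros U) (use ab uc s in auto)
    moreover have "a \<in> ?V" using ab u uc s by (simp add: diff_self)
    moreover have "u \<oplus> (b \<ominus> a) \<otimes> s = w"
      unfolding sb using uc w by (simp add: add_diff_cancel)
    then have "b \<notin> ?V" using w by simp
    ultimately show ?thesis by blast
  qed
  then have "t1_space T"
    unfolding t1_space_def topspace_eq by blast
  then have "closedin T {\<zero>}"
    by (simp add: t1_space_closedin_singleton topspace_eq)
  moreover have "continuous_map (prod_topology T T) T (\<lambda>p. fst p \<ominus> snd p)"
    by (intro cont_intros continuous_map_fst continuous_map_snd)
  ultimately have "closedin (prod_topology T T)
      {p \<in> topspace (prod_topology T T). fst p \<ominus> snd p \<in> {\<zero>}}"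
    using closedin_continuous_map_preimage by blast
  also have "\<dots> = (\<lambda>x. (x, x)) ` topspace T"
    by (auto simp: topspace_eq diff_eq_zero diff_self)
  finally show ?thesis
    by (simp add: Hausdorff_space_closedin_diagonal)
qed

lemma compact_imp_closed: "compactin T K \<Longrightarrow> closedin T K"
  using Hausdorff compactin_imp_closedin by blast

lemma closed_point: "a \<in> carrier F \<Longrightarrow> closedin T {a}"
  by (simp add: Hausdorff closedin_Hausdorff_singleton topspace_eq)

lemma open_nonzero: "openin T (carrier F - {\<zero>})"
  using closed_point[OF zero_closed] topspace_eq by (metis openin_diff openin_topspace)

lemma open_cozero:
  assumes "continuous_map X T f" shows "openin X {x \<in> topspace X. f x \<noteq> \<zero>}"
proof -
  have "{x \<in> topspace X. f x \<noteq> \<zero>} = {x \<in> topspace X. f x \<in> carrier F - {\<zero>}}"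
    using continuous_map_carrier[OF assms] by auto
  then show ?thesis using open_vimage[OF assms open_nonzero] by simp
qed

lemma closed_zero_set:
  assumes "continuous_map X T f" shows "closedin X {x \<in> topspace X. f x = \<zero>}"
  using closedin_continuous_map_preimage[OF assms closed_point[OF zero_closed]] by simp

text \<open>If a connected set had two points, its images under affine maps would connect any two points of
  the field.\<close>

lemma disconnected_imp_totally_disconnected:
  assumes "\<not> connected_space T" "connectedin T S" "a \<in> S" "b \<in> S"
  shows "a = b"
proof (rule ccontr)
  assume "a \<noteq> b"
  have ab: "a \<in> carrier F" "b \<in> carrier F"
    using assms connectedin_subset_topspace topspace_eq by blast+
  have "connected_space T"
    unfolding connected_space_subconnected topspace_eq
  proof (intro ballI)
    fix x y assume xy: "x \<in> carrier F" "y \<in> carrier F"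
    obtain s where s: "s \<in> carrier F" and sb: "(b \<ominus> a) \<otimes> s = y \<ominus> x"
      using affine_slope[of a b "y \<ominus> x"] ab xy \<open>a \<noteq> b\<close> by auto
    let ?h = "\<lambda>z. x \<oplus> (z \<ominus> a) \<otimes> s"
    have "connectedin T (?h ` S)"
      by (intro connectedin_continuous_map_image[OF _ assms(2)] cont_intros) (use ab xy s in auto)
    moreover have "?h a = x" using ab xy s by (simp add: diff_self)
    moreover have "?h b = y" unfolding sb using xy by (simp add: add_diff_cancel)
    ultimately show "\<exists>S. connectedin T S \<and> x \<in> S \<and> y \<in> S"
      using assms(3,4) by (intro exI[of _ "?h ` S"]) force
  qed
  then show False using assms(1) by simp
qed

text \<open>Uniform smallness: small times compact is small.\<close>

lemma tube_mult:
  assumes "compactin T K" "openin T U" "\<zero> \<in> U"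
  shows "\<exists>W. openin T W \<and> \<zero> \<in> W \<and> (\<forall>w\<in>W. \<forall>k\<in>K. w \<otimes> k \<in> U)"
proof -
  have K: "K \<subseteq> carrier F" using assms(1) compactin_subset_topspace topspace_eq by blast
  let ?P = "{p \<in> topspace (prod_topology T T). fst p \<otimes> snd p \<in> U}"
  have "openin (prod_topology T T) ?P"
    by (intro open_vimage cont_intros continuous_map_fst continuous_map_snd assms)
  moreover have "{\<zero>} \<times> K \<subseteq> ?P"
    using K assms(3) by (auto simp: topspace_eq)
  ultimately obtain W V where "openin T W" "\<zero> \<in> W" "K \<subseteq> V" "W \<times> V \<subseteq> ?P"
    using tube_lemma_right[of T T ?P K \<zero>] assms(1) by (auto simp: topspace_eq)
  then show ?thesis by (intro exI[of _ W]) fastforce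
qed

lemma compact_multiples:
  assumes "compactin T K" "c \<in> carrier F"
  shows "compactin T ((\<lambda>x. c \<otimes> x) ` K)"
  by (rule image_compactin[OF assms(1)]) (intro cont_intros assms)

lemma compact_sum:
  assumes "compactin T K" "compactin T L"
  shows "compactin T {x \<oplus> y |x y. x \<in> K \<and> y \<in> L}"
proof -
  have "compactin (prod_topology T T) (K \<times> L)"
    using assms by (simp add: compactin_Times)
  moreover have "continuous_map (prod_topology T T) T (\<lambda>p. fst p \<oplus> snd p)"
    by (intro cont_intros continuous_map_fst continuous_map_snd)
  ultimately have "compactin T ((\<lambda>p. fst p \<oplus> snd p) ` (K \<times> L))"
    by (rule image_compactin)
  moreover have "(\<lambda>p. fst p \<oplus> snd p) ` (K \<times> L) = {x \<oplus> y |x y. x \<in> K \<and> y \<in> L}"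
    by force
  ultimately show ?thesis by simp
qed

text \<open>Inversion carries small elements out of any given compact set, since otherwise small times
  compact could reach \<open>\<one>\<close>.\<close>

lemma small_imp_inverse_large:
  assumes "compactin T K"
  shows "\<exists>W. openin T W \<and> \<zero> \<in> W \<and> (\<forall>w\<in>W. w \<noteq> \<zero> \<longrightarrow> inv w \<notin> K)"
proof -
  have "openin T (carrier F - {\<one>})"
    using closed_point[OF one_closed] topspace_eq by (metis openin_diff openin_topspace)
  from tube_mult[OF assms this] obtain W
    where W: "openin T W" "\<zero> \<in> W" "\<And>w k. w \<in> W \<Longrightarrow> k \<in> K \<Longrightarrow> w \<otimes> k \<noteq> \<one>"
    by auto
  have "inv w \<notin> K" if "w \<in> W" "w \<noteq> \<zero>" for w
    using W(3)[of w "inv w"] inv_right[of w] open_carrier[OF W(1)] that by auto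
  then show ?thesis
    using W(1,2) by blast
qed

lemma connected_imp_nondiscrete:
  assumes "connected_space T" "openin T N" "\<zero> \<in> N"
  shows "\<exists>a\<in>N. a \<noteq> \<zero>"
proof (rule ccontr)
  assume "\<not> ?thesis"
  with assms(3) have "N = {\<zero>}" by blast
  with assms(2) have "openin T {\<zero>}" by simp
  then have "{\<zero>} = carrier F"
    using assms(1) closed_point[OF zero_closed] by (auto simp: connected_space_clopen_in topspace_eq)
  then have "\<one> \<in> {\<zero>}" using one_closed by simp
  then show False using zero_not_one by simp
qed

text \<open>In a compact field \<open>small_imp_inverse_large\<close> would leave \<open>\<zero>\<close> isolated.\<close>

lemma connected_imp_not_compact:
  assumes "connected_space T"
  shows "\<not> compactin T (carrier F)"
proof
  assume "compactin T (carrier F)"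
  from small_imp_inverse_large[OF this] obtain W
    where W: "openin T W" "\<zero> \<in> W" "\<forall>w\<in>W. w \<noteq> \<zero> \<longrightarrow> inv w \<notin> carrier F"
    by (elim exE conjE)
  obtain a where "a \<in> W" "a \<noteq> \<zero>"
    using connected_imp_nondiscrete[OF assms W(1,2)] by (elim bexE)
  moreover from this have "inv a \<in> carrier F"
    using inv_closed open_carrier[OF W(1)] by simp
  ultimately show False
    using W(3) by simp
qed

lemma connected_imp_common_small:
  assumes "connected_space T" "openin T N" "\<zero> \<in> N" "openin T N'" "\<zero> \<in> N'"
  shows "\<exists>a\<in>N \<inter> N'. a \<noteq> \<zero>"
  using connected_imp_nondiscrete[OF assms(1) openin_Int[OF assms(2,4)]] assms(3,5) by simp

end

text \<open>Cluster points along a filter base, in a form that serves for sequences and for the net of all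
  nonzero elements tending to \<open>\<zero>\<close>: if every point had a neighbourhood that the net eventually avoids,
  finitely many of these would cover, and a common tail would have nowhere to go.\<close>

lemma compact_space_cluster_point:
  assumes "compact_space P" and "\<And>a. a \<in> A \<Longrightarrow> f a \<in> topspace P"
    and ne: "\<N> \<noteq> {}" and Int: "\<And>M N. M \<in> \<N> \<Longrightarrow> N \<in> \<N> \<Longrightarrow> M \<inter> N \<in> \<N>"
    and freq: "\<And>N. N \<in> \<N> \<Longrightarrow> N \<inter> A \<noteq> {}"
  shows "\<exists>p\<in>topspace P. \<forall>W N. openin P W \<longrightarrow> p \<in> W \<longrightarrow> N \<in> \<N> \<longrightarrow> (\<exists>a\<in>N \<inter> A. f a \<in> W)"
proof (rule ccontr)
  assume neg: "\<not> ?thesis"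
  define \<W> where "\<W> = {W. openin P W \<and> (\<exists>N\<in>\<N>. \<forall>a\<in>N \<inter> A. f a \<notin> W)}"
  have "topspace P \<subseteq> \<Union>\<W>"
  proof
    fix p assume "p \<in> topspace P"
    with neg obtain W N where "openin P W" "p \<in> W" "N \<in> \<N>" "\<not> (\<exists>a\<in>N \<inter> A. f a \<in> W)"
      by auto
    then have "W \<in> \<W>" unfolding \<W>_def by auto
    with \<open>p \<in> W\<close> show "p \<in> \<Union>\<W>" by auto
  qed
  moreover have "\<forall>W\<in>\<W>. openin P W"
    unfolding \<W>_def by simp
  ultimately obtain \<F> where \<F>: "finite \<F>" "\<F> \<subseteq> \<W>" "topspace P \<subseteq> \<Union>\<F>"
    using assms(1) unfolding compact_space_alt by meson
  have "\<exists>M\<in>\<N>. \<forall>W\<in>\<F>. \<forall>a\<in>M \<inter> A. f a \<notin> W"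
    using \<F>(1,2)
  proof (induction \<F>)
    case empty
    then show ?case using ne by auto
  next
    case (insert W \<F>)
    then obtain M where M: "M \<in> \<N>" "\<forall>W\<in>\<F>. \<forall>a\<in>M \<inter> A. f a \<notin> W" by auto
    obtain N where N: "N \<in> \<N>" "\<forall>a\<in>N \<inter> A. f a \<notin> W"
      using insert.prems unfolding \<W>_def by auto
    show ?case
      by (rule bexI[OF _ Int[OF M(1) N(1)]]) (use M(2) N(2) in auto)
  qed
  then obtain M where M: "M \<in> \<N>" "\<And>W a. W \<in> \<F> \<Longrightarrow> a \<in> M \<inter> A \<Longrightarrow> f a \<notin> W" by blast
  obtain a where a: "a \<in> M" "a \<in> A" using freq[OF M(1)] by auto
  then obtain W where "W \<in> \<F>" "f a \<in> W" using assms(2)[of a] \<F>(3) by auto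
  then show False using M(2)[of W a] a by simp
qed

section \<open>A path in a connected locally compact field: unbounded multiples\<close>

context topological_field
begin

text \<open>No nonzero element has all its multiples in \<open>V\<close>, so the compact sets of those \<open>y\<close> whose first \<open>m\<close>
  multiples lie in \<open>V\<close> shrink to \<open>\<zero>\<close>. This is the absence of small subgroups in quantitative form.\<close>

lemma multiples_small:
  assumes V: "compactin T V" and escape: "\<And>y. y \<in> carrier F \<Longrightarrow> y \<noteq> \<zero> \<Longrightarrow> \<exists>n::nat. [n] \<cdot> y \<notin> V"
    and U: "openin T U" "\<zero> \<in> U"
  shows "\<exists>m::nat. \<forall>y\<in>V. (\<forall>k\<le>m. [k] \<cdot> y \<in> V) \<longrightarrow> y \<in> U"
proof -
  have Vc: "V \<subseteq> carrier F" using V compactin_subset_topspace topspace_eq by blast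
  define \<W> where "\<W> = insert U (range (\<lambda>n::nat. {y \<in> carrier F. [n] \<cdot> y \<in> carrier F - V}))"
  have "openin T (carrier F - V)"
    using compact_imp_closed[OF V] topspace_eq by (metis openin_diff openin_topspace)
  then have "\<forall>W\<in>\<W>. openin T W"
    unfolding \<W>_def using U(1) by (auto simp del: Diff_iff intro!: open_vimage_self cont_intros)
  moreover have "V \<subseteq> \<Union>\<W>"
  proof
    fix y assume y: "y \<in> V"
    show "y \<in> \<Union>\<W>"
    proof (cases "y = \<zero>")
      case True
      then show ?thesis using U(2) unfolding \<W>_def by auto
    next
      case False
      then obtain n :: nat where "[n] \<cdot> y \<notin> V" using escape y Vc by auto
      then have "y \<in> {y \<in> carrier F. [n] \<cdot> y \<in> carrier F - V}" using y Vc by auto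
      then show ?thesis unfolding \<W>_def by auto
    qed
  qed
  ultimately obtain \<F> where \<F>: "finite \<F>" "\<F> \<subseteq> \<W>" "V \<subseteq> \<Union>\<F>"
    using V unfolding compactin_def by meson
  have "\<exists>m::nat. \<forall>W\<in>\<F>. \<forall>y\<in>W. y \<in> U \<or> (\<exists>k\<le>m. [k] \<cdot> y \<notin> V)"
    using \<F>(1,2)
  proof (induction \<F>)
    case (insert W \<F>)
    then obtain m :: nat where m: "\<forall>W\<in>\<F>. \<forall>y\<in>W. y \<in> U \<or> (\<exists>k\<le>m. [k] \<cdot> y \<notin> V)" by auto
    obtain n :: nat where n: "\<forall>y\<in>W. y \<in> U \<or> [n] \<cdot> y \<notin> V"
      using insert.prems unfolding \<W>_def by auto
    have "\<forall>W\<in>insert W \<F>. \<forall>y\<in>W. y \<in> U \<or> (\<exists>k\<le>max m n. [k] \<cdot> y \<notin> V)"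
      using m n by (metis insert_iff max.cobounded2 max.coboundedI1)
    then show ?case by blast
  qed auto
  then obtain m :: nat where "\<forall>W\<in>\<F>. \<forall>y\<in>W. y \<in> U \<or> (\<exists>k\<le>m. [k] \<cdot> y \<notin> V)" ..
  then show ?thesis
    using \<F>(3) by (intro exI[of _ m]) (meson Union_iff subsetD)
qed

text \<open>For each small \<open>a \<noteq> \<zero>\<close>, walk through the multiples of \<open>a\<close> at such a speed that time \<open>1\<close> is the last
  moment before the first exit from \<open>V\<close>. By Tychonoff's theorem for \<open>V\<close> to the power \<open>{0..1}\<close>, these walks have
  a cluster point \<open>j\<close> as \<open>a\<close> tends to \<open>\<zero>\<close>. It is additive because each walk is additive up to one step
  \<open>a\<close>; it is continuous because \<open>j t\<close> has its first \<open>m\<close> multiples in \<open>V\<close> when \<open>t \<le> 1 / m\<close>; and \<open>j 1\<close>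
  is not \<open>\<zero>\<close>, being one step away from the complement of \<open>V\<close>.\<close>

lemma path_if_multiples_escape:
  assumes conn: "connected_space T"
    and V: "compactin T V" "openin T V0" "\<zero> \<in> V0" "V0 \<subseteq> V"
    and escape: "\<And>y. y \<in> carrier F \<Longrightarrow> y \<noteq> \<zero> \<Longrightarrow> \<exists>n::nat. [n] \<cdot> y \<notin> V"
  shows "\<exists>j. continuous_map (top_of_set {0..1::real}) T j \<and> j 0 = \<zero> \<and> j 1 = \<one>"
proof -
  have Vc: "V \<subseteq> carrier F" using V compactin_subset_topspace topspace_eq by blast
  have zV: "\<zero> \<in> V" using V by auto
  \<comment> \<open>the last multiple before the first exit from \<open>V\<close>\<close>
  define q where "q a = (LEAST n. [Suc n] \<cdot> a \<notin> V)" for a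
  have q_exit: "[Suc (q a)] \<cdot> a \<notin> V" if a: "a \<in> carrier F" "a \<noteq> \<zero>" for a
  proof -
    obtain n :: nat where n: "[n] \<cdot> a \<notin> V" using escape[OF a] by (elim exE)
    then have "n \<noteq> 0" using zV by (metis add.nat_pow_0)
    then have "[Suc (n - 1)] \<cdot> a \<notin> V" using n by simp
    then show ?thesis unfolding q_def by (rule LeastI)
  qed
  have q_in: "[k] \<cdot> a \<in> V" if "a \<in> carrier F" "k \<le> q a" for a k
  proof (cases k)
    case 0
    then show ?thesis using zV by simp
  next
    case (Suc i)
    then have "i < q a" using that by simp
    then show ?thesis
      using not_less_Least[of i "\<lambda>n. [Suc n] \<cdot> a \<notin> V"] unfolding Suc q_def by simp
  qed
  define ja where "ja a = (\<lambda>t\<in>{0..1::real}. [nat \<lfloor>t * real (q a)\<rfloor>] \<cdot> a)" for a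
  define P where "P = product_topology (\<lambda>_. subtopology T V) {0..1::real}"
  have "compact_space (subtopology T V)" using V(1) compact_space_subtopology by blast
  then have cP: "compact_space P"
    unfolding P_def by (simp add: compact_space_product_topology)
  have topP: "topspace P = {0..1} \<rightarrow>\<^sub>E V"
    unfolding P_def using Vc topspace_eq by (simp add: inf.absorb2)
  have fl: "nat \<lfloor>t * real n\<rfloor> \<le> n" if "t \<in> {0..1}" for t and n :: nat
  proof -
    have "t * real n \<le> real n" using that by (simp add: mult_left_le_one_le)
    then show ?thesis by linarith
  qed
  have "ja a \<in> topspace P" if "a \<in> carrier F" for a
    unfolding topP ja_def using q_in[OF that fl] by auto
  then have "\<exists>j\<in>topspace P. \<forall>W N. openin P W \<longrightarrow> j \<in> W \<longrightarrow> N \<in> {N. openin T N \<and> \<zero> \<in> N} \<longrightarrow>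
      (\<exists>a\<in>N \<inter> (carrier F - {\<zero>}). ja a \<in> W)"
  proof (intro compact_space_cluster_point[OF cP])
    show "N \<inter> (carrier F - {\<zero>}) \<noteq> {}" if "N \<in> {N. openin T N \<and> \<zero> \<in> N}" for N
    proof -
      have "openin T N" "\<zero> \<in> N" using that by auto
      then obtain a where "a \<in> N" "a \<noteq> \<zero>" using connected_imp_nondiscrete[OF conn] by meson
      then show ?thesis using open_carrier[OF \<open>openin T N\<close>] by auto
    qed
    have "carrier F \<in> {N. openin T N \<and> \<zero> \<in> N}"
      using openin_topspace[of T] unfolding topspace_eq by simp
    then show "{N. openin T N \<and> \<zero> \<in> N} \<noteq> {}" by auto
  qed auto
  then obtain j where j: "j \<in> topspace P"
    and clus: "\<And>W N. openin P W \<Longrightarrow> j \<in> W \<Longrightarrow> openin T N \<Longrightarrow> \<zero> \<in> N \<Longrightarrow>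
      \<exists>a\<in>N. a \<in> carrier F \<and> a \<noteq> \<zero> \<and> ja a \<in> W"
    by fast
  have proj: "continuous_map P T (\<lambda>x. x t)" if "t \<in> {0..1}" for t
    unfolding P_def
    using continuous_map_into_fulltopology[OF continuous_map_product_projection[OF that]] .
  have jV: "j t \<in> V" if "t \<in> {0..1}" for t
    using j that unfolding topP by auto
  have jc: "j t \<in> carrier F" if "t \<in> {0..1}" for t
    using jV[OF that] Vc by auto
  \<comment> \<open>the rounding error of \<open>ja a\<close> is at most one step \<open>a\<close>, which disappears in the limit\<close>
  have j_add: "j (s + t) = j s \<oplus> j t" if st: "s \<in> {0..1}" "t \<in> {0..1}" "s + t \<in> {0..1}" for s t
  proof (rule ccontr)
    define h where "h x = x (s + t) \<ominus> (x s \<oplus> x t)" for x :: "real \<Rightarrow> 'f"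
    assume "j (s + t) \<noteq> j s \<oplus> j t"
    then have "h j \<noteq> \<zero>" "h j \<in> carrier F"
      unfolding h_def using jc st by (auto simp: diff_eq_zero)
    then obtain A N where AN: "openin T A" "openin T N" "h j \<in> A" "\<zero> \<in> N" "disjnt A N"
      using Hausdorff unfolding Hausdorff_space_def topspace_eq by (meson zero_closed)
    have "continuous_map P T h"
      unfolding h_def by (intro cont_intros proj st)
    then have "openin P {x \<in> topspace P. h x \<in> A}"
      using open_vimage AN(1) by blast
    from clus[OF this _ AN(2,4)] obtain a where a: "a \<in> N" "a \<in> carrier F" "h (ja a) \<in> A"
      using j AN(3) by auto
    define m1 where "m1 = nat \<lfloor>s * real (q a)\<rfloor>"
    define m2 where "m2 = nat \<lfloor>t * real (q a)\<rfloor>"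
    define m where "m = nat \<lfloor>(s + t) * real (q a)\<rfloor>"
    have "m = m1 + m2 \<or> m = Suc (m1 + m2)"
    proof -
      have "0 \<le> s * real (q a)" "0 \<le> t * real (q a)" using st by auto
      then show ?thesis
        unfolding m_def m1_def m2_def distrib_right by linarith
    qed
    moreover have "h (ja a) = ([m] \<cdot> a) \<ominus> ([(m1 + m2)] \<cdot> a)"
      unfolding h_def ja_def m_def m1_def m2_def using st a(2) by (simp add: add.nat_pow_mult)
    moreover have "([(Suc (m1 + m2))] \<cdot> a) \<ominus> ([(m1 + m2)] \<cdot> a) = a"
    proof -
      have "b \<oplus> a \<ominus> b = a" if "b \<in> carrier F" for b
        using that a(2) by algebra
      then show ?thesis using a(2) by simp
    qed
    ultimately have "h (ja a) \<in> N"
      using a AN(4) by (auto simp: diff_self)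
    then show False using AN(5) a(3) by (auto simp: disjnt_iff)
  qed
  have j0: "j 0 = \<zero>"
    using j_add[of 0 0] jc[of 0] by simp
  have j1: "j 1 \<noteq> \<zero>"
  proof
    assume j1: "j 1 = \<zero>"
    let ?S = "{p \<in> topspace (prod_topology T T). fst p \<oplus> snd p \<in> V0}"
    have "openin (prod_topology T T) ?S"
      by (intro open_vimage cont_intros continuous_map_fst continuous_map_snd V)
    moreover have "(\<zero>, \<zero>) \<in> ?S" using V(3) by (simp add: topspace_eq)
    ultimately obtain A N where AN: "openin T A" "openin T N" "\<zero> \<in> A" "\<zero> \<in> N" "A \<times> N \<subseteq> ?S"
      unfolding openin_prod_topology_alt by meson
    have "openin P {x \<in> topspace P. x 1 \<in> A}"
      using open_vimage[OF proj AN(1)] by simp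
    from clus[OF this _ AN(2,4)] obtain a
      where a: "a \<in> N" "a \<in> carrier F" "a \<noteq> \<zero>" "ja a 1 \<in> A"
      using j AN(3) j1 by auto
    have "(ja a 1, a) \<in> ?S" using AN(5) a by auto
    then have "ja a 1 \<oplus> a \<in> V" using V(4) by auto
    moreover have "ja a 1 \<oplus> a = [Suc (q a)] \<cdot> a" unfolding ja_def using a(2) by simp
    ultimately show False using q_exit[OF a(2,3)] by simp
  qed
  have j_mult: "j (real k * t) = [k] \<cdot> j t" if "t \<in> {0..1}" "real k * t \<le> 1" for k t
    using that(2)
  proof (induction k)
    case 0
    then show ?case using j0 by simp
  next
    case (Suc k)
    then have le: "real k * t \<le> 1" "real k * t + t \<le> 1" using that(1) by (auto simp: algebra_simps)
    have "j (real k * t + t) = j (real k * t) \<oplus> j t"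
      using that(1) le by (intro j_add) auto
    then show ?case using Suc.IH le by (simp add: algebra_simps)
  qed
  have j_small: "\<exists>d>0. \<forall>t\<in>{0..1}. t < d \<longrightarrow> j t \<in> U" if U: "openin T U" "\<zero> \<in> U" for U
  proof -
    obtain m :: nat where m: "\<And>y. y \<in> V \<Longrightarrow> (\<forall>k\<le>m. [k] \<cdot> y \<in> V) \<Longrightarrow> y \<in> U"
      using multiples_small[OF V(1) escape U] by meson
    have "j t \<in> U" if t: "t \<in> {0..1}" "t < 1 / real (Suc m)" for t
    proof (rule m[OF jV[OF t(1)]], intro allI impI)
      fix k assume "k \<le> m"
      then have "real k * t \<le> real (Suc m) * t" using t(1) by (intro mult_right_mono) auto
      also have "\<dots> \<le> 1" using t(2) by (simp add: field_simps)
      finally have "real k * t \<le> 1" .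
      then show "[k] \<cdot> j t \<in> V"
        using j_mult[OF t(1), of k] jV[of "real k * t"] t(1) by simp
    qed
    then show ?thesis by (intro exI[of _ "1 / real (Suc m)"]) simp
  qed
  have j_diff: "j t = j s \<oplus> j (t - s)" if "s \<in> {0..1}" "t \<in> {0..1}" "s \<le> t" for s t
    using j_add[of s "t - s"] that by simp
  have cj: "continuous_map (top_of_set {0..1}) T j"
    unfolding continuous_map_eq_topcontinuous_at topcontinuous_at_def
  proof (intro ballI conjI allI impI; (elim conjE)?)
    show "j \<in> topspace (top_of_set {0..1}) \<rightarrow> topspace T"
      using jc topspace_eq by auto
    fix s U assume s: "s \<in> topspace (top_of_set {0..1::real})" and U: "openin T U" "j s \<in> U"
    have s01: "s \<in> {0..1}" using s by simp
    let ?U1 = "{y \<in> carrier F. j s \<oplus> y \<in> U}" and ?U2 = "{y \<in> carrier F. j s \<ominus> y \<in> U}"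
    have "openin T ?U1" "openin T ?U2"
      by (intro open_vimage_self cont_intros U jc s01)+
    moreover have "\<zero> \<in> ?U1" "\<zero> \<in> ?U2" using U(2) jc[OF s01] by (auto simp: a_minus_def)
    ultimately obtain d where d: "d > 0" "\<And>t. t \<in> {0..1} \<Longrightarrow> t < d \<Longrightarrow> j t \<in> ?U1 \<inter> ?U2"
      using j_small[OF openin_Int, of ?U1 ?U2] by auto
    have "j t \<in> U" if t: "t \<in> {0..1}" "dist s t < d" for t
    proof (cases "s \<le> t")
      case True
      then have "j (t - s) \<in> ?U1" using d(2)[of "t - s"] t s01 by (auto simp: dist_real_def)
      then show ?thesis using j_diff[OF s01 t(1) True] by simp
    next
      case False
      then have *: "j (s - t) \<in> ?U2" using d(2)[of "s - t"] t s01 by (auto simp: dist_real_def)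
      have "j s = j t \<oplus> j (s - t)" using j_diff[OF t(1) s01] False by simp
      moreover have "j t \<in> carrier F" "j (s - t) \<in> carrier F"
        using jc[OF t(1)] jc[of "s - t"] t(1) s01 False by auto
      ultimately have "j s \<ominus> j (s - t) = j t" by (simp add: a_minus_def a_assoc r_neg)
      then show ?thesis using * by simp
    qed
    moreover have "openin (top_of_set {0..1}) ({0..1} \<inter> ball s d)"
      by (simp add: openin_open_Int)
    ultimately show "\<exists>W. openin (top_of_set {0..1}) W \<and> s \<in> W \<and> (\<forall>t\<in>W. j t \<in> U)"
      using s01 d(1) by (intro exI[of _ "{0..1} \<inter> ball s d"]) auto
  qed
  have j1c: "j 1 \<in> carrier F" by (rule jc) simp
  have "continuous_map (top_of_set {0..1}) T (\<lambda>t. inv (j 1) \<otimes> j t)"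
    by (intro cont_intros cj inv_closed j1 j1c)
  then show ?thesis
    using j0 j1 j1c inv_left inv_closed by (intro exI[of _ "\<lambda>t. inv (j 1) \<otimes> j t"]) simp
qed

end

section \<open>Bounded multiples are impossible in a connected locally compact field\<close>

context topological_field
begin

text \<open>An additive subgroup that is closed under multiplication by \<open>p\<close>, that is, a \<open>Z[p]\<close>-submodule of
  \<open>F\<close>. Only the operator \<open>p\<close> is recorded, which avoids speaking about the ring \<open>Z[p]\<close> itself.\<close>

definition stable_subgroup :: "'f \<Rightarrow> 'f set \<Rightarrow> bool" where
  "stable_subgroup p N \<longleftrightarrow> N \<subseteq> carrier F \<and> \<zero> \<in> N \<and>
     (\<forall>x\<in>N. \<forall>y\<in>N. x \<oplus> y \<in> N) \<and> (\<forall>x\<in>N. \<ominus> x \<in> N) \<and> (\<forall>x\<in>N. p \<otimes> x \<in> N)"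

lemma stable_subgroupD:
  assumes "stable_subgroup p N"
  shows "N \<subseteq> carrier F" "\<zero> \<in> N" "\<And>x y. x \<in> N \<Longrightarrow> y \<in> N \<Longrightarrow> x \<oplus> y \<in> N"
    "\<And>x. x \<in> N \<Longrightarrow> \<ominus> x \<in> N" "\<And>x. x \<in> N \<Longrightarrow> p \<otimes> x \<in> N"
  using assms unfolding stable_subgroup_def by auto

text \<open>The polynomials in \<open>p\<close> with coefficients in \<open>H\<close>, in Horner form: with this form, \<open>H + p Q \<subseteq> Q\<close>
  bounds them by \<open>Q\<close> in one induction.\<close>

inductive_set adjoin :: "'f set \<Rightarrow> 'f \<Rightarrow> 'f set" for H :: "'f set" and p :: 'f where
  zero: "\<zero> \<in> adjoin H p"
| horner: "h \<in> H \<Longrightarrow> x \<in> adjoin H p \<Longrightarrow> h \<oplus> p \<otimes> x \<in> adjoin H p"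

lemma stable_subgroup_adjoin:
  assumes p: "p \<in> carrier F" and H: "H \<subseteq> carrier F" "\<zero> \<in> H"
    "\<And>x y. x \<in> H \<Longrightarrow> y \<in> H \<Longrightarrow> x \<oplus> y \<in> H" "\<And>x. x \<in> H \<Longrightarrow> \<ominus> x \<in> H"
  shows "stable_subgroup p (adjoin H p)"
proof -
  have c: "x \<in> carrier F" if "x \<in> adjoin H p" for x
    using that by induction (use p H in auto)
  have add: "x \<oplus> y \<in> adjoin H p" if "x \<in> adjoin H p" "y \<in> adjoin H p" for x y
    using that
  proof (induction arbitrary: y)
    case zero
    then show ?case using c by simp
  next
    case (horner h x)
    note h = horner
    show ?case
      using h(4)
    proof cases
      case zero
      then show ?thesis using adjoin.horner[OF h(1,2)] c[OF h(2)] h(1) p H(1) by auto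
    next
      case (horner h' x')
      have "h \<oplus> p \<otimes> x \<oplus> y = (h \<oplus> h') \<oplus> p \<otimes> (x \<oplus> x')"
        unfolding horner(1) using h(1) horner(2) c[OF h(2)] c[OF horner(3)] p subsetD[OF H(1)]
        by algebra
      then show ?thesis
        using adjoin.horner[OF H(3)[OF h(1) horner(2)] h(3)[OF horner(3)]] by simp
    qed
  qed
  have neg: "\<ominus> x \<in> adjoin H p" if "x \<in> adjoin H p" for x
    using that
  proof induction
    case zero
    then show ?case using adjoin.zero by simp
  next
    case (horner h x)
    have "\<ominus> (h \<oplus> p \<otimes> x) = \<ominus> h \<oplus> p \<otimes> (\<ominus> x)"
      using horner(1) c[OF horner(2)] p subsetD[OF H(1)] by algebra
    then show ?case using adjoin.horner[OF H(4)[OF horner(1)] horner(3)] by simp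
  qed
  have mult: "p \<otimes> x \<in> adjoin H p" if "x \<in> adjoin H p" for x
    using adjoin.horner[OF H(2) that] c[OF that] p by simp
  show ?thesis
    unfolding stable_subgroup_def using c add neg mult adjoin.zero by auto
qed

lemma adjoin_contains:
  assumes "p \<in> carrier F" "H \<subseteq> carrier F" "h \<in> H"
  shows "h \<in> adjoin H p"
  using adjoin.horner[OF assms(3) adjoin.zero, of p] assms by auto

lemma power_in_stable_subgroup:
  assumes "stable_subgroup p N" "x \<in> N" "p \<in> carrier F"
  shows "p [^] (k::nat) \<otimes> x \<in> N"
proof (induction k)
  case 0
  then show ?case using assms(2) stable_subgroupD(1)[OF assms(1)] by auto
next
  case (Suc k)
  have "x \<in> carrier F" using assms(2) stable_subgroupD(1)[OF assms(1)] by auto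
  then have "p [^] Suc k \<otimes> x = p \<otimes> (p [^] k \<otimes> x)"
    using assms(3) by (simp add: m_comm m_lcomm)
  then show ?case using stable_subgroupD(5)[OF assms(1) Suc] by simp
qed

lemma stable_subgroup_closure:
  assumes N: "stable_subgroup p N" and p: "p \<in> carrier F"
  shows "stable_subgroup p (T closure_of N)"
proof -
  let ?C = "T closure_of N"
  have sub: "N \<subseteq> ?C" "?C \<subseteq> carrier F"
    using stable_subgroupD(1)[OF N] topspace_eq closure_of_subset closure_of_subset_topspace by metis+
  have add: "x \<oplus> y \<in> ?C" if "x \<in> ?C" "y \<in> ?C" for x y
  proof -
    have "(\<lambda>q. fst q \<oplus> snd q) ` (prod_topology T T closure_of (N \<times> N))
        \<subseteq> T closure_of ((\<lambda>q. fst q \<oplus> snd q) ` (N \<times> N))"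
      by (intro continuous_map_image_closure_subset cont_intros continuous_map_fst continuous_map_snd)
    also have "\<dots> \<subseteq> ?C"
      by (intro closure_of_mono) (use stable_subgroupD(3)[OF N] in auto)
    finally show ?thesis using that unfolding closure_of_Times by force
  qed
  have unary: "f x \<in> ?C" if "continuous_map T T f" "\<And>x. x \<in> N \<Longrightarrow> f x \<in> N" "x \<in> ?C" for f x
  proof -
    have "f ` ?C \<subseteq> T closure_of (f ` N)"
      using continuous_map_image_closure_subset[OF that(1)] .
    also have "\<dots> \<subseteq> ?C" by (intro closure_of_mono) (use that(2) in auto)
    finally show ?thesis using that(3) by auto
  qed
  have "\<ominus> x \<in> ?C" "p \<otimes> x \<in> ?C" if "x \<in> ?C" for x
    by (rule unary[OF _ _ that]; use stable_subgroupD[OF N] p in \<open>auto intro!: cont_intros\<close>)+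
  then show ?thesis
    unfolding stable_subgroup_def using sub add stable_subgroupD(2)[OF N] by auto
qed

text \<open>A cluster point \<open>l \<noteq> \<zero>\<close> of the bounded sequence of powers would make some quotient \<open>p\<^sup>m / p\<^sup>k\<close>, with
  \<open>k < m\<close>, close to \<open>1\<close>. Then \<open>p\<^sup>m\<^sup>-\<^sup>k\<^sup>-\<^sup>1\<close> is close to \<open>1 / p\<close>, but \<open>1 / p\<close> has
  a neighbourhood outside the closed set \<open>Q\<close>, which contains all powers.\<close>

lemma powers_tend_to_zero:
  assumes Q: "compactin T Q" and p: "p \<in> carrier F" "p \<noteq> \<zero>" "inv p \<notin> Q"
    and pow: "\<And>k::nat. p [^] k \<in> Q" and U: "openin T U" "\<zero> \<in> U"
  shows "\<exists>k::nat. p [^] k \<in> U"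
proof -
  have Qc: "Q \<subseteq> carrier F" using Q compactin_subset_topspace topspace_eq by blast
  have "\<exists>l\<in>topspace (subtopology T Q). \<forall>W N. openin (subtopology T Q) W \<longrightarrow> l \<in> W \<longrightarrow>
      N \<in> range (\<lambda>n::nat. {n..}) \<longrightarrow> (\<exists>k\<in>N \<inter> UNIV. p [^] k \<in> W)" (is "Bex _ ?clus")
  proof (rule compact_space_cluster_point[OF compact_space_subtopology[OF Q]])
    show "M \<inter> N \<in> range (\<lambda>n::nat. {n..})"
      if "M \<in> range (\<lambda>n::nat. {n..})" "N \<in> range (\<lambda>n::nat. {n..})" for M N
    proof -
      obtain m n where "M = {m..}" "N = {n..}" using \<open>M \<in> _\<close> \<open>N \<in> _\<close> by auto
      then have "M \<inter> N = {max m n..}" by auto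
      then show ?thesis by auto
    qed
  qed (use pow Qc topspace_eq in auto)
  then obtain l where l: "l \<in> Q" and cl: "?clus l"
    by auto
  have clus: "\<exists>k\<ge>n. p [^] (k::nat) \<in> W" if "openin T W" "l \<in> W" for W n
    using cl[rule_format, of "Q \<inter> W" "{n..}"] l that by (auto simp: openin_subtopology_Int2)
  show ?thesis
  proof (cases "l = \<zero>")
    case True
    then show ?thesis using clus[OF U(1)] U(2) by auto
  next
    case False
    have lc: "l \<in> carrier F" using l Qc by auto
    let ?X = "prod_topology (subtopology T (carrier F - {\<zero>})) T"
    let ?S = "{q \<in> topspace ?X. inv p \<otimes> (snd q \<otimes> inv (fst q)) \<in> carrier F - Q}"
    have "openin T (carrier F - Q)"
      using compact_imp_closed[OF Q] topspace_eq by (metis openin_diff openin_topspace)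
    moreover have "continuous_map ?X T fst"
      using continuous_map_into_fulltopology continuous_map_fst by blast
    ultimately have "openin ?X ?S"
      by (intro open_vimage cont_intros continuous_map_snd inv_closed p) auto
    moreover have "(l, l) \<in> ?S"
      using lc False inv_right[OF lc] inv_closed p by (auto simp: topspace_eq)
    ultimately obtain A B where AB: "openin (subtopology T (carrier F - {\<zero>})) A" "openin T B"
        "l \<in> A" "l \<in> B" "A \<times> B \<subseteq> ?S"
      unfolding openin_prod_topology_alt by meson
    have A: "openin T A" using AB(1) open_nonzero openin_trans_full by blast
    obtain k where k: "p [^] (k::nat) \<in> A" using clus[OF A AB(3)] by auto
    obtain m where m: "m \<ge> Suc k" "p [^] (m::nat) \<in> B" using clus[OF AB(2,4)] by auto
    have "(p [^] k, p [^] m) \<in> ?S" using AB(5) k m by auto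
    then have 1: "inv p \<otimes> (p [^] m \<otimes> inv (p [^] k)) \<notin> Q" "p [^] k \<noteq> \<zero>" by auto
    obtain d where d: "m = Suc (d + k)" using m(1) by (metis add.commute add_Suc_right le_Suc_ex)
    have "p [^] m = p \<otimes> (p [^] d \<otimes> p [^] k)"
      unfolding d using p by (simp add: m_comm nat_pow_mult)
    moreover have "p [^] d \<otimes> p [^] k \<otimes> inv (p [^] k) = p [^] d"
      using inv_right[of "p [^] k"] inv_closed[of "p [^] k"] 1(2) p(1) by (simp add: m_assoc)
    moreover have "inv p \<otimes> (p \<otimes> y) = y" if "y \<in> carrier F" for y
      using inv_left[OF p(1,2)] inv_closed[OF p(1,2)] p(1) that by (metis l_one m_assoc)
    ultimately have "inv p \<otimes> (p [^] m \<otimes> inv (p [^] k)) = p [^] d"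
      using p(1) inv_closed[of "p [^] k"] 1(2) by (simp add: m_assoc)
    then show ?thesis using 1(1) pow[of d] by simp
  qed
qed

text \<open>\<open>N\<close> is the sum of the \<open>Z v\<close> for \<open>v \<in> E\<close>, and \<open>C\<close> the corresponding sum of the \<open>v Q\<close>.\<close>

lemma finitely_generated_bounded:
  assumes "finite E" "E \<subseteq> carrier F" and p: "p \<in> carrier F"
    and Z: "stable_subgroup p Z" "\<one> \<in> Z" "Z \<subseteq> Q" "compactin T Q"
  shows "\<exists>N C. stable_subgroup p N \<and> E \<subseteq> N \<and> N \<subseteq> C \<and> compactin T C"
  using assms(1,2)
proof (induction E)
  case empty
  have "stable_subgroup p {\<zero>}" using p unfolding stable_subgroup_def by simp
  then show ?case
    by (intro exI[of _ "{\<zero>}"]) (simp add: topspace_eq)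
next
  case (insert v E)
  then obtain N C where N: "stable_subgroup p N" "E \<subseteq> N" "N \<subseteq> C" "compactin T C" by auto
  have v: "v \<in> carrier F" using insert.prems by simp
  note Nd = stable_subgroupD[OF N(1)] and Zd = stable_subgroupD[OF Z(1)]
  let ?N = "{n \<oplus> v \<otimes> z |n z. n \<in> N \<and> z \<in> Z}"
  let ?C = "{c \<oplus> d |c d. c \<in> C \<and> d \<in> (\<lambda>x. v \<otimes> x) ` Q}"
  have mem: "n \<oplus> v \<otimes> z \<in> ?N" if "n \<in> N" "z \<in> Z" for n z using that by auto
  have "stable_subgroup p ?N"
    unfolding stable_subgroup_def
  proof (intro conjI ballI)
    show "?N \<subseteq> carrier F" using Nd(1) Zd(1) v by auto
    show "\<zero> \<in> ?N" using mem[OF Nd(2) Zd(2)] v by simp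
    fix x assume "x \<in> ?N"
    then obtain n z where nz: "n \<in> N" "z \<in> Z" and x: "x = n \<oplus> v \<otimes> z" by auto
    have c: "n \<in> carrier F" "z \<in> carrier F" using nz Nd(1) Zd(1) by auto
    have "\<ominus> x = \<ominus> n \<oplus> v \<otimes> (\<ominus> z)" unfolding x using c v by algebra
    then show "\<ominus> x \<in> ?N" using mem[OF Nd(4) Zd(4)] nz by simp
    have "p \<otimes> x = p \<otimes> n \<oplus> v \<otimes> (p \<otimes> z)" unfolding x using c v p by algebra
    then show "p \<otimes> x \<in> ?N" using mem[OF Nd(5) Zd(5)] nz by simp
    fix y assume "y \<in> ?N"
    then obtain n' z' where nz': "n' \<in> N" "z' \<in> Z" and y: "y = n' \<oplus> v \<otimes> z'" by auto
    have c': "n' \<in> carrier F" "z' \<in> carrier F" using nz' Nd(1) Zd(1) by auto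
    have "x \<oplus> y = (n \<oplus> n') \<oplus> v \<otimes> (z \<oplus> z')" unfolding x y using c c' v by algebra
    then show "x \<oplus> y \<in> ?N" using mem[OF Nd(3) Zd(3)] nz nz' by simp
  qed
  moreover have "v \<in> ?N" using mem[OF Nd(2) Z(2)] v by simp
  moreover have "E \<subseteq> ?N"
  proof
    fix e assume "e \<in> E"
    then have "e \<in> N" using N(2) by auto
    moreover from this have "e \<oplus> v \<otimes> \<zero> = e" using v Nd(1) by auto
    ultimately show "e \<in> ?N" using mem[OF _ Zd(2), of e] by simp
  qed
  moreover have "?N \<subseteq> ?C" using N(3) Z(3) by blast
  moreover have "compactin T ?C"
    by (intro compact_sum N compact_multiples Z v)
  ultimately show ?case by (intro exI[of _ ?N] exI[of _ ?C]) simp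
qed

text \<open>If all multiples of \<open>y\<close> stay in \<open>V\<close>, the integers lie in a compact set. Choosing \<open>p\<close> small, the ring
  \<open>Z[p]\<close> is bounded and \<open>p\<^sup>k V\<close> shrinks to \<open>\<zero>\<close>. Iterating \<open>V \<subseteq> E + p V\<close> with \<open>E\<close> finite puts \<open>V\<close> into the
  compact closure \<open>N\<close> of the \<open>Z[p]\<close>-module generated by \<open>E\<close>. So \<open>N\<close> is an open and closed subgroup,
  and the whole field would be compact.\<close>

lemma multiples_leave_compact_nbhd:
  assumes conn: "connected_space T"
    and V: "compactin T V" "openin T V0" "\<zero> \<in> V0" "V0 \<subseteq> V"
    and y: "y \<in> carrier F" "y \<noteq> \<zero>"
  shows "\<exists>n::nat. [n] \<cdot> y \<notin> V"
proof (rule ccontr)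
  assume "\<not> ?thesis"
  then have bounded: "[n] \<cdot> y \<in> V" for n :: nat by simp
  have Vc: "V \<subseteq> carrier F" using V(1) compactin_subset_topspace topspace_eq by blast
  define K where "K = (\<lambda>x. inv y \<otimes> x) ` V"
  have K: "compactin T K" unfolding K_def by (intro compact_multiples V inv_closed y)
  have mult_one: "inv y \<otimes> ([n] \<cdot> y) = [n] \<cdot> \<one>" for n :: nat
    by (induction n) (use y inv_closed inv_left in \<open>auto simp: r_distr\<close>)
  have one_K: "[n] \<cdot> \<one> \<in> K" for n :: nat
    unfolding K_def mult_one[symmetric] using bounded by auto
  \<comment> \<open>the image of the integers, and a compact set around it\<close>
  define H where "H = {([(n::nat)] \<cdot> \<one>) \<ominus> ([(m::nat)] \<cdot> \<one>) |n m. True}"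
  define K' where "K' = {x \<oplus> y |x y. x \<in> K \<and> y \<in> (\<lambda>x. \<ominus> \<one> \<otimes> x) ` K}"
  have K': "compactin T K'" unfolding K'_def by (intro compact_sum compact_multiples K) simp
  have HK': "H \<subseteq> K'"
  proof
    fix h assume "h \<in> H"
    then obtain n m :: nat where "h = ([n] \<cdot> \<one>) \<ominus> ([m] \<cdot> \<one>)" unfolding H_def by auto
    then have "h = ([n] \<cdot> \<one>) \<oplus> (\<ominus> \<one> \<otimes> ([m] \<cdot> \<one>))" by (simp add: a_minus_def l_minus)
    then show "h \<in> K'" unfolding K'_def using one_K by blast
  qed
  have memH: "([n] \<cdot> \<one>) \<ominus> ([m] \<cdot> \<one>) \<in> H" for n m :: nat unfolding H_def by auto
  have H: "H \<subseteq> carrier F" "\<zero> \<in> H" "\<one> \<in> H"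
    using memH[of 0 0] memH[of 1 0] unfolding H_def by (auto simp: a_minus_def)
  have Hadd: "x \<oplus> z \<in> H" if "x \<in> H" "z \<in> H" for x z
  proof -
    obtain n m n' m' :: nat where "x = ([n] \<cdot> \<one>) \<ominus> ([m] \<cdot> \<one>)" "z = ([n'] \<cdot> \<one>) \<ominus> ([m'] \<cdot> \<one>)"
      using \<open>x \<in> H\<close> \<open>z \<in> H\<close> unfolding H_def by auto
    moreover have "(a \<ominus> b) \<oplus> (c \<ominus> d) = (a \<oplus> c) \<ominus> (b \<oplus> d)"
      if "a \<in> carrier F" "b \<in> carrier F" "c \<in> carrier F" "d \<in> carrier F" for a b c d
      using that by algebra
    ultimately have "x \<oplus> z = ([(n + n')] \<cdot> \<one>) \<ominus> ([(m + m')] \<cdot> \<one>)"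
      by (simp add: add.nat_pow_mult)
    then show ?thesis using memH by simp
  qed
  have Hneg: "\<ominus> x \<in> H" if "x \<in> H" for x
  proof -
    obtain n m :: nat where "x = ([n] \<cdot> \<one>) \<ominus> ([m] \<cdot> \<one>)"
      using \<open>x \<in> H\<close> unfolding H_def by auto
    moreover have "\<ominus> (a \<ominus> b) = b \<ominus> a" if "a \<in> carrier F" "b \<in> carrier F" for a b
      using that by algebra
    ultimately show ?thesis using memH by simp
  qed
  \<comment> \<open>\<open>Q\<close> absorbs \<open>H + p Q\<close> as soon as \<open>p Q \<subseteq> V\<close>\<close>
  define Q where "Q = {x \<oplus> y |x y. x \<in> K' \<and> y \<in> V}"
  have Q: "compactin T Q" unfolding Q_def by (intro compact_sum K' V)
  have Qc: "Q \<subseteq> carrier F" using Q compactin_subset_topspace topspace_eq by blast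
  obtain W1 where W1: "openin T W1" "\<zero> \<in> W1" "\<forall>w\<in>W1. \<forall>k\<in>Q. w \<otimes> k \<in> V0"
    using tube_mult[OF Q V(2,3)] by (elim exE conjE)
  obtain W2 where W2: "openin T W2" "\<zero> \<in> W2" "\<forall>w\<in>W2. w \<noteq> \<zero> \<longrightarrow> inv w \<notin> Q"
    using small_imp_inverse_large[OF Q] by (elim exE conjE)
  obtain p where p: "p \<in> W1" "p \<in> W2" "p \<noteq> \<zero>"
    using connected_imp_common_small[OF conn W1(1,2) W2(1,2)] by auto
  have pc: "p \<in> carrier F" using open_carrier[OF W1(1) p(1)] .
  define Z where "Z = adjoin H p"
  have Z: "stable_subgroup p Z" unfolding Z_def by (intro stable_subgroup_adjoin pc H Hadd Hneg)
  have oneZ: "\<one> \<in> Z" unfolding Z_def by (intro adjoin_contains pc H)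
  have ZQ: "Z \<subseteq> Q"
  proof
    fix x assume "x \<in> Z"
    then show "x \<in> Q" unfolding Z_def
    proof induction
      case zero
      have "\<zero> \<oplus> \<zero> \<in> Q" unfolding Q_def using H HK' V by blast
      then show ?case by simp
    next
      case (horner h x)
      then have "h \<in> K'" "p \<otimes> x \<in> V" using HK' W1(3) p(1) V(4) by auto
      then show ?case unfolding Q_def by blast
    qed
  qed
  have pow: "p [^] k \<in> Q" for k :: nat
    using power_in_stable_subgroup[OF Z oneZ pc, of k] ZQ pc by auto
  have ip: "inv p \<in> carrier F" "p \<otimes> inv p = \<one>"
    using inv_closed[OF pc p(3)] inv_right[OF pc p(3)] .
  \<comment> \<open>finitely many translates of \<open>p V\<close> cover \<open>V\<close>\<close>
  define B where "B v = {x \<in> carrier F. inv p \<otimes> (x \<ominus> v) \<in> V0}" for v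
  have "openin T (B v)" if "v \<in> V" for v
    unfolding B_def by (intro open_vimage_self cont_intros V ip) (use that Vc in auto)
  moreover have "v \<in> B v" if "v \<in> V" for v
    unfolding B_def using that Vc V(3) ip by (auto simp: diff_self)
  ultimately have "(\<forall>U\<in>B ` V. openin T U) \<and> V \<subseteq> \<Union>(B ` V)" by auto
  then obtain \<F> where \<F>: "finite \<F>" "\<F> \<subseteq> B ` V" "V \<subseteq> \<Union>\<F>"
    using V(1) unfolding compactin_def by meson
  then obtain E where E: "E \<subseteq> V" "finite E" "\<F> = B ` E"
    using finite_subset_image[OF \<F>(1,2)] by auto
  obtain N0 C where N0: "stable_subgroup p N0" "E \<subseteq> N0" "N0 \<subseteq> C" "compactin T C"
    using finitely_generated_bounded[OF E(2) _ pc Z oneZ ZQ Q] E(1) Vc by (meson order_trans)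
  define N where "N = T closure_of N0"
  have N: "stable_subgroup p N" unfolding N_def using stable_subgroup_closure[OF N0(1) pc] .
  note Nd = stable_subgroupD[OF N]
  have closedN: "closedin T N" unfolding N_def by simp
  have "N \<subseteq> C" unfolding N_def using closure_of_minimal[OF N0(3) compact_imp_closed[OF N0(4)]] .
  then have compN: "compactin T N" using closed_compactin[OF N0(4) _ closedN] by simp
  have EN: "E \<subseteq> N"
    using N0(2) closure_of_subset[of N0 T] stable_subgroupD(1)[OF N0(1)] topspace_eq
    unfolding N_def by auto
  have step: "\<exists>v\<in>E. \<exists>u\<in>V. x = v \<oplus> p \<otimes> u" if "x \<in> V" for x
  proof -
    obtain v where v: "v \<in> E" "inv p \<otimes> (x \<ominus> v) \<in> V0"
      using \<F>(3) \<open>x \<in> V\<close> unfolding E(3) B_def by auto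
    have c: "x \<in> carrier F" "v \<in> carrier F" using \<open>x \<in> V\<close> v(1) E(1) Vc by auto
    have "p \<otimes> (inv p \<otimes> (x \<ominus> v)) = (p \<otimes> inv p) \<otimes> (x \<ominus> v)"
      using c ip(1) pc by (simp add: m_assoc)
    then have "x = v \<oplus> p \<otimes> (inv p \<otimes> (x \<ominus> v))"
      using c ip(2) add_diff_cancel by simp
    then show ?thesis using v V(4) by auto
  qed
  have expand: "\<exists>n\<in>N. \<exists>u\<in>V. x = n \<oplus> p [^] k \<otimes> u" if "x \<in> V" for x and k :: nat
  proof (induction k)
    case 0
    show ?case using Nd(2) \<open>x \<in> V\<close> Vc by (intro bexI[of _ \<zero>] bexI[of _ x]) auto
  next
    case (Suc k)
    then obtain n u where nu: "n \<in> N" "u \<in> V" "x = n \<oplus> p [^] k \<otimes> u" by auto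
    obtain v u' where vu: "v \<in> E" "u' \<in> V" "u = v \<oplus> p \<otimes> u'" using step[OF nu(2)] by auto
    have c: "n \<in> carrier F" "v \<in> carrier F" "u' \<in> carrier F" "p [^] k \<in> carrier F"
      using nu(1) vu(1,2) Nd(1) E(1) Vc pc by auto
    have "x = (n \<oplus> p [^] k \<otimes> v) \<oplus> (p [^] k \<otimes> p) \<otimes> u'"
      unfolding nu(3) vu(3) using c pc by algebra
    moreover have "n \<oplus> p [^] k \<otimes> v \<in> N"
      using power_in_stable_subgroup[OF N _ pc, of v k] vu(1) EN nu(1) Nd(3) by auto
    ultimately show ?case using vu(2) by (intro bexI[of _ "n \<oplus> p [^] k \<otimes> v"] bexI[of _ u']) auto
  qed
  have VN: "V \<subseteq> N"
  proof (rule ccontr)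
    assume "\<not> V \<subseteq> N"
    then obtain x where x: "x \<in> V" "x \<notin> N" by auto
    have xc: "x \<in> carrier F" using x Vc by auto
    let ?U = "{d \<in> carrier F. x \<ominus> d \<in> carrier F - N}"
    have "openin T (carrier F - N)"
      using closedN topspace_eq by (metis openin_diff openin_topspace)
    then have oU: "openin T ?U" by (intro open_vimage_self cont_intros xc)
    have zU: "\<zero> \<in> ?U" using xc x(2) by (simp add: a_minus_def)
    obtain W where W: "openin T W" "\<zero> \<in> W" "\<forall>w\<in>W. \<forall>k\<in>V. w \<otimes> k \<in> ?U"
      using tube_mult[OF V(1) oU zU] by (elim exE conjE)
    have "inv p \<notin> Q" using W2(3) p by simp
    then obtain k :: nat where k: "p [^] k \<in> W"
      using powers_tend_to_zero[OF Q pc p(3) _ pow W(1,2)] by auto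
    obtain n u where nu: "n \<in> N" "u \<in> V" "x = n \<oplus> p [^] k \<otimes> u" using expand[OF x(1), of k] by auto
    have "p [^] k \<otimes> u \<in> ?U" using W(3) k nu(2) by simp
    moreover have "x \<ominus> p [^] k \<otimes> u = n"
    proof -
      have "n \<oplus> b \<ominus> b = n" if "b \<in> carrier F" for b
        using that nu(1) Nd(1) by (auto simp: a_minus_def a_assoc r_neg)
      then show ?thesis unfolding nu(3) using nu(2) Vc pc by auto
    qed
    ultimately show False using nu(1) by simp
  qed
  have "openin T N"
    unfolding openin_subopen[of T N]
  proof
    fix n assume n: "n \<in> N"
    then have nc: "n \<in> carrier F" using Nd(1) by auto
    let ?O = "{x \<in> carrier F. x \<ominus> n \<in> V0}"
    have "openin T ?O" by (intro open_vimage_self cont_intros V nc)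
    moreover have "n \<in> ?O" using nc V(3) by (simp add: diff_self)
    moreover have "?O \<subseteq> N"
    proof
      fix x assume x: "x \<in> ?O"
      then have "x \<ominus> n \<in> N" using V(4) VN by auto
      then have "n \<oplus> (x \<ominus> n) \<in> N" using Nd(3)[OF n] by simp
      then show "x \<in> N" using add_diff_cancel nc x by simp
    qed
    ultimately show "\<exists>O'. openin T O' \<and> n \<in> O' \<and> O' \<subseteq> N" by (intro exI[of _ ?O]) simp
  qed
  then have "N = carrier F"
    using conn closedN Nd(2) unfolding connected_space_clopen_in topspace_eq by auto
  then show False using connected_imp_not_compact[OF conn] compN by simp
qed

theorem connected_locally_compact_imp_path:
  assumes "connected_space T" "compactin T V" "openin T V0" "\<zero> \<in> V0" "V0 \<subseteq> V"
  shows "\<exists>j. continuous_map (top_of_set {0..1::real}) T j \<and> j 0 = \<zero> \<and> j 1 = \<one>"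
  using path_if_multiples_escape[OF assms multiples_leave_compact_nbhd[OF assms]] .

end

section \<open>Compact \<open>F\<close>-Tychonoff spaces are \<open>F\<close>-normal\<close>

context topological_field
begin

lemma KH_separate:
  assumes "KH_obj F T X" "closedin X C" "x \<in> topspace X" "x \<notin> C"
  obtains f where "continuous_map X T f" "f x = \<one>" "\<And>y. y \<in> C \<Longrightarrow> f y = \<zero>"
  using assms unfolding KH_obj_def F_Tychonoff_def by (metis DiffI)

lemma KH_compact: "KH_obj F T X \<Longrightarrow> compact_space X"
  unfolding KH_obj_def by simp

lemma KH_separate_points:
  assumes "KH_obj F T X" "x \<in> topspace X" "y \<in> topspace X" "x \<noteq> y"
  obtains f where "continuous_map X T f" "f x = \<one>" "f y = \<zero>"
proof -
  have "closedin X {y}"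
    using assms unfolding KH_obj_def F_Tychonoff_def t1_space_closedin_singleton by auto
  with KH_separate[OF assms(1) _ assms(2), of "{y}"] assms(4) show ?thesis
    using that by auto
qed

lemma KH_Hausdorff:
  assumes "KH_obj F T X" shows "Hausdorff_space X"
  unfolding Hausdorff_space_def
proof (intro allI impI; elim conjE)
  fix x y assume xy: "x \<in> topspace X" "y \<in> topspace X" "x \<noteq> y"
  obtain f where f: "continuous_map X T f" "f x = \<one>" "f y = \<zero>"
    using KH_separate_points[OF assms xy] .
  obtain U V where UV: "openin T U" "openin T V" "\<one> \<in> U" "\<zero> \<in> V" "disjnt U V"
    using Hausdorff zero_not_one unfolding Hausdorff_space_def topspace_eq
    by (metis one_closed zero_closed)
  show "\<exists>U V. openin X U \<and> openin X V \<and> x \<in> U \<and> y \<in> V \<and> disjnt U V"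
  proof (intro exI conjI)
    show "openin X {z \<in> topspace X. f z \<in> U}" "openin X {z \<in> topspace X. f z \<in> V}"
      using open_vimage f(1) UV(1,2) by auto
  qed (use xy f UV in \<open>auto simp: disjnt_iff\<close>)
qed

lemma KH_normal: "KH_obj F T X \<Longrightarrow> normal_space X"
  using KH_Hausdorff KH_compact compact_Hausdorff_or_regular_imp_normal_space by blast

text \<open>Functions to the totally disconnected \<open>F\<close> separate the points of \<open>X\<close>, so \<open>X\<close> has only trivial
  connected subsets. In a compact Hausdorff space components are quasi-components, so disjoint
  closed sets are separated by a clopen set.\<close>

lemma KH_F_normal_if_disconnected:
  assumes X: "KH_obj F T X" and nc: "\<not> connected_space T"
    and C: "closedin X C" and D: "closedin X D" and CD: "disjnt C D"
  shows "\<exists>e. continuous_map X T e \<and> (\<forall>x\<in>C. e x = \<one>) \<and> (\<forall>x\<in>D. e x = \<zero>)"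
proof -
  have conn: "a = b" if S: "connectedin X S" "a \<in> S" "b \<in> S" for S a b
  proof (rule ccontr)
    assume "a \<noteq> b"
    moreover have ab: "a \<in> topspace X" "b \<in> topspace X" using S connectedin_subset_topspace by blast+
    ultimately obtain f where f: "continuous_map X T f" "f a = \<one>" "f b = \<zero>"
      using KH_separate_points[OF X] by blast
    have "f a = f b"
      by (rule disconnected_imp_totally_disconnected[OF nc connectedin_continuous_map_image[OF f(1) S(1)]])
        (use S in auto)
    then show False using f zero_not_one by simp
  qed
  have eq: "quasi_components_of X = connected_components_of X"
    using quasi_eq_connected_components_of KH_Hausdorff[OF X] KH_compact[OF X] by blast
  have pt: "separated_between X {a} {b}" if ab: "a \<in> C" "b \<in> D" for a b
  proof -
    have abX: "a \<in> topspace X" "b \<in> topspace X"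
      using ab closedin_subset[OF C] closedin_subset[OF D] by auto
    have "\<not> quasi_component_of X a b"
    proof
      assume q: "quasi_component_of X a b"
      have "quasi_component_of_set X a \<in> connected_components_of X"
        using abX(1) unfolding eq[symmetric] quasi_components_of_def by auto
      then have "connectedin X (quasi_component_of_set X a)"
        using connectedin_connected_components_of by blast
      then have "a = b"
        by (rule conn) (use q abX(1) quasi_component_of_refl in auto)
      then show False using ab CD by (auto simp: disjnt_iff)
    qed
    then show ?thesis using abX by (simp add: separated_between_singletons)
  qed
  have cC: "compactin X C" and cD: "compactin X D"
    using C D KH_compact[OF X] closedin_compact_space by blast+
  have "separated_between X C D"
    unfolding separated_between_pointwise_left[OF cC] separated_between_pointwise_right[OF cD]
    using pt closedin_subset[OF C] closedin_subset[OF D] by auto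
  then obtain U V where UV: "openin X U" "openin X V" "U \<union> V = topspace X" "disjnt U V" "C \<subseteq> U" "D \<subseteq> V"
    unfolding separated_between_def by auto
  let ?e = "\<lambda>x. if x \<in> U then \<one> else \<zero>"
  have "continuous_map X T ?e"
    unfolding continuous_map_def
  proof (intro conjI allI impI)
    fix W assume "openin T W"
    have "{x \<in> topspace X. ?e x \<in> W} = (if \<one> \<in> W then U else {}) \<union> (if \<zero> \<in> W then V else {})"
      using UV(3,4) by (auto simp: disjnt_iff)
    also have "openin X \<dots>" using UV(1,2) by auto
    finally show "openin X {x \<in> topspace X. ?e x \<in> W}" .
  qed (auto simp: topspace_eq)
  moreover have "\<forall>x\<in>C. ?e x = \<one>" "\<forall>x\<in>D. ?e x = \<zero>"
    using UV(4,5,6) by (auto simp: disjnt_iff)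
  ultimately show ?thesis by (intro exI[of _ ?e]) simp
qed

lemma KH_F_normal_if_path:
  assumes X: "KH_obj F T X"
    and j: "continuous_map (top_of_set {0..1::real}) T j" "j 0 = \<zero>" "j 1 = \<one>"
    and C: "closedin X C" and D: "closedin X D" and CD: "disjnt C D"
  shows "\<exists>e. continuous_map X T e \<and> (\<forall>x\<in>C. e x = \<one>) \<and> (\<forall>x\<in>D. e x = \<zero>)"
proof -
  have "disjnt D C" using CD disjnt_sym by blast
  then obtain u where u: "continuous_map X (top_of_set {0..1::real}) u" "u ` D \<subseteq> {0}" "u ` C \<subseteq> {1}"
    using Urysohn_lemma[OF KH_normal[OF X] D C, of 0 1] by auto
  have "continuous_map X T (j \<circ> u)" using continuous_map_compose[OF u(1) j(1)] .
  then show ?thesis using u j by (intro exI[of _ "j \<circ> u"]) auto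
qed

lemma locally_compactI:
  assumes "compactin T V" "openin T V0" "\<zero> \<in> V0" "V0 \<subseteq> V"
  shows "locally_compact_space T"
  unfolding locally_compact_space_def topspace_eq
proof
  fix x assume x: "x \<in> carrier F"
  let ?U = "{y \<in> carrier F. y \<ominus> x \<in> V0}" and ?K = "(\<lambda>y. x \<oplus> y) ` V"
  have "openin T ?U" by (intro open_vimage_self cont_intros assms x)
  moreover have "compactin T ?K" by (rule image_compactin[OF assms(1)]) (intro cont_intros x)
  moreover have "x \<in> ?U" using x assms(3) by (simp add: diff_self)
  moreover have "?U \<subseteq> ?K"
  proof
    fix y assume y: "y \<in> ?U"
    then have "y = x \<oplus> (y \<ominus> x)" using x add_diff_cancel by simp
    then show "y \<in> ?K" using y assms(4) by blast
  qed
  ultimately show "\<exists>U K. openin T U \<and> compactin T K \<and> x \<in> U \<and> U \<subseteq> K" by blast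
qed

text \<open>If every \<open>f - t g\<close> has a zero in \<open>Z\<close>, then each \<open>t\<close> is a value of \<open>f / g\<close>. For \<open>t\<close> near \<open>\<zero>\<close> the zeros stay
  away from the zeros of \<open>g\<close>, where \<open>f\<close> does not vanish. So a neighbourhood of \<open>\<zero>\<close> is contained in the
  image under \<open>f / g\<close> of a compact set on which \<open>g\<close> does not vanish.\<close>

lemma linear_combination_avoids_zero:
  assumes nlc: "\<not> locally_compact_space T"
    and Z: "compactin X Z" and f: "continuous_map X T f" and g: "continuous_map X T g"
    and fg: "\<And>z. z \<in> Z \<Longrightarrow> f z = \<zero> \<Longrightarrow> g z \<noteq> \<zero>"
  shows "\<exists>t\<in>carrier F. \<forall>z\<in>Z. f z \<ominus> t \<otimes> g z \<noteq> \<zero>"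
proof (rule ccontr)
  assume "\<not> ?thesis"
  then have bad: "\<exists>z\<in>Z. f z \<ominus> t \<otimes> g z = \<zero>" if "t \<in> carrier F" for t using that by auto
  have ZX: "Z \<subseteq> topspace X" using compactin_subset_topspace[OF Z] .
  have fc: "f z \<in> carrier F" and gc: "g z \<in> carrier F" if "z \<in> Z" for z
    using continuous_map_carrier[OF f subsetD[OF ZX that]] continuous_map_carrier[OF g subsetD[OF ZX that]] .
  let ?P = "{q \<in> topspace (prod_topology T X). f (snd q) \<ominus> fst q \<otimes> g (snd q) \<noteq> \<zero>}"
  have "continuous_map (prod_topology T X) T (\<lambda>q. f (snd q) \<ominus> fst q \<otimes> g (snd q))"
    using continuous_map_compose[OF continuous_map_snd f] continuous_map_compose[OF continuous_map_snd g]
    by (intro cont_intros continuous_map_fst) (auto simp: o_def)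
  then have P: "openin (prod_topology T X) ?P" by (rule open_cozero)
  define Z0 where "Z0 = Z \<inter> {z \<in> topspace X. g z = \<zero>}"
  have Z0: "compactin X Z0"
    unfolding Z0_def by (intro compact_Int_closedin Z closed_zero_set g)
  have "{\<zero>} \<times> Z0 \<subseteq> ?P"
    unfolding Z0_def using fg fc ZX by (auto simp: topspace_eq a_minus_def)
  then obtain W Y where WY: "openin T W" "openin X Y" "\<zero> \<in> W" "Z0 \<subseteq> Y" "W \<times> Y \<subseteq> ?P"
    using tube_lemma_right[OF P Z0, of \<zero>] topspace_eq by auto
  define Z1 where "Z1 = Z \<inter> (topspace X - Y)"
  have Z1: "compactin X Z1"
    unfolding Z1_def by (intro compact_Int_closedin Z) (use WY(2) in auto)
  have gZ1: "g z \<noteq> \<zero>" if "z \<in> Z1" for z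
    using that WY(4) ZX unfolding Z1_def Z0_def by auto
  have "continuous_map (subtopology X Z1) T (\<lambda>z. f z \<otimes> inv (g z))"
    by (intro cont_intros continuous_map_from_subtopology f g) (use gZ1 in auto)
  moreover have "compactin (subtopology X Z1) Z1"
    using Z1 by (simp add: compactin_subtopology)
  ultimately have V: "compactin T ((\<lambda>z. f z \<otimes> inv (g z)) ` Z1)"
    using image_compactin by blast
  have "W \<subseteq> (\<lambda>z. f z \<otimes> inv (g z)) ` Z1"
  proof
    fix t assume t: "t \<in> W"
    have tc: "t \<in> carrier F" using open_carrier[OF WY(1) t] .
    obtain z where z: "z \<in> Z" "f z \<ominus> t \<otimes> g z = \<zero>" using bad[OF tc] by auto
    have "(t, z) \<notin> ?P" using z(2) by simp
    then have z1: "z \<in> Z1" using t WY(5) z(1) ZX unfolding Z1_def by auto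
    have "f z = t \<otimes> g z" using z tc fc gc diff_eq_zero by simp
    then have "f z \<otimes> inv (g z) = t"
      using gc[OF z(1)] gZ1[OF z1] inv_right inv_closed tc by (simp add: m_assoc)
    then show "t \<in> (\<lambda>z. f z \<otimes> inv (g z)) ` Z1" using z1 by force
  qed
  then show False using nlc locally_compactI[OF V WY(1,3)] by simp
qed

text \<open>Finitely many functions that vanish on \<open>D\<close> have no common zero on \<open>Z\<close>; they are merged one by one by
  linear combinations. The induction is over all closed sets, since merging in \<open>g\<close> uses the case of
  the zero set of \<open>g\<close>.\<close>

lemma KH_nonvanishing:
  assumes nlc: "\<not> locally_compact_space T"
    and X: "KH_obj F T X" and D: "closedin X D" and Z: "closedin X Z" and ZD: "disjnt Z D"
  shows "\<exists>h. continuous_map X T h \<and> (\<forall>x\<in>D. h x = \<zero>) \<and> (\<forall>x\<in>Z. h x \<noteq> \<zero>)"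
proof -
  define \<G> where "\<G> = {g. continuous_map X T g \<and> (\<forall>x\<in>D. g x = \<zero>)}"
  have DX: "D \<subseteq> topspace X" using closedin_subset[OF D] .
  have cz: "compactin X S" if "closedin X S" for S
    using closedin_compact_space[OF KH_compact[OF X] that] .
  have fin: "\<exists>h\<in>\<G>. \<forall>x\<in>S. h x \<noteq> \<zero>"
    if "finite G" "G \<subseteq> \<G>" "closedin X S" "\<And>x. x \<in> S \<Longrightarrow> \<exists>g\<in>G. g x \<noteq> \<zero>" for G S
    using that
  proof (induction G arbitrary: S)
    case empty
    have "(\<lambda>x. \<zero>) \<in> \<G>" unfolding \<G>_def by (auto simp: topspace_eq)
    moreover have "S = {}" using empty.prems by auto
    ultimately show ?case by auto
  next
    case (insert g G)
    have g: "continuous_map X T g" "\<And>x. x \<in> D \<Longrightarrow> g x = \<zero>" using insert.prems unfolding \<G>_def by auto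
    have "closedin X (S \<inter> {x \<in> topspace X. g x = \<zero>})"
      by (intro closedin_Int insert.prems closed_zero_set g)
    then obtain h where h: "h \<in> \<G>" "\<And>x. x \<in> S \<Longrightarrow> g x = \<zero> \<Longrightarrow> h x \<noteq> \<zero>"
      using insert.IH[of "S \<inter> {x \<in> topspace X. g x = \<zero>}"] insert.prems closedin_subset[of X S]
      by (smt (verit, best) Int_iff insert_iff insert_subset mem_Collect_eq subsetD)
    have hc: "continuous_map X T h" "\<And>x. x \<in> D \<Longrightarrow> h x = \<zero>" using h(1) unfolding \<G>_def by auto
    have "\<exists>t\<in>carrier F. \<forall>z\<in>S. h z \<ominus> t \<otimes> g z \<noteq> \<zero>"
      by (rule linear_combination_avoids_zero[OF nlc cz[OF insert.prems(2)] hc(1) g(1)]) (use h(2) in auto)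
    then obtain t where t: "t \<in> carrier F" "\<forall>z\<in>S. h z \<ominus> t \<otimes> g z \<noteq> \<zero>"
      by (elim bexE)
    have "(\<lambda>x. h x \<ominus> t \<otimes> g x) \<in> \<G>"
      unfolding \<G>_def using hc g t(1) by (auto intro!: cont_intros simp: a_minus_def)
    then show ?case using t(2) by (intro bexI[of _ "\<lambda>x. h x \<ominus> t \<otimes> g x"]) auto
  qed
  have sep: "\<exists>g\<in>\<G>. g z \<noteq> \<zero>" if z: "z \<in> Z" for z
  proof -
    have "z \<in> topspace X" "z \<notin> D" using z ZD closedin_subset[OF Z] by (auto simp: disjnt_iff)
    then obtain g where "continuous_map X T g" "g z = \<one>" "\<And>y. y \<in> D \<Longrightarrow> g y = \<zero>"
      using KH_separate[OF X D, of z] by auto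
    then show ?thesis unfolding \<G>_def by (intro bexI[of _ g]) auto
  qed
  define B where "B g = {x \<in> topspace X. g x \<noteq> \<zero>}" for g
  have "\<forall>U\<in>B ` \<G>. openin X U" unfolding B_def \<G>_def by (auto intro: open_cozero)
  moreover have "Z \<subseteq> \<Union>(B ` \<G>)" using sep closedin_subset[OF Z] unfolding B_def by auto
  ultimately obtain \<F> where \<F>: "finite \<F>" "\<F> \<subseteq> B ` \<G>" "Z \<subseteq> \<Union>\<F>"
    using cz[OF Z] unfolding compactin_def by meson
  then obtain G where G: "G \<subseteq> \<G>" "finite G" "\<F> = B ` G"
    using finite_subset_image[OF \<F>(1,2)] by auto
  have "\<exists>g\<in>G. g x \<noteq> \<zero>" if "x \<in> Z" for x
    using that \<F>(3) unfolding G(3) B_def by auto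
  from fin[OF G(2,1) Z this] show ?thesis unfolding \<G>_def by auto
qed

text \<open>An \<open>F\<close>-valued Urysohn lemma, by the three kinds of fields.\<close>

theorem KH_F_normal:
  assumes X: "KH_obj F T X" and C: "closedin X C" and D: "closedin X D" and CD: "disjnt C D"
  shows "\<exists>e. continuous_map X T e \<and> (\<forall>x\<in>C. e x = \<one>) \<and> (\<forall>x\<in>D. e x = \<zero>)"
proof -
  consider (disc) "\<not> connected_space T"
    | (loc) V V0 where "connected_space T" "compactin T V" "openin T V0" "\<zero> \<in> V0" "V0 \<subseteq> V"
    | (nlc) "\<not> locally_compact_space T"
    unfolding locally_compact_space_def topspace_eq by (metis zero_closed)
  then show ?thesis
  proof cases
    case disc
    from KH_F_normal_if_disconnected[OF X disc C D CD] show ?thesis .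
  next
    case loc
    obtain j where "continuous_map (top_of_set {0..1::real}) T j" "j 0 = \<zero>" "j 1 = \<one>"
      using connected_locally_compact_imp_path[OF loc] by auto
    from KH_F_normal_if_path[OF X this C D CD] show ?thesis .
  next
    case nlc
    obtain A B where AB: "openin X A" "openin X B" "C \<subseteq> A" "D \<subseteq> B" "disjnt A B"
      using KH_normal[OF X] C D CD unfolding normal_space_def by meson
    have cl: "closedin X (topspace X - B)" "closedin X (topspace X - A)" using AB by auto
    have dj: "disjnt (topspace X - B) D" "disjnt (topspace X - A) C" using AB by (auto simp: disjnt_iff)
    obtain g where g: "continuous_map X T g" "\<forall>x\<in>D. g x = \<zero>" "\<forall>x\<in>topspace X - B. g x \<noteq> \<zero>"
      using KH_nonvanishing[OF nlc X D cl(1) dj(1)] by (elim exE conjE)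
    obtain g' where g': "continuous_map X T g'" "\<forall>x\<in>C. g' x = \<zero>" "\<forall>x\<in>topspace X - A. g' x \<noteq> \<zero>"
      using KH_nonvanishing[OF nlc X C cl(2) dj(2)] by (elim exE conjE)
    have "compactin X (topspace X)" using KH_compact[OF X] unfolding compact_space_def .
    moreover have "g x \<noteq> \<zero>" if "x \<in> topspace X" "g' x = \<zero>" for x
      using that g(3) g'(3) AB(5) by (auto simp: disjnt_iff)
    ultimately have "\<exists>t\<in>carrier F. \<forall>x\<in>topspace X. g' x \<ominus> t \<otimes> g x \<noteq> \<zero>"
      by (intro linear_combination_avoids_zero[OF nlc _ g'(1) g(1)])
    then obtain t where t: "t \<in> carrier F" "\<forall>x\<in>topspace X. g' x \<ominus> t \<otimes> g x \<noteq> \<zero>"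
      by (elim bexE)
    \<comment> \<open>on \<open>C\<close>, where \<open>g'\<close> vanishes, this is \<open>- t g / (- t g)\<close>; on \<open>D\<close> the numerator vanishes\<close>
    let ?e = "\<lambda>x. (\<ominus> (t \<otimes> g x)) \<otimes> inv (g' x \<ominus> t \<otimes> g x)"
    have "continuous_map X T ?e"
      by (intro cont_intros g g' t(1)) (use t in auto)
    moreover have "?e x = \<one>" if x: "x \<in> C" for x
    proof -
      have xX: "x \<in> topspace X" using x closedin_subset[OF C] by auto
      have gx: "g x \<in> carrier F" using continuous_map_carrier[OF g(1) xX] .
      then have "g' x \<ominus> t \<otimes> g x = \<ominus> (t \<otimes> g x)" using g'(2) x t(1) by (simp add: a_minus_def)
      then show ?thesis using inv_right[of "\<ominus> (t \<otimes> g x)"] t gx xX by (metis a_inv_closed m_closed)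
    qed
    moreover have "?e x = \<zero>" if x: "x \<in> D" for x
    proof -
      have xX: "x \<in> topspace X" using x closedin_subset[OF D] by auto
      have "g' x \<in> carrier F" using continuous_map_carrier[OF g'(1) xX] .
      moreover have "g' x \<ominus> t \<otimes> g x \<noteq> \<zero>" using t xX by auto
      moreover have "g x = \<zero>" using g(2) x by simp
      ultimately show ?thesis using t(1) inv_closed[of "g' x \<ominus> t \<otimes> g x"] by simp
    qed
    ultimately show ?thesis by (intro exI[of _ ?e]) simp
  qed
qed

end

section \<open>Characters and maximal ideals of an algebra\<close>

text \<open>A unital algebra morphism to \<open>F\<close>. Fixing the scalars \<open>c 1\<close> is equivalent to linearity here, and
  is the form in which the residue map \<open>c \<mapsto> M + c 1\<close> uses it.\<close>

definition character :: "'f ring \<Rightarrow> ('f, 'a) module \<Rightarrow> ('a \<Rightarrow> 'f) \<Rightarrow> bool" where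
  "character F A \<omega> \<longleftrightarrow> \<omega> \<in> ring_hom A F \<and> (\<forall>c\<in>carrier F. \<omega> (c \<odot>\<^bsub>A\<^esub> \<one>\<^bsub>A\<^esub>) = c)"

text \<open>The field and the algebra share their operation names, so both structures are accessed with a
  mandatory prefix.\<close>

locale F_algebra =
  fixes F :: "'f ring" and T :: "'f topology" and A :: "('f, 'a) module"
  assumes tf: "topological_field F T" and alg: "algebra F A"
begin

sublocale F: topological_field F T by (rule tf)
sublocale A: cring A by (rule algebra.M_cring[OF alg])

abbreviation scalar :: "'f \<Rightarrow> 'a" where "scalar c \<equiv> c \<odot>\<^bsub>A\<^esub> \<one>\<^bsub>A\<^esub>"

lemma F_module: "module F A" using algebra.module[OF alg] .

lemma scalar_closed: "c \<in> carrier F \<Longrightarrow> scalar c \<in> carrier A"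
  using module.smult_closed[OF F_module] by simp

lemma smult_eq: "c \<in> carrier F \<Longrightarrow> a \<in> carrier A \<Longrightarrow> c \<odot>\<^bsub>A\<^esub> a = scalar c \<otimes>\<^bsub>A\<^esub> a"
  using algebra.smult_assoc2[OF alg, of c "\<one>\<^bsub>A\<^esub>" a] by simp

lemma scalar_hom: "(\<lambda>c. scalar c) \<in> ring_hom F A"
proof (rule ring_hom_memI)
  fix c d assume c: "c \<in> carrier F" and d: "d \<in> carrier F"
  show "scalar (c \<otimes>\<^bsub>F\<^esub> d) = scalar c \<otimes>\<^bsub>A\<^esub> scalar d"
    using module.smult_assoc1[OF F_module c d A.one_closed] smult_eq[OF c scalar_closed[OF d]] by simp
  show "scalar (c \<oplus>\<^bsub>F\<^esub> d) = scalar c \<oplus>\<^bsub>A\<^esub> scalar d"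
    using module.smult_l_distr[OF F_module c d A.one_closed] .
qed (use scalar_closed module.smult_one[OF F_module] in auto)

lemma scalar_zero: "scalar \<zero>\<^bsub>F\<^esub> = \<zero>\<^bsub>A\<^esub>"
  using module.smult_l_null[OF F_module] by simp

lemma scalar_one: "scalar \<one>\<^bsub>F\<^esub> = \<one>\<^bsub>A\<^esub>"
  using module.smult_one[OF F_module] by simp

context
  fixes \<omega> assumes char: "character F A \<omega>"
begin

lemma char_hom: "\<omega> \<in> ring_hom A F"
  and char_scalar: "c \<in> carrier F \<Longrightarrow> \<omega> (scalar c) = c"
  using char unfolding character_def by auto

lemma char_closed: "a \<in> carrier A \<Longrightarrow> \<omega> a \<in> carrier F"
  using ring_hom_closed[OF char_hom] .

lemma char_smult: "c \<in> carrier F \<Longrightarrow> a \<in> carrier A \<Longrightarrow> \<omega> (c \<odot>\<^bsub>A\<^esub> a) = c \<otimes>\<^bsub>F\<^esub> \<omega> a"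
  using smult_eq[of c a] ring_hom_mult[OF char_hom, of "scalar c" a] by (simp add: scalar_closed char_scalar)

lemma char_ring: "ring_hom_ring A F \<omega>"
  by (intro ring_hom_ringI2 A.ring_axioms F.ring_axioms char_hom)

lemma char_minus: "a \<in> carrier A \<Longrightarrow> b \<in> carrier A \<Longrightarrow> \<omega> (a \<ominus>\<^bsub>A\<^esub> b) = \<omega> a \<ominus>\<^bsub>F\<^esub> \<omega> b"
proof -
  interpret h: ring_hom_ring A F \<omega> by (rule char_ring)
  show "a \<in> carrier A \<Longrightarrow> b \<in> carrier A \<Longrightarrow> \<omega> (a \<ominus>\<^bsub>A\<^esub> b) = \<omega> a \<ominus>\<^bsub>F\<^esub> \<omega> b"
    by (simp add: a_minus_def)
qed

lemma kernel_ideal: "ideal {a \<in> carrier A. \<omega> a = \<zero>\<^bsub>F\<^esub>} A"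
  using ring_hom_ring.kernel_is_ideal[OF char_ring] by (simp add: a_kernel_def')

lemma kernel_diff_scalar:
  assumes "a \<in> carrier A" "c \<in> carrier F"
  shows "a \<ominus>\<^bsub>A\<^esub> scalar c \<in> {a \<in> carrier A. \<omega> a = \<zero>\<^bsub>F\<^esub>} \<longleftrightarrow> \<omega> a = c"
  using assms scalar_closed char_closed by (simp add: char_minus char_scalar F.diff_eq_zero)

text \<open>The kernel has a complement of scalars: if \<open>\<omega> a \<noteq> \<zero>\<close>, then \<open>1 - a / \<omega> a\<close> lies in the kernel, so an
  ideal that contains the kernel and \<open>a\<close> contains \<open>1\<close>.\<close>

lemma kernel_maximal: "maximalideal {a \<in> carrier A. \<omega> a = \<zero>\<^bsub>F\<^esub>} A"
proof (rule maximalidealI[OF kernel_ideal])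
  show "carrier A \<noteq> {a \<in> carrier A. \<omega> a = \<zero>\<^bsub>F\<^esub>}"
    using ring_hom_one[OF char_hom] F.zero_not_one A.one_closed by force
  fix J assume J: "ideal J A" "{a \<in> carrier A. \<omega> a = \<zero>\<^bsub>F\<^esub>} \<subseteq> J" "J \<subseteq> carrier A"
  show "J = {a \<in> carrier A. \<omega> a = \<zero>\<^bsub>F\<^esub>} \<or> J = carrier A"
  proof (cases "J \<subseteq> {a \<in> carrier A. \<omega> a = \<zero>\<^bsub>F\<^esub>}")
    case False
    then obtain a where a: "a \<in> J" "a \<in> carrier A" "\<omega> a \<noteq> \<zero>\<^bsub>F\<^esub>" using J(3) by auto
    let ?b = "\<one>\<^bsub>A\<^esub> \<ominus>\<^bsub>A\<^esub> scalar (inv\<^bsub>F\<^esub> (\<omega> a)) \<otimes>\<^bsub>A\<^esub> a"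
    have ic: "inv\<^bsub>F\<^esub> (\<omega> a) \<in> carrier F" using F.inv_closed char_closed a by simp
    have sa: "scalar (inv\<^bsub>F\<^esub> (\<omega> a)) \<otimes>\<^bsub>A\<^esub> a \<in> J"
      using ideal.I_l_closed[OF J(1) a(1)] scalar_closed ic by simp
    have "\<omega> ?b = \<zero>\<^bsub>F\<^esub>"
      using a ic scalar_closed F.inv_left[OF char_closed]
      by (simp add: char_minus ring_hom_mult[OF char_hom] ring_hom_one[OF char_hom] char_scalar F.diff_self)
    then have "?b \<in> J" using J(2) a ic scalar_closed by auto
    then have "?b \<oplus>\<^bsub>A\<^esub> scalar (inv\<^bsub>F\<^esub> (\<omega> a)) \<otimes>\<^bsub>A\<^esub> a \<in> J"
      using sa additive_subgroup.a_closed[OF ideal.axioms(1)[OF J(1)]] by simp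
    moreover have "?b \<oplus>\<^bsub>A\<^esub> scalar (inv\<^bsub>F\<^esub> (\<omega> a)) \<otimes>\<^bsub>A\<^esub> a = \<one>\<^bsub>A\<^esub>"
      using a ic scalar_closed by (simp add: a_minus_def A.a_assoc A.l_neg)
    ultimately show ?thesis using ideal.one_imp_carrier[OF J(1)] by simp
  qed (use J in auto)
qed

lemma residue_map_kernel_iso:
  "residue_map A {a \<in> carrier A. \<omega> a = \<zero>\<^bsub>F\<^esub>} \<in> ring_iso F (A Quot {a \<in> carrier A. \<omega> a = \<zero>\<^bsub>F\<^esub>})"
proof -
  let ?M = "{a \<in> carrier A. \<omega> a = \<zero>\<^bsub>F\<^esub>}"
  have eq: "residue_map A ?M = (\<lambda>a. ?M +>\<^bsub>A\<^esub> a) \<circ> (\<lambda>c. scalar c)"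
    unfolding residue_map_def o_def ..
  have hom: "residue_map A ?M \<in> ring_hom F (A Quot ?M)"
    unfolding eq by (rule ring_hom_trans[OF scalar_hom ideal.rcos_ring_hom[OF kernel_ideal]])
  have cos: "?M +>\<^bsub>A\<^esub> a = ?M +>\<^bsub>A\<^esub> scalar c \<longleftrightarrow> \<omega> a = c" if "a \<in> carrier A" "c \<in> carrier F" for a c
    using A.quotient_eq_iff_same_a_r_cos[OF kernel_ideal that(1) scalar_closed[OF that(2)]]
      kernel_diff_scalar[OF that] by blast
  have "inj_on (residue_map A ?M) (carrier F)"
    unfolding residue_map_def
  proof (rule inj_onI)
    fix c d assume c: "c \<in> carrier F" and d: "d \<in> carrier F"
      and "?M +>\<^bsub>A\<^esub> scalar c = ?M +>\<^bsub>A\<^esub> scalar d"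
    then have "\<omega> (scalar c) = d" using cos[OF scalar_closed[OF c] d] by simp
    then show "c = d" using char_scalar[OF c] by simp
  qed
  moreover have "residue_map A ?M ` carrier F = carrier (A Quot ?M)"
  proof
    show "residue_map A ?M ` carrier F \<subseteq> carrier (A Quot ?M)"
      using ring_hom_closed[OF hom] by auto
    show "carrier (A Quot ?M) \<subseteq> residue_map A ?M ` carrier F"
    proof
      fix S assume "S \<in> carrier (A Quot ?M)"
      then obtain a where a: "a \<in> carrier A" "S = ?M +>\<^bsub>A\<^esub> a"
        unfolding FactRing_def A_RCOSETS_def' by auto
      then have "S = residue_map A ?M (\<omega> a)"
        unfolding residue_map_def using cos char_closed by auto
      then show "S \<in> residue_map A ?M ` carrier F" using char_closed a(1) by auto
    qed
  qed
  ultimately show ?thesis unfolding ring_iso_def bij_betw_def using hom by simp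
qed

end

lemma Gelfand_if_characters:
  assumes "\<And>M. M \<in> Max_ideals A \<Longrightarrow> \<exists>\<omega>. character F A \<omega> \<and> M = {a \<in> carrier A. \<omega> a = \<zero>\<^bsub>F\<^esub>}"
  shows "Gelfand F A"
  unfolding Gelfand_def
proof
  fix M assume "M \<in> Max_ideals A"
  from assms[OF this] obtain \<omega> where \<omega>: "character F A \<omega>" "M = {a \<in> carrier A. \<omega> a = \<zero>\<^bsub>F\<^esub>}"
    by (elim exE conjE)
  show "residue_map A M \<in> ring_iso F (A Quot M)"
    unfolding \<omega>(2) by (rule residue_map_kernel_iso[OF \<omega>(1)])
qed

context
  fixes M assumes G: "Gelfand F A" and M: "M \<in> Max_ideals A"
begin

lemma Max_ideal: "ideal M A"
  using M unfolding Max_ideals_def by (simp add: maximalideal.axioms(1))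

lemma residue_iso: "residue_map A M \<in> ring_iso F (A Quot M)"
  using G M unfolding Gelfand_def by simp

text \<open>The evaluation at \<open>M\<close> is the quotient map to \<open>A / M\<close> followed by the inverse of the residue
  isomorphism.\<close>

lemma ev_character: "character F A (\<lambda>a. ev F A a M)"
proof -
  have "inv_into (carrier F) (residue_map A M) \<in> ring_iso (A Quot M) F"
    using ring_iso_set_sym[OF F.ring_axioms residue_iso] .
  then have "inv_into (carrier F) (residue_map A M) \<in> ring_hom (A Quot M) F"
    unfolding ring_iso_def by simp
  from ring_hom_trans[OF ideal.rcos_ring_hom[OF Max_ideal] this]
  have "(\<lambda>a. ev F A a M) \<in> ring_hom A F"
    using M unfolding ev_def o_def by simp
  moreover have "ev F A (scalar c) M = c" if "c \<in> carrier F" for c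
  proof -
    have "ev F A (scalar c) M = inv_into (carrier F) (residue_map A M) (residue_map A M c)"
      using M unfolding ev_def residue_map_def by simp
    then show ?thesis
      using residue_iso that unfolding ring_iso_def bij_betw_def by simp
  qed
  ultimately show ?thesis unfolding character_def by simp
qed

text \<open>All computations with the abstractly defined \<open>ev\<close> go through this description of its values.\<close>

lemma ev_iff:
  assumes a: "a \<in> carrier A" and c: "c \<in> carrier F"
  shows "ev F A a M = c \<longleftrightarrow> a \<ominus>\<^bsub>A\<^esub> scalar c \<in> M"
proof -
  have bij: "bij_betw (residue_map A M) (carrier F) (carrier (A Quot M))"
    using residue_iso unfolding ring_iso_def by simp
  have "M +>\<^bsub>A\<^esub> a \<in> carrier (A Quot M)"
    using ring_hom_closed[OF ideal.rcos_ring_hom[OF Max_ideal] a] .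
  then have "ev F A a M = c \<longleftrightarrow> M +>\<^bsub>A\<^esub> a = residue_map A M c"
    using M c bij unfolding ev_def
    by (auto simp: bij_betw_def f_inv_into_f)
  also have "\<dots> \<longleftrightarrow> a \<ominus>\<^bsub>A\<^esub> scalar c \<in> M"
    unfolding residue_map_def
    using A.quotient_eq_iff_same_a_r_cos[OF Max_ideal a scalar_closed[OF c]] by simp
  finally show ?thesis .
qed

lemma ev_closed: "a \<in> carrier A \<Longrightarrow> ev F A a M \<in> carrier F"
  using char_closed[OF ev_character] .

lemma ev_zero_iff: "a \<in> carrier A \<Longrightarrow> ev F A a M = \<zero>\<^bsub>F\<^esub> \<longleftrightarrow> a \<in> M"
  using ev_iff[of a "\<zero>\<^bsub>F\<^esub>"] by (simp add: scalar_zero a_minus_def)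

lemma Max_ideal_eq_kernel: "M = {a \<in> carrier A. ev F A a M = \<zero>\<^bsub>F\<^esub>}"
  using ev_zero_iff additive_subgroup.a_subset[OF ideal.axioms(1)[OF Max_ideal]] by auto

end

text \<open>Together with \<open>ev_character\<close> and \<open>Max_ideal_eq_kernel\<close>, this makes taking kernels and evaluating
  inverse bijections between characters (on \<open>carrier A\<close>) and maximal ideals.\<close>

lemma ev_kernel:
  assumes "Gelfand F A" and \<omega>: "character F A \<omega>" and a: "a \<in> carrier A"
  shows "ev F A a {a \<in> carrier A. \<omega> a = \<zero>\<^bsub>F\<^esub>} = \<omega> a"
proof -
  have "{a \<in> carrier A. \<omega> a = \<zero>\<^bsub>F\<^esub>} \<in> Max_ideals A"
    unfolding Max_ideals_def using kernel_maximal[OF \<omega>] by simp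
  from ev_iff[OF assms(1) this a char_closed[OF \<omega> a]] show ?thesis
    using kernel_diff_scalar[OF \<omega> a char_closed[OF \<omega> a]] by simp
qed

end

section \<open>The algebra of continuous functions\<close>

context topological_field
begin

lemma CF_mem: "f \<in> carrier (CF F T X) \<longleftrightarrow> f \<in> extensional (topspace X) \<and> continuous_map X T f"
  unfolding CF_def by simp

lemma CF_simps:
  "f \<otimes>\<^bsub>CF F T X\<^esub> g = (\<lambda>x\<in>topspace X. f x \<otimes> g x)"
  "f \<oplus>\<^bsub>CF F T X\<^esub> g = (\<lambda>x\<in>topspace X. f x \<oplus> g x)"
  "c \<odot>\<^bsub>CF F T X\<^esub> f = (\<lambda>x\<in>topspace X. c \<otimes> f x)"
  "\<one>\<^bsub>CF F T X\<^esub> = (\<lambda>x\<in>topspace X. \<one>)"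
  "\<zero>\<^bsub>CF F T X\<^esub> = (\<lambda>x\<in>topspace X. \<zero>)"
  unfolding CF_def by simp_all

lemma CF_restrict: "continuous_map X T f \<Longrightarrow> (\<lambda>x\<in>topspace X. f x) \<in> carrier (CF F T X)"
  unfolding CF_mem using continuous_map_eq[of X T f] by auto

lemma CF_cont: "f \<in> carrier (CF F T X) \<Longrightarrow> continuous_map X T f"
  and CF_ext: "f \<in> carrier (CF F T X) \<Longrightarrow> f \<in> extensional (topspace X)"
  unfolding CF_mem by auto

lemma CF_val: "f \<in> carrier (CF F T X) \<Longrightarrow> x \<in> topspace X \<Longrightarrow> f x \<in> carrier F"
  using CF_cont continuous_map_carrier by metis

lemma CF_eqI:
  "f \<in> carrier (CF F T X) \<Longrightarrow> g \<in> carrier (CF F T X) \<Longrightarrow> (\<And>x. x \<in> topspace X \<Longrightarrow> f x = g x) \<Longrightarrow> f = g"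
  using extensionalityI[OF CF_ext CF_ext] by blast

lemma CF_closed:
  "f \<in> carrier (CF F T X) \<Longrightarrow> g \<in> carrier (CF F T X) \<Longrightarrow> f \<otimes>\<^bsub>CF F T X\<^esub> g \<in> carrier (CF F T X)"
  "f \<in> carrier (CF F T X) \<Longrightarrow> g \<in> carrier (CF F T X) \<Longrightarrow> f \<oplus>\<^bsub>CF F T X\<^esub> g \<in> carrier (CF F T X)"
  "c \<in> carrier F \<Longrightarrow> f \<in> carrier (CF F T X) \<Longrightarrow> c \<odot>\<^bsub>CF F T X\<^esub> f \<in> carrier (CF F T X)"
  "\<one>\<^bsub>CF F T X\<^esub> \<in> carrier (CF F T X)"
  "\<zero>\<^bsub>CF F T X\<^esub> \<in> carrier (CF F T X)"
  unfolding CF_simps by (intro CF_restrict cont_intros CF_cont; simp)+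

lemma CF_cring: "cring (CF F T X)"
proof (rule cringI)
  note cl = CF_closed[where X = X]
  show "abelian_group (CF F T X)"
  proof (rule abelian_groupI)
    fix f g h assume f: "f \<in> carrier (CF F T X)" and g: "g \<in> carrier (CF F T X)" and h: "h \<in> carrier (CF F T X)"
    show "f \<oplus>\<^bsub>CF F T X\<^esub> g \<oplus>\<^bsub>CF F T X\<^esub> h = f \<oplus>\<^bsub>CF F T X\<^esub> (g \<oplus>\<^bsub>CF F T X\<^esub> h)"
      unfolding CF_simps by (rule restrict_ext) (use f g h in \<open>simp add: CF_val a_assoc\<close>)
  next
    fix f g assume f: "f \<in> carrier (CF F T X)" and g: "g \<in> carrier (CF F T X)"
    show "f \<oplus>\<^bsub>CF F T X\<^esub> g = g \<oplus>\<^bsub>CF F T X\<^esub> f"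
      unfolding CF_simps by (rule restrict_ext) (use f g in \<open>simp add: CF_val a_comm\<close>)
  next
    fix f assume f: "f \<in> carrier (CF F T X)"
    show "\<zero>\<^bsub>CF F T X\<^esub> \<oplus>\<^bsub>CF F T X\<^esub> f = f"
      by (rule CF_eqI[OF cl(2)[OF cl(5) f] f]) (use f in \<open>auto simp: CF_simps CF_val\<close>)
    let ?g = "\<lambda>x\<in>topspace X. \<ominus> f x"
    have g: "?g \<in> carrier (CF F T X)" by (intro CF_restrict cont_intros CF_cont f)
    have "?g \<oplus>\<^bsub>CF F T X\<^esub> f = \<zero>\<^bsub>CF F T X\<^esub>"
      unfolding CF_simps by (rule restrict_ext) (use f g in \<open>simp add: CF_val l_neg\<close>)
    then show "\<exists>g\<in>carrier (CF F T X). g \<oplus>\<^bsub>CF F T X\<^esub> f = \<zero>\<^bsub>CF F T X\<^esub>" using g by (intro bexI[of _ ?g])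
  qed (use cl in auto)
  show "comm_monoid (CF F T X)"
  proof (rule comm_monoidI)
    fix f g h assume f: "f \<in> carrier (CF F T X)" and g: "g \<in> carrier (CF F T X)" and h: "h \<in> carrier (CF F T X)"
    show "f \<otimes>\<^bsub>CF F T X\<^esub> g \<otimes>\<^bsub>CF F T X\<^esub> h = f \<otimes>\<^bsub>CF F T X\<^esub> (g \<otimes>\<^bsub>CF F T X\<^esub> h)"
      unfolding CF_simps by (rule restrict_ext) (use f g h in \<open>simp add: CF_val m_assoc\<close>)
  next
    fix f g assume f: "f \<in> carrier (CF F T X)" and g: "g \<in> carrier (CF F T X)"
    show "f \<otimes>\<^bsub>CF F T X\<^esub> g = g \<otimes>\<^bsub>CF F T X\<^esub> f"
      unfolding CF_simps by (rule restrict_ext) (use f g in \<open>simp add: CF_val m_comm\<close>)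
  next
    fix f assume f: "f \<in> carrier (CF F T X)"
    show "\<one>\<^bsub>CF F T X\<^esub> \<otimes>\<^bsub>CF F T X\<^esub> f = f"
      by (rule CF_eqI[OF cl(1)[OF cl(4) f] f]) (use f in \<open>auto simp: CF_simps CF_val\<close>)
  qed (use cl in auto)
  fix f g h assume f: "f \<in> carrier (CF F T X)" and g: "g \<in> carrier (CF F T X)" and h: "h \<in> carrier (CF F T X)"
  show "(f \<oplus>\<^bsub>CF F T X\<^esub> g) \<otimes>\<^bsub>CF F T X\<^esub> h = f \<otimes>\<^bsub>CF F T X\<^esub> h \<oplus>\<^bsub>CF F T X\<^esub> g \<otimes>\<^bsub>CF F T X\<^esub> h"
    unfolding CF_simps by (rule restrict_ext) (use f g h in \<open>simp add: CF_val l_distr\<close>)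
qed

lemma CF_algebra: "algebra F (CF F T X)"
proof (rule algebraI)
  note cl = CF_closed[where X = X]
  fix c d f assume c: "c \<in> carrier F" and d: "d \<in> carrier F" and f: "f \<in> carrier (CF F T X)"
  show "(c \<oplus> d) \<odot>\<^bsub>CF F T X\<^esub> f = c \<odot>\<^bsub>CF F T X\<^esub> f \<oplus>\<^bsub>CF F T X\<^esub> d \<odot>\<^bsub>CF F T X\<^esub> f"
    unfolding CF_simps by (rule restrict_ext) (use c d f in \<open>simp add: CF_val l_distr\<close>)
  show "(c \<otimes> d) \<odot>\<^bsub>CF F T X\<^esub> f = c \<odot>\<^bsub>CF F T X\<^esub> (d \<odot>\<^bsub>CF F T X\<^esub> f)"
    unfolding CF_simps by (rule restrict_ext) (use c d f in \<open>simp add: CF_val m_assoc\<close>)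
next
  note cl = CF_closed[where X = X]
  fix c f g assume c: "c \<in> carrier F" and f: "f \<in> carrier (CF F T X)" and g: "g \<in> carrier (CF F T X)"
  show "c \<odot>\<^bsub>CF F T X\<^esub> (f \<oplus>\<^bsub>CF F T X\<^esub> g) = c \<odot>\<^bsub>CF F T X\<^esub> f \<oplus>\<^bsub>CF F T X\<^esub> c \<odot>\<^bsub>CF F T X\<^esub> g"
    unfolding CF_simps by (rule restrict_ext) (use c f g in \<open>simp add: CF_val r_distr\<close>)
  show "c \<odot>\<^bsub>CF F T X\<^esub> f \<otimes>\<^bsub>CF F T X\<^esub> g = c \<odot>\<^bsub>CF F T X\<^esub> (f \<otimes>\<^bsub>CF F T X\<^esub> g)"
    unfolding CF_simps by (rule restrict_ext) (use c f g in \<open>simp add: CF_val m_assoc\<close>)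
next
  note cl = CF_closed[where X = X]
  fix f assume f: "f \<in> carrier (CF F T X)"
  show "\<one> \<odot>\<^bsub>CF F T X\<^esub> f = f"
    by (rule CF_eqI[OF CF_closed(3)[OF one_closed f] f]) (use f in \<open>auto simp: CF_simps CF_val\<close>)
qed (use CF_closed CF_cring is_cring in auto)

lemma CF_F_algebra: "F_algebra F T (CF F T X)"
  using CF_algebra topological_field_axioms by (intro F_algebra.intro)

lemma CF_eval_character:
  assumes "x \<in> topspace X"
  shows "character F (CF F T X) (\<lambda>f. f x)"
  unfolding character_def using assms CF_closed[where X = X]
  by (auto intro!: ring_hom_memI simp: CF_simps CF_val)

definition vanishing_ideal :: "'x topology \<Rightarrow> 'x \<Rightarrow> ('x \<Rightarrow> 'f) set" where
  "vanishing_ideal X x = {f \<in> carrier (CF F T X). f x = \<zero>}"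

lemma vanishing_ideal_Max: "x \<in> topspace X \<Longrightarrow> vanishing_ideal X x \<in> Max_ideals (CF F T X)"
  unfolding Max_ideals_def vanishing_ideal_def
  using F_algebra.kernel_maximal[OF CF_F_algebra CF_eval_character] by simp

text \<open>The witness is \<open>h = (e / f) f\<close>, where \<open>e\<close> is \<open>1\<close> near \<open>z\<close> and \<open>0\<close> on a neighbourhood of the zero set of \<open>f\<close>;
  so \<open>e / f\<close>, extended by \<open>\<zero>\<close>, is continuous.\<close>

lemma CF_local_unit:
  assumes X: "KH_obj F T X" and I: "ideal I (CF F T X)" and f: "f \<in> I" and z: "z \<in> topspace X" "f z \<noteq> \<zero>"
  shows "\<exists>N h. openin X N \<and> z \<in> N \<and> h \<in> I \<and> (\<forall>x\<in>N. h x = \<one>)"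
proof -
  have fC: "f \<in> carrier (CF F T X)"
    using additive_subgroup.a_subset[OF ideal.axioms(1)[OF I]] f by auto
  define U where "U = {x \<in> topspace X. f x \<noteq> \<zero>}"
  define Z where "Z = {x \<in> topspace X. f x = \<zero>}"
  have U: "openin X U" "z \<in> U" unfolding U_def using open_cozero CF_cont[OF fC] z by auto
  have Z: "closedin X Z" unfolding Z_def using closed_zero_set CF_cont[OF fC] by auto
  have reg: "regular_space X"
    using KH_Hausdorff[OF X] KH_compact[OF X] compact_Hausdorff_imp_regular_space by blast
  obtain N K where NK: "openin X N" "closedin X K" "z \<in> N" "N \<subseteq> K" "K \<subseteq> U"
  proof -
    have "neighbourhood_base_of (closedin X) X" using reg by (simp add: neighbourhood_base_of_closedin)
    then show ?thesis using that U unfolding neighbourhood_base_of by metis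
  qed
  have "disjnt K Z" using NK(5) unfolding U_def Z_def by (auto simp: disjnt_iff)
  then obtain A B where AB: "openin X A" "openin X B" "K \<subseteq> A" "Z \<subseteq> B" "disjnt A B"
    using KH_normal[OF X] NK(2) Z unfolding normal_space_def by meson
  have cA: "closedin X (topspace X - A)" using AB(1) by auto
  have "disjnt K (topspace X - A)" using AB(3) by (auto simp: disjnt_iff)
  from KH_F_normal[OF X NK(2) cA this] obtain e
    where e: "continuous_map X T e" "\<forall>x\<in>K. e x = \<one>" "\<forall>x\<in>topspace X - A. e x = \<zero>"
    by (elim exE conjE)
  have BX: "B \<subseteq> topspace X" using openin_subset[OF AB(2)] .
  have eB: "e x = \<zero>" if "x \<in> B" for x using e(3) that AB(5) BX by (auto simp: disjnt_iff)
  \<comment> \<open>\<open>e / f\<close>, extended by zero across the zero set of \<open>f\<close>\<close>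
  define g where "g x = (if f x = \<zero> then \<zero> else e x \<otimes> inv (f x))" for x
  have gU: "continuous_map (subtopology X U) T (\<lambda>x. e x \<otimes> inv (f x))"
    by (intro cont_intros continuous_map_from_subtopology e CF_cont[OF fC]) (auto simp: U_def)
  have gB: "g x = \<zero>" if "x \<in> B" for x
    using eB[OF that] CF_val[OF fC subsetD[OF BX that]] inv_closed unfolding g_def by simp
  have "continuous_map X T g"
    unfolding continuous_map_def
  proof (intro conjI allI impI)
    show "g \<in> topspace X \<rightarrow> topspace T"
      unfolding g_def using CF_val[OF fC] continuous_map_carrier[OF e(1)] inv_closed
      by (auto simp: topspace_eq)
    fix W assume W: "openin T W"
    have gZ: "g x = (if x \<in> U then e x \<otimes> inv (f x) else \<zero>)" if "x \<in> topspace X" for x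
      using that unfolding g_def U_def by simp
    have "{x \<in> topspace X. g x \<in> W}
        = {x \<in> U. e x \<otimes> inv (f x) \<in> W} \<union> (if \<zero> \<in> W then B else {})"
    proof (rule Set.set_eqI, rule iffI)
      fix x assume "x \<in> {x \<in> topspace X. g x \<in> W}"
      then have x: "x \<in> topspace X" "g x \<in> W" by auto
      show "x \<in> {x \<in> U. e x \<otimes> inv (f x) \<in> W} \<union> (if \<zero> \<in> W then B else {})"
        using x gZ[OF x(1)] AB(4) unfolding U_def Z_def by (auto split: if_splits)
    next
      fix x assume "x \<in> {x \<in> U. e x \<otimes> inv (f x) \<in> W} \<union> (if \<zero> \<in> W then B else {})"
      then consider "x \<in> U" "e x \<otimes> inv (f x) \<in> W" | "\<zero> \<in> W" "x \<in> B"
        by (auto split: if_splits)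
      then show "x \<in> {x \<in> topspace X. g x \<in> W}"
      proof cases
        case 1
        then show ?thesis using gZ[of x] openin_subset[OF U(1)] by auto
      next
        case 2
        then show ?thesis using gB[of x] BX by auto
      qed
    qed
    moreover have "openin X {x \<in> U. e x \<otimes> inv (f x) \<in> W}"
      using open_vimage[OF gU W] openin_trans_full[OF _ U(1)] openin_subset[OF U(1)]
      by (simp add: inf.absorb2)
    ultimately show "openin X {x \<in> topspace X. g x \<in> W}" using AB(2) by auto
  qed
  then have gC: "(\<lambda>x\<in>topspace X. g x) \<in> carrier (CF F T X)" by (rule CF_restrict)
  let ?h = "(\<lambda>x\<in>topspace X. g x) \<otimes>\<^bsub>CF F T X\<^esub> f"
  have hI: "?h \<in> I" using ideal.I_l_closed[OF I f gC] .
  have "?h x = \<one>" if "x \<in> N" for x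
  proof -
    have x: "x \<in> topspace X" "x \<in> K" "f x \<noteq> \<zero>"
      using that NK openin_subset[OF NK(1)] unfolding U_def by auto
    then show ?thesis
      using e(2) CF_val[OF fC x(1)] inv_left inv_closed unfolding CF_simps g_def by simp
  qed
  then show ?thesis using NK(1,3) hI by blast
qed

text \<open>Otherwise \<open>X\<close> is covered by finitely many open sets on each of which some member of \<open>I\<close> is \<open>1\<close>. If \<open>h\<close> and
  \<open>k\<close> are \<open>1\<close> on two sets, then \<open>1 - (1 - h) (1 - k)\<close> is \<open>1\<close> on their union.\<close>

lemma CF_ideal_fixed:
  assumes X: "KH_obj F T X" and I: "ideal I (CF F T X)" and proper: "I \<noteq> carrier (CF F T X)"
  shows "\<exists>x\<in>topspace X. I \<subseteq> vanishing_ideal X x"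
proof (rule ccontr)
  assume free: "\<not> ?thesis"
  interpret I: ideal I "CF F T X" by (rule I)
  have IC: "f \<in> carrier (CF F T X)" if "f \<in> I" for f using that I.a_subset by auto
  define \<W> where "\<W> = {N. openin X N \<and> (\<exists>h\<in>I. \<forall>x\<in>N. h x = \<one>)}"
  have "topspace X \<subseteq> \<Union>\<W>"
  proof
    fix z assume z: "z \<in> topspace X"
    then have "\<not> I \<subseteq> vanishing_ideal X z" using free by simp
    then obtain f where "f \<in> I" "f z \<noteq> \<zero>" using IC unfolding vanishing_ideal_def by auto
    then obtain N h where "openin X N" "z \<in> N" "h \<in> I" "\<forall>x\<in>N. h x = \<one>"
      using CF_local_unit[OF X I _ z] by meson
    then show "z \<in> \<Union>\<W>" unfolding \<W>_def by auto
  qed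
  moreover have "\<forall>N\<in>\<W>. openin X N" unfolding \<W>_def by simp
  ultimately obtain \<F> where \<F>: "finite \<F>" "\<F> \<subseteq> \<W>" "topspace X \<subseteq> \<Union>\<F>"
    using KH_compact[OF X] unfolding compact_space_alt by meson
  have "\<exists>h\<in>I. \<forall>x\<in>\<Union>\<F>. h x = \<one>"
    using \<F>(1,2)
  proof (induction \<F>)
    case empty
    then show ?case using I.zero_closed by (intro bexI[of _ "\<zero>\<^bsub>CF F T X\<^esub>"]) simp_all
  next
    case (insert N \<F>)
    then obtain h where h: "h \<in> I" "\<forall>x\<in>\<Union>\<F>. h x = \<one>" by auto
    obtain k where k: "openin X N" "k \<in> I" "\<forall>x\<in>N. k x = \<one>" using insert.prems unfolding \<W>_def by auto
    have X\<F>: "\<Union>\<F> \<subseteq> topspace X" "N \<subseteq> topspace X"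
      using insert.prems openin_subset unfolding \<W>_def by auto
    \<comment> \<open>\<open>1 - (1 - h) (1 - k)\<close>\<close>
    let ?m = "h \<oplus>\<^bsub>CF F T X\<^esub> (\<lambda>x\<in>topspace X. \<one> \<ominus> h x) \<otimes>\<^bsub>CF F T X\<^esub> k"
    have "(\<lambda>x\<in>topspace X. \<one> \<ominus> h x) \<in> carrier (CF F T X)"
      by (intro CF_restrict cont_intros CF_cont IC h) simp
    then have "?m \<in> I"
      using additive_subgroup.a_closed[OF ideal.axioms(1)[OF I] h(1) I.I_l_closed[OF k(2)]] by simp
    moreover have "?m x = \<one>" if x: "x \<in> \<Union>(insert N \<F>)" for x
    proof -
      have xX: "x \<in> topspace X" using x X\<F> by auto
      have c: "h x \<in> carrier F" "k x \<in> carrier F" using CF_val[OF IC[OF h(1)] xX] CF_val[OF IC[OF k(2)] xX] .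
      have "?m x = h x \<oplus> (\<one> \<ominus> h x) \<otimes> k x" using xX by (simp add: CF_simps)
      also have "\<dots> = \<one>"
      proof (cases "x \<in> N")
        case True
        then show ?thesis using c k(3) add_diff_cancel by simp
      next
        case False
        then have "h x = \<one>" using x h(2) by auto
        then show ?thesis using c by (simp add: diff_self)
      qed
      finally show ?thesis .
    qed
    ultimately show ?case by (intro bexI[of _ ?m]) auto
  qed
  then obtain h where h: "h \<in> I" "\<forall>x\<in>topspace X. h x = \<one>" using \<F>(3) by auto
  have "h = \<one>\<^bsub>CF F T X\<^esub>"
    by (rule CF_eqI[OF IC[OF h(1)] CF_closed(4)]) (use h in \<open>auto simp: CF_simps\<close>)
  then show False using I.one_imp_carrier h(1) proper by simp
qed

lemma CF_Max_ideals:
  assumes X: "KH_obj F T X"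
  shows "Max_ideals (CF F T X) = vanishing_ideal X ` topspace X"
proof
  show "vanishing_ideal X ` topspace X \<subseteq> Max_ideals (CF F T X)"
    using vanishing_ideal_Max by auto
  show "Max_ideals (CF F T X) \<subseteq> vanishing_ideal X ` topspace X"
  proof
    fix M assume "M \<in> Max_ideals (CF F T X)"
    then interpret M: maximalideal M "CF F T X" unfolding Max_ideals_def by simp
    obtain x where x: "x \<in> topspace X" "M \<subseteq> vanishing_ideal X x"
      using CF_ideal_fixed[OF X M.is_ideal] M.I_notcarr by auto
    have "maximalideal (vanishing_ideal X x) (CF F T X)"
      using vanishing_ideal_Max[OF x(1)] unfolding Max_ideals_def by simp
    then interpret V: maximalideal "vanishing_ideal X x" "CF F T X" .
    have "vanishing_ideal X x = M"
      using M.I_maximal[OF V.is_ideal x(2) V.a_subset] V.I_notcarr by auto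
    then show "M \<in> vanishing_ideal X ` topspace X" using x(1) by auto
  qed
qed

text \<open>Functions supported in disjoint neighbourhoods of \<open>x\<close> and \<open>y\<close> have product zero, so one of them lies
  in \<open>P\<close>, although neither vanishes at its own point.\<close>

lemma CF_prime_unique:
  assumes X: "KH_obj F T X" and P: "primeideal P (CF F T X)"
    and x: "x \<in> topspace X" "P \<subseteq> vanishing_ideal X x"
    and y: "y \<in> topspace X" "P \<subseteq> vanishing_ideal X y"
  shows "x = y"
proof (rule ccontr)
  assume "x \<noteq> y"
  interpret P: primeideal P "CF F T X" by (rule P)
  obtain U V where UV: "openin X U" "openin X V" "x \<in> U" "y \<in> V" "disjnt U V"
    using KH_Hausdorff[OF X] x(1) y(1) \<open>x \<noteq> y\<close> unfolding Hausdorff_space_def by metis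
  obtain f where f: "continuous_map X T f" "f x = \<one>" "\<And>z. z \<in> topspace X - U \<Longrightarrow> f z = \<zero>"
    using KH_separate[OF X, of "topspace X - U" x] UV(1,3) x(1) by auto
  obtain g where g: "continuous_map X T g" "g y = \<one>" "\<And>z. z \<in> topspace X - V \<Longrightarrow> g z = \<zero>"
    using KH_separate[OF X, of "topspace X - V" y] UV(2,4) y(1) by auto
  let ?f = "\<lambda>x\<in>topspace X. f x" and ?g = "\<lambda>x\<in>topspace X. g x"
  have fg: "?f \<in> carrier (CF F T X)" "?g \<in> carrier (CF F T X)" using CF_restrict f(1) g(1) by auto
  have "?f \<otimes>\<^bsub>CF F T X\<^esub> ?g = \<zero>\<^bsub>CF F T X\<^esub>"
  proof (rule CF_eqI[OF CF_closed(1)[OF fg] CF_closed(5)])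
    fix z assume z: "z \<in> topspace X"
    have "f z = \<zero> \<or> g z = \<zero>" using f(3) g(3) z UV(5) by (auto simp: disjnt_iff)
    then show "(?f \<otimes>\<^bsub>CF F T X\<^esub> ?g) z = \<zero>\<^bsub>CF F T X\<^esub> z"
      using z continuous_map_carrier[OF f(1) z] continuous_map_carrier[OF g(1) z] by (auto simp: CF_simps)
  qed
  then have "?f \<in> P \<or> ?g \<in> P" using P.I_prime[OF fg] P.zero_closed by simp
  then show False
    using x y f(2) g(2) zero_not_one unfolding vanishing_ideal_def by auto
qed

lemma CF_unit_iff:
  assumes f: "f \<in> carrier (CF F T X)"
  shows "f \<in> Units (CF F T X) \<longleftrightarrow> (\<forall>x\<in>topspace X. f x \<noteq> \<zero>)"
proof
  assume "f \<in> Units (CF F T X)"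
  then obtain g where g: "g \<in> carrier (CF F T X)" "g \<otimes>\<^bsub>CF F T X\<^esub> f = \<one>\<^bsub>CF F T X\<^esub>"
    unfolding Units_def by auto
  show "\<forall>x\<in>topspace X. f x \<noteq> \<zero>"
  proof
    fix x assume x: "x \<in> topspace X"
    have "g x \<otimes> f x = \<one>" using fun_cong[OF g(2), of x] x by (simp add: CF_simps)
    then show "f x \<noteq> \<zero>" using CF_val[OF g(1) x] zero_not_one by auto
  qed
next
  assume nz: "\<forall>x\<in>topspace X. f x \<noteq> \<zero>"
  let ?g = "\<lambda>x\<in>topspace X. inv (f x)"
  have g: "?g \<in> carrier (CF F T X)" by (intro CF_restrict cont_intros CF_cont f) (use nz in auto)
  have "?g \<otimes>\<^bsub>CF F T X\<^esub> f = \<one>\<^bsub>CF F T X\<^esub>"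
    by (rule CF_eqI[OF CF_closed(1)[OF g f] CF_closed(4)])
      (use nz CF_val[OF f] inv_left in \<open>auto simp: CF_simps\<close>)
  moreover from this have "f \<otimes>\<^bsub>CF F T X\<^esub> ?g = \<one>\<^bsub>CF F T X\<^esub>"
    using comm_monoid.m_comm[OF cring.axioms(2)[OF CF_cring] f g] by simp
  ultimately show "f \<in> Units (CF F T X)" unfolding Units_def using f g by blast
qed

lemma CF_spectrum:
  assumes f: "f \<in> carrier (CF F T X)"
  shows "spectrum F (CF F T X) f = f ` topspace X"
proof -
  interpret FA: F_algebra F T "CF F T X" by (rule CF_F_algebra)
  have "(f \<ominus>\<^bsub>CF F T X\<^esub> FA.scalar c) x = f x \<ominus> c" if "c \<in> carrier F" "x \<in> topspace X" for c x
    using FA.char_minus[OF CF_eval_character[OF that(2)] f FA.scalar_closed[OF that(1)]]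
      FA.char_scalar[OF CF_eval_character[OF that(2)] that(1)] by simp
  then show ?thesis
    unfolding spectrum_def
    using CF_unit_iff[OF FA.A.minus_closed[OF f FA.scalar_closed]] CF_val[OF f] diff_eq_zero by auto
qed

theorem CF_obj:
  assumes X: "KH_obj F T X"
  shows "AF_obj F T (CF F T X)"
proof -
  interpret FA: F_algebra F T "CF F T X" by (rule CF_F_algebra)
  have "Gelfand F (CF F T X)"
  proof (rule FA.Gelfand_if_characters)
    fix M assume "M \<in> Max_ideals (CF F T X)"
    then obtain x where "x \<in> topspace X" "M = vanishing_ideal X x" using CF_Max_ideals[OF X] by auto
    then show "\<exists>\<omega>. character F (CF F T X) \<omega> \<and> M = {a \<in> carrier (CF F T X). \<omega> a = \<zero>}"
      using CF_eval_character unfolding vanishing_ideal_def by (intro exI[of _ "\<lambda>f. f x"]) simp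
  qed
  moreover have "compactin T (spectrum F (CF F T X) f)" if "f \<in> carrier (CF F T X)" for f
    unfolding CF_spectrum[OF that]
    using image_compactin[OF _ CF_cont[OF that]] KH_compact[OF X] unfolding compact_space_def by blast
  moreover have "\<exists>!M. M \<in> Max_ideals (CF F T X) \<and> P \<subseteq> M" if P: "primeideal P (CF F T X)" for P
  proof -
    interpret P: primeideal P "CF F T X" by (rule P)
    obtain x where x: "x \<in> topspace X" "P \<subseteq> vanishing_ideal X x"
      using CF_ideal_fixed[OF X P.is_ideal] P.I_notcarr by auto
    show ?thesis
    proof (rule ex1I[of _ "vanishing_ideal X x"])
      fix M assume M: "M \<in> Max_ideals (CF F T X) \<and> P \<subseteq> M"
      then obtain y where y: "y \<in> topspace X" "M = vanishing_ideal X y" using CF_Max_ideals[OF X] by auto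
      then show "M = vanishing_ideal X x" using CF_prime_unique[OF X P x] M by auto
    qed (use x vanishing_ideal_Max in auto)
  qed
  ultimately show ?thesis
    unfolding AF_obj_def using CF_algebra by auto
qed

end

section \<open>The maximal ideal space\<close>

text \<open>An ideal maximal among those that avoid \<open>S\<close> is prime: if \<open>a\<close> and \<open>b\<close> are not in \<open>P\<close>, then \<open>P + (a)\<close> and
  \<open>P + (b)\<close> meet \<open>S\<close>, and if \<open>a b\<close> were in \<open>P\<close>, the product of the two elements of \<open>S\<close> would be in \<open>P\<close>.\<close>

lemma (in cring) prime_ideal_avoiding:
  assumes S: "S \<subseteq> carrier R" "\<one> \<in> S" "\<zero> \<notin> S" "\<And>s t. s \<in> S \<Longrightarrow> t \<in> S \<Longrightarrow> s \<otimes> t \<in> S"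
  shows "\<exists>P. primeideal P R \<and> P \<inter> S = {}"
proof -
  define \<I> where "\<I> = {I. ideal I R \<and> I \<inter> S = {}}"
  have "{\<zero>} \<in> \<I>" unfolding \<I>_def using zeroideal S(3) by auto
  then have ne: "\<I> \<noteq> {}" by auto
  have ch: "\<Union>C \<in> \<I>" if C: "C \<noteq> {}" "subset.chain \<I> C" for C
  proof -
    have "subset.chain {I. ideal I R} C" using C(2) unfolding pred_on.chain_def \<I>_def by auto
    from chain_Union_is_ideal[OF this] have "ideal (\<Union>C) R" using C(1) by simp
    then show ?thesis using C(2) unfolding pred_on.chain_def \<I>_def by auto
  qed
  have "\<exists>P\<in>\<I>. \<forall>I\<in>\<I>. P \<subseteq> I \<longrightarrow> I = P"
    by (rule subset_Zorn_nonempty[OF ne ch])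
  then obtain P where P: "P \<in> \<I>" and Pmax: "\<forall>I\<in>\<I>. P \<subseteq> I \<longrightarrow> I = P"
    by (elim bexE)
  have iP: "ideal P R" and PS: "P \<inter> S = {}" using P unfolding \<I>_def by auto
  interpret P: ideal P R by (rule iP)
  have meets: "\<exists>s\<in>S. \<exists>p\<in>P. \<exists>x\<in>carrier R. s = p \<oplus> x \<otimes> a" if a: "a \<in> carrier R" "a \<notin> P" for a
  proof (rule ccontr)
    assume no: "\<not> ?thesis"
    let ?I = "P <+>\<^bsub>R\<^esub> PIdl a"
    have "ideal ?I R" using add_ideals[OF iP cgenideal_ideal[OF a(1)]] .
    moreover have "?I \<inter> S = {}" using no unfolding set_add_def' cgenideal_def by auto
    moreover have "P \<subseteq> ?I"
    proof
      fix p assume "p \<in> P"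
      moreover have "\<zero> \<otimes> a \<in> PIdl a" unfolding cgenideal_def by auto
      moreover have "p = p \<oplus> \<zero> \<otimes> a" using \<open>p \<in> P\<close> P.a_subset a(1) by auto
      ultimately show "p \<in> ?I" unfolding set_add_def' by blast
    qed
    ultimately have "?I = P" using Pmax unfolding \<I>_def by auto
    moreover have "\<zero> \<oplus> a \<in> ?I"
      using P.zero_closed cgenideal_self[OF a(1)] unfolding set_add_def' by blast
    ultimately show False using a by simp
  qed
  have "primeideal P R"
  proof (rule primeidealI[OF iP is_cring])
    show "carrier R \<noteq> P" using S(2) PS by auto
    fix a b assume ab: "a \<in> carrier R" "b \<in> carrier R" "a \<otimes> b \<in> P"
    show "a \<in> P \<or> b \<in> P"
    proof (rule ccontr)
      assume "\<not> (a \<in> P \<or> b \<in> P)"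
      then have nab: "a \<notin> P" "b \<notin> P" by auto
      obtain s p x where s: "s \<in> S" "p \<in> P" "x \<in> carrier R" "s = p \<oplus> x \<otimes> a"
        using meets[OF ab(1) nab(1)] by auto
      obtain t q y where t: "t \<in> S" "q \<in> P" "y \<in> carrier R" "t = q \<oplus> y \<otimes> b"
        using meets[OF ab(2) nab(2)] by auto
      have c: "p \<in> carrier R" "q \<in> carrier R" using s(2) t(2) P.a_subset by auto
      have "s \<otimes> t = (p \<otimes> t \<oplus> (x \<otimes> a) \<otimes> q) \<oplus> (x \<otimes> y) \<otimes> (a \<otimes> b)"
        unfolding s(4) t(4) using c s(3) t(3) ab by algebra
      moreover have "p \<otimes> t \<in> P" "(x \<otimes> a) \<otimes> q \<in> P" "(x \<otimes> y) \<otimes> (a \<otimes> b) \<in> P"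
        using P.I_r_closed P.I_l_closed s t ab S(1) by auto
      ultimately have "s \<otimes> t \<in> P" using P.a_closed by simp
      then show False using S(4)[OF s(1) t(1)] PS by auto
    qed
  qed
  then show ?thesis using PS by auto
qed

lemma closedin_Collect_all:
  assumes "\<And>i. i \<in> I \<Longrightarrow> closedin X {x \<in> topspace X. Q i x}"
  shows "closedin X {x \<in> topspace X. \<forall>i\<in>I. Q i x}"
proof -
  have "openin X (\<Union>i\<in>I. topspace X - {x \<in> topspace X. Q i x})"
    using assms by blast
  moreover have "topspace X - {x \<in> topspace X. \<forall>i\<in>I. Q i x}
      = (\<Union>i\<in>I. topspace X - {x \<in> topspace X. Q i x})"
    by auto
  ultimately show ?thesis unfolding closedin_def by auto
qed

context F_algebra
begin

lemma Max_prime: "M \<in> Max_ideals A \<Longrightarrow> primeideal M A"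
  unfolding Max_ideals_def using A.maximalideal_prime by simp

lemma one_notin_Max: "M \<in> Max_ideals A \<Longrightarrow> \<one>\<^bsub>A\<^esub> \<notin> M"
  using Max_prime ideal.one_imp_carrier primeideal.axioms(1) primeideal.I_notcarr by metis

lemma MF_topspace: "topspace (MF A) = Max_ideals A"
  unfolding MF_def topology_generated_by_topspace using one_notin_Max by auto

lemma MF_basic_open: "a \<in> carrier A \<Longrightarrow> openin (MF A) {M \<in> Max_ideals A. a \<notin> M}"
  unfolding MF_def by (rule topology_generated_by_Basis) auto

text \<open>The sets \<open>D(a)\<close> were only declared a subbase; they are a base because \<open>D(a) \<inter> D(b) = D(a b)\<close>.\<close>

lemma MF_base:
  assumes "openin (MF A) U" "M \<in> U"
  shows "\<exists>a\<in>carrier A. a \<notin> M \<and> (\<forall>N\<in>Max_ideals A. a \<notin> N \<longrightarrow> N \<in> U)"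
proof -
  have "generate_topology_on ((\<lambda>a. {M \<in> Max_ideals A. a \<notin> M}) ` carrier A) U"
    using openin_topology_generated_by assms(1) unfolding MF_def by auto
  then show ?thesis
    using assms(2)
  proof (induction arbitrary: M)
    case (Int U V)
    have "M \<in> Max_ideals A"
      using Int.hyps(1) Int.prems openin_subset[of "MF A" U] MF_topspace
      unfolding MF_def openin_topology_generated_by_iff by auto
    then have pr: "primeideal M A" by (rule Max_prime)
    obtain a where a: "a \<in> carrier A" "a \<notin> M" "\<forall>N\<in>Max_ideals A. a \<notin> N \<longrightarrow> N \<in> U"
      using Int.IH(1) Int.prems by auto
    obtain b where b: "b \<in> carrier A" "b \<notin> M" "\<forall>N\<in>Max_ideals A. b \<notin> N \<longrightarrow> N \<in> V"
      using Int.IH(2) Int.prems by auto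
    have "a \<otimes>\<^bsub>A\<^esub> b \<notin> M" using primeideal.I_prime[OF pr a(1) b(1)] a(2) b(2) by auto
    moreover have "a \<notin> N" "b \<notin> N" if "N \<in> Max_ideals A" "a \<otimes>\<^bsub>A\<^esub> b \<notin> N" for N
      using ideal.I_r_closed[OF primeideal.axioms(1)[OF Max_prime[OF that(1)]], of a b]
        ideal.I_l_closed[OF primeideal.axioms(1)[OF Max_prime[OF that(1)]], of b a] a(1) b(1) that(2) by auto
    ultimately show ?case
      using a b by (intro bexI[of _ "a \<otimes>\<^bsub>A\<^esub> b"]) auto
  next
    case (UN K)
    then obtain U where "U \<in> K" "M \<in> U" by auto
    then obtain a where "a \<in> carrier A" "a \<notin> M" "\<forall>N\<in>Max_ideals A. a \<notin> N \<longrightarrow> N \<in> U"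
      using UN.IH by metis
    then show ?case using \<open>U \<in> K\<close> by auto
  next
    case (Basis U)
    then show ?case by auto
  qed simp
qed

text \<open>For distinct \<open>M\<close> and \<open>N\<close>, the products \<open>a b\<close> with \<open>a \<notin> M\<close> and \<open>b \<notin> N\<close> form a multiplicative set. A prime
  ideal that avoids it lies in both \<open>M\<close> and \<open>N\<close>, so no such prime exists and the set contains zero:
  \<open>a b = 0\<close>. Then \<open>D(a)\<close> and \<open>D(b)\<close> are disjoint neighbourhoods.\<close>

lemma MF_Hausdorff:
  assumes pm: "\<And>P. primeideal P A \<Longrightarrow> \<exists>!M. M \<in> Max_ideals A \<and> P \<subseteq> M"
  shows "Hausdorff_space (MF A)"
  unfolding Hausdorff_space_def MF_topspace
proof (intro allI impI; elim conjE)
  fix M N assume M: "M \<in> Max_ideals A" and N: "N \<in> Max_ideals A" and "M \<noteq> N"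
  have pM: "primeideal M A" and pN: "primeideal N A" using Max_prime M N by auto
  have "\<exists>a\<in>carrier A - M. \<exists>b\<in>carrier A - N. a \<otimes>\<^bsub>A\<^esub> b = \<zero>\<^bsub>A\<^esub>"
  proof (rule ccontr)
    assume no: "\<not> ?thesis"
    let ?S = "{a \<otimes>\<^bsub>A\<^esub> b |a b. a \<in> carrier A - M \<and> b \<in> carrier A - N}"
    have mem: "a \<otimes>\<^bsub>A\<^esub> b \<in> ?S" if "a \<in> carrier A" "a \<notin> M" "b \<in> carrier A" "b \<notin> N" for a b
      using that by auto
    have one: "\<one>\<^bsub>A\<^esub> \<notin> M" "\<one>\<^bsub>A\<^esub> \<notin> N" using one_notin_Max M N by auto
    have "\<exists>P. primeideal P A \<and> P \<inter> ?S = {}"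
    proof (rule A.prime_ideal_avoiding)
      show "\<one>\<^bsub>A\<^esub> \<in> ?S" using mem[OF A.one_closed one(1) A.one_closed one(2)] by simp
      show "\<zero>\<^bsub>A\<^esub> \<notin> ?S" using no by force
      fix s t assume "s \<in> ?S" "t \<in> ?S"
      then obtain a b c d where s: "a \<in> carrier A" "a \<notin> M" "b \<in> carrier A" "b \<notin> N" "s = a \<otimes>\<^bsub>A\<^esub> b"
        and t: "c \<in> carrier A" "c \<notin> M" "d \<in> carrier A" "d \<notin> N" "t = c \<otimes>\<^bsub>A\<^esub> d" by auto
      have "a \<otimes>\<^bsub>A\<^esub> c \<notin> M" "b \<otimes>\<^bsub>A\<^esub> d \<notin> N"
        using primeideal.I_prime[OF pM s(1) t(1)] primeideal.I_prime[OF pN s(3) t(3)] s t by auto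
      moreover have "s \<otimes>\<^bsub>A\<^esub> t = (a \<otimes>\<^bsub>A\<^esub> c) \<otimes>\<^bsub>A\<^esub> (b \<otimes>\<^bsub>A\<^esub> d)"
        unfolding s(5) t(5) using s t by (simp add: A.m_assoc A.m_lcomm)
      ultimately show "s \<otimes>\<^bsub>A\<^esub> t \<in> ?S" using mem s t by simp
    qed auto
    then obtain P where P: "primeideal P A" "P \<inter> ?S = {}" by auto
    have PA: "P \<subseteq> carrier A"
      using additive_subgroup.a_subset[OF ideal.axioms(1)[OF primeideal.axioms(1)[OF P(1)]]] .
    have "P \<subseteq> M"
    proof (rule subsetI, rule ccontr)
      fix x assume x: "x \<in> P" "x \<notin> M"
      then have xc: "x \<in> carrier A" using PA by auto
      from mem[OF xc x(2) A.one_closed one(2)] have "x \<in> ?S" by (simp only: A.r_one[OF xc])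
      then show False using P(2) x(1) by blast
    qed
    moreover have "P \<subseteq> N"
    proof (rule subsetI, rule ccontr)
      fix x assume x: "x \<in> P" "x \<notin> N"
      then have xc: "x \<in> carrier A" using PA by auto
      from mem[OF A.one_closed one(1) xc x(2)] have "x \<in> ?S" by (simp only: A.l_one[OF xc])
      then show False using P(2) x(1) by blast
    qed
    ultimately show False using pm[OF P(1)] M N \<open>M \<noteq> N\<close> by auto
  qed
  then obtain a b where ab: "a \<in> carrier A" "a \<notin> M" "b \<in> carrier A" "b \<notin> N" "a \<otimes>\<^bsub>A\<^esub> b = \<zero>\<^bsub>A\<^esub>" by auto
  have "a \<in> L \<or> b \<in> L" if "L \<in> Max_ideals A" for L
    using primeideal.I_prime[OF Max_prime[OF that] ab(1,3)] ab(5)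
      additive_subgroup.zero_closed[OF ideal.axioms(1)[OF primeideal.axioms(1)[OF Max_prime[OF that]]]] by simp
  then have "disjnt {M \<in> Max_ideals A. a \<notin> M} {M \<in> Max_ideals A. b \<notin> M}"
    by (auto simp: disjnt_iff)
  then show "\<exists>U V. openin (MF A) U \<and> openin (MF A) V \<and> M \<in> U \<and> N \<in> V \<and> disjnt U V"
    using MF_basic_open[OF ab(1)] MF_basic_open[OF ab(3)] M N ab(2,4)
    by (intro exI[of _ "{M \<in> Max_ideals A. a \<notin> M}"] exI[of _ "{M \<in> Max_ideals A. b \<notin> M}"]) simp
qed

definition spectral_product :: "('a \<Rightarrow> 'f) topology" where
  "spectral_product = product_topology (\<lambda>a. subtopology T (spectrum F A a)) (carrier A)"

text \<open>The topology of pointwise convergence on the characters is the one induced by \<open>spectral_product\<close>. Its points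
  are extensional on \<open>carrier A\<close>, so a maximal ideal of a Gelfand algebra is the kernel of exactly one of them.\<close>

definition character_space :: "('a \<Rightarrow> 'f) set" where
  "character_space = {\<omega> \<in> topspace spectral_product. character F A \<omega>}"

lemma spectral_product_projection:
  "a \<in> carrier A \<Longrightarrow> continuous_map spectral_product T (\<lambda>\<omega>. \<omega> a)"
  using continuous_map_product_projection[of a "carrier A" "\<lambda>a. subtopology T (spectrum F A a)"]
    continuous_map_into_fulltopology
  unfolding spectral_product_def by blast

lemma character_space_closed: "closedin spectral_product character_space"
proof -
  let ?P = spectral_product
  have val: "\<omega> a \<in> carrier F" if "\<omega> \<in> topspace ?P" "a \<in> carrier A" for \<omega> a
    using F.continuous_map_carrier[OF spectral_product_projection[OF that(2)] that(1)] .
  let ?mult = "{\<omega> \<in> topspace ?P. \<forall>p\<in>carrier A \<times> carrier A.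
      \<omega> (fst p \<otimes>\<^bsub>A\<^esub> snd p) = \<omega> (fst p) \<otimes>\<^bsub>F\<^esub> \<omega> (snd p)}"
  let ?add = "{\<omega> \<in> topspace ?P. \<forall>p\<in>carrier A \<times> carrier A.
      \<omega> (fst p \<oplus>\<^bsub>A\<^esub> snd p) = \<omega> (fst p) \<oplus>\<^bsub>F\<^esub> \<omega> (snd p)}"
  let ?scal = "{\<omega> \<in> topspace ?P. \<forall>c\<in>carrier F. \<omega> (scalar c) = c}"
  have "closedin ?P ?mult" "closedin ?P ?add" "closedin ?P ?scal"
    by (intro closedin_Collect_all closedin_continuous_maps_eq[OF F.Hausdorff] F.cont_intros
        spectral_product_projection; auto simp: scalar_closed)+
  then have "closedin ?P (?mult \<inter> ?add \<inter> ?scal)" by (intro closedin_Int)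
  moreover have "character_space = ?mult \<inter> ?add \<inter> ?scal"
  proof (rule Set.set_eqI, rule iffI)
    fix \<omega> assume "\<omega> \<in> ?mult \<inter> ?add \<inter> ?scal"
    then have o: "\<omega> \<in> topspace ?P"
      "\<And>a b. a \<in> carrier A \<Longrightarrow> b \<in> carrier A \<Longrightarrow> \<omega> (a \<otimes>\<^bsub>A\<^esub> b) = \<omega> a \<otimes>\<^bsub>F\<^esub> \<omega> b"
      "\<And>a b. a \<in> carrier A \<Longrightarrow> b \<in> carrier A \<Longrightarrow> \<omega> (a \<oplus>\<^bsub>A\<^esub> b) = \<omega> a \<oplus>\<^bsub>F\<^esub> \<omega> b"
      "\<And>c. c \<in> carrier F \<Longrightarrow> \<omega> (scalar c) = c" by auto
    have "\<omega> \<one>\<^bsub>A\<^esub> = \<one>\<^bsub>F\<^esub>" using o(4)[OF F.one_closed] scalar_one by simp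
    then have "\<omega> \<in> ring_hom A F" by (intro ring_hom_memI o val)
    then show "\<omega> \<in> character_space" unfolding character_space_def character_def using o(1,4) by simp
  next
    fix \<omega> assume "\<omega> \<in> character_space"
    then show "\<omega> \<in> ?mult \<inter> ?add \<inter> ?scal"
      unfolding character_space_def character_def by (auto simp: ring_hom_mult ring_hom_add)
  qed
  ultimately show ?thesis by simp
qed

context
  assumes AF: "AF_obj F T A"
begin

lemma AF_Gelfand: "Gelfand F A"
  and AF_spectrum: "a \<in> carrier A \<Longrightarrow> compactin T (spectrum F A a)"
  and AF_pm: "primeideal P A \<Longrightarrow> \<exists>!M. M \<in> Max_ideals A \<and> P \<subseteq> M"
  using AF unfolding AF_obj_def by auto

text \<open>\<open>a - ev a M\<close> lies in \<open>M\<close>, and a maximal ideal contains no unit.\<close>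

lemma ev_in_spectrum:
  assumes M: "M \<in> Max_ideals A" and a: "a \<in> carrier A"
  shows "ev F A a M \<in> spectrum F A a"
proof -
  have c: "ev F A a M \<in> carrier F" using ev_closed[OF AF_Gelfand M a] .
  have "a \<ominus>\<^bsub>A\<^esub> scalar (ev F A a M) \<in> M" using ev_iff[OF AF_Gelfand M a c] by simp
  moreover have "u \<notin> M" if u: "u \<in> Units A" for u
  proof
    assume "u \<in> M"
    then have "inv\<^bsub>A\<^esub> u \<otimes>\<^bsub>A\<^esub> u \<in> M"
      using ideal.I_l_closed[OF Max_ideal[OF AF_Gelfand M]] A.Units_inv_closed[OF u] by simp
    then show False using A.Units_l_inv[OF u] one_notin_Max[OF M] by simp
  qed
  ultimately show ?thesis unfolding spectrum_def using c by auto
qed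

abbreviation kernel :: "('a \<Rightarrow> 'f) \<Rightarrow> 'a set" where
  "kernel \<omega> \<equiv> {a \<in> carrier A. \<omega> a = \<zero>\<^bsub>F\<^esub>}"

lemma kernel_Max: "character F A \<omega> \<Longrightarrow> kernel \<omega> \<in> Max_ideals A"
  unfolding Max_ideals_def using kernel_maximal by simp

lemma spectral_product_compact: "compact_space spectral_product"
  unfolding spectral_product_def compact_space_product_topology
  using AF_spectrum compact_space_subtopology by auto

lemma Max_ideals_are_kernels:
  assumes M: "M \<in> Max_ideals A"
  obtains \<omega> where "\<omega> \<in> character_space" "kernel \<omega> = M"
proof
  let ?w = "\<lambda>a\<in>carrier A. ev F A a M"
  have ch: "character F A (\<lambda>a. ev F A a M)" using ev_character[OF AF_Gelfand M] .
  have "character F A ?w"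
    unfolding character_def
    using char_scalar[OF ch] scalar_closed ring_hom_mult[OF char_hom[OF ch]]
      ring_hom_add[OF char_hom[OF ch]] ring_hom_one[OF char_hom[OF ch]] char_closed[OF ch]
    by (auto intro!: ring_hom_memI)
  moreover have "?w \<in> topspace spectral_product"
    unfolding spectral_product_def
    using ev_in_spectrum[OF M] ev_closed[OF AF_Gelfand M] by (auto simp: F.topspace_eq)
  ultimately show "?w \<in> character_space" unfolding character_space_def by simp
  show "kernel ?w = M" using Max_ideal_eq_kernel[OF AF_Gelfand M] by auto
qed

lemma kernel_continuous: "continuous_map (subtopology spectral_product character_space) (MF A) kernel"
  unfolding MF_def
proof (rule continuous_on_generated_topo)
  let ?H = "subtopology spectral_product character_space"
  have top: "topspace ?H = character_space" unfolding character_space_def by auto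
  fix U assume "U \<in> (\<lambda>a. {M \<in> Max_ideals A. a \<notin> M}) ` carrier A"
  then obtain a where a: "a \<in> carrier A" "U = {M \<in> Max_ideals A. a \<notin> M}" by auto
  have "kernel -` U \<inter> topspace ?H = {\<omega> \<in> topspace ?H. \<omega> a \<noteq> \<zero>\<^bsub>F\<^esub>}"
    unfolding top a(2) using a(1) kernel_Max by (auto simp: character_space_def)
  also have "openin ?H \<dots>"
    by (intro F.open_cozero continuous_map_from_subtopology spectral_product_projection a)
  finally show "openin ?H (kernel -` U \<inter> topspace ?H)" .
next
  show "kernel ` topspace (subtopology spectral_product character_space)
      \<subseteq> \<Union> ((\<lambda>a. {M \<in> Max_ideals A. a \<notin> M}) ` carrier A)"
    using kernel_Max MF_topspace unfolding MF_def topology_generated_by_topspace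
    by (auto simp: character_space_def)
qed

lemma kernel_image: "kernel ` character_space = Max_ideals A"
  using kernel_Max Max_ideals_are_kernels unfolding character_space_def by blast

lemma character_space_compact: "compact_space (subtopology spectral_product character_space)"
  using closedin_compact_space[OF spectral_product_compact character_space_closed]
    compact_space_subtopology by blast

lemma MF_compact: "compact_space (MF A)"
proof -
  have "compactin spectral_product character_space"
    using closedin_compact_space[OF spectral_product_compact character_space_closed] .
  then have "compactin (subtopology spectral_product character_space) character_space"
    by (simp add: compactin_subtopology)
  from image_compactin[OF this kernel_continuous] show ?thesis
    unfolding compact_space_def MF_topspace kernel_image .
qed

text \<open>Taking kernels is a continuous map from a compact space to a Hausdorff space, hence closed, and it
  carries the coordinate \<open>\<omega> \<mapsto> \<omega> a\<close> to \<open>ev a\<close>.\<close>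

lemma ev_continuous:
  assumes a: "a \<in> carrier A"
  shows "continuous_map (MF A) T (\<lambda>M. ev F A a M)"
  unfolding continuous_map_closedin
proof (intro conjI allI impI)
  let ?H = "subtopology spectral_product character_space"
  have top: "topspace ?H = character_space" unfolding character_space_def by auto
  show "(\<lambda>M. ev F A a M) \<in> topspace (MF A) \<rightarrow> topspace T"
    using ev_closed[OF AF_Gelfand _ a] MF_topspace F.topspace_eq by auto
  fix C assume C: "closedin T C"
  have "closed_map ?H (MF A) kernel"
    using continuous_imp_closed_map[OF kernel_continuous character_space_compact MF_Hausdorff[OF AF_pm]] .
  moreover have "closedin ?H {\<omega> \<in> topspace ?H. \<omega> a \<in> C}"
    by (intro closedin_continuous_map_preimage[OF _ C] continuous_map_from_subtopology
        spectral_product_projection a)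
  ultimately have cl: "closedin (MF A) (kernel ` {\<omega> \<in> topspace ?H. \<omega> a \<in> C})"
    unfolding closed_map_def by blast
  have evk: "ev F A a (kernel \<omega>) = \<omega> a" if "\<omega> \<in> character_space" for \<omega>
    using ev_kernel[OF AF_Gelfand _ a] that unfolding character_space_def by auto
  have "kernel ` {\<omega> \<in> topspace ?H. \<omega> a \<in> C} = {M \<in> topspace (MF A). ev F A a M \<in> C}"
  proof (rule Set.set_eqI, rule iffI)
    fix M assume "M \<in> kernel ` {\<omega> \<in> topspace ?H. \<omega> a \<in> C}"
    then show "M \<in> {M \<in> topspace (MF A). ev F A a M \<in> C}"
      unfolding top MF_topspace using evk kernel_image by auto
  next
    fix M assume M: "M \<in> {M \<in> topspace (MF A). ev F A a M \<in> C}"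
    then obtain \<omega> where \<omega>: "\<omega> \<in> character_space" "kernel \<omega> = M"
      using Max_ideals_are_kernels unfolding MF_topspace by blast
    have "\<omega> a \<in> C" using evk[OF \<omega>(1)] \<omega>(2) M by simp
    then show "M \<in> kernel ` {\<omega> \<in> topspace ?H. \<omega> a \<in> C}" unfolding top using \<omega> by blast
  qed
  then show "closedin (MF A) {M \<in> topspace (MF A). ev F A a M \<in> C}" using cl by simp
qed

text \<open>A basic open neighbourhood \<open>D(a)\<close> of \<open>M\<close> is the cozero set of \<open>ev a\<close>, and \<open>ev a / ev a M\<close> is the
  separating function.\<close>

theorem MF_obj: "KH_obj F T (MF A)"
  unfolding KH_obj_def F_Tychonoff_def
proof (intro conjI allI impI)
  show "compact_space (MF A)" using MF_compact .
  show "t1_space (MF A)" using Hausdorff_imp_t1_space[OF MF_Hausdorff[OF AF_pm]] .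
  fix C M assume C: "closedin (MF A) C" and M: "M \<in> topspace (MF A) - C"
  have "openin (MF A) (topspace (MF A) - C)" using C by auto
  from MF_base[OF this M] obtain a where a: "a \<in> carrier A" "a \<notin> M"
    "\<forall>N\<in>Max_ideals A. a \<notin> N \<longrightarrow> N \<in> topspace (MF A) - C" by (elim bexE conjE)
  have MM: "M \<in> Max_ideals A" using M MF_topspace by simp
  let ?c = "ev F A a M"
  have c: "?c \<in> carrier F" "?c \<noteq> \<zero>\<^bsub>F\<^esub>"
    using ev_closed[OF AF_Gelfand MM a(1)] ev_zero_iff[OF AF_Gelfand MM a(1)] a(2) by auto
  let ?f = "\<lambda>N. inv\<^bsub>F\<^esub> ?c \<otimes>\<^bsub>F\<^esub> ev F A a N"
  have "continuous_map (MF A) T ?f"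
    by (intro F.cont_intros F.inv_closed c ev_continuous a)
  moreover have "?f M = \<one>\<^bsub>F\<^esub>" using F.inv_left[OF c] .
  moreover have "?f N = \<zero>\<^bsub>F\<^esub>" if N: "N \<in> C" for N
  proof -
    have NM: "N \<in> Max_ideals A" using N closedin_subset[OF C] MF_topspace by auto
    then have "a \<in> N" using a(3) N by auto
    then show ?thesis using ev_zero_iff[OF AF_Gelfand NM a(1)] F.inv_closed[OF c] by simp
  qed
  ultimately show "\<exists>f. continuous_map (MF A) T f \<and> f M = \<one>\<^bsub>F\<^esub> \<and> (\<forall>y\<in>C. f y = \<zero>\<^bsub>F\<^esub>)"
    by (intro exI[of _ ?f]) simp
qed

end

end

section \<open>The functors and the units\<close>

context topological_field
begin

lemma AF_F_algebra: "AF_obj F T A \<Longrightarrow> F_algebra F T A"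
  unfolding AF_obj_def using topological_field_axioms by (auto intro: F_algebra.intro)

lemma KH_homD:
  assumes "f \<in> KH_hom X Y"
  shows "continuous_map X Y f" "f \<in> extensional (topspace X)" "\<And>x. x \<in> topspace X \<Longrightarrow> f x \<in> topspace Y"
  using assms continuous_map_funspace unfolding KH_hom_def by fastforce+

lemma CF_compose:
  assumes "f \<in> KH_hom X Y" "\<phi> \<in> carrier (CF F T Y)"
  shows "compose (topspace X) \<phi> f \<in> carrier (CF F T X)"
  using CF_restrict[OF continuous_map_compose[OF KH_homD(1)[OF assms(1)] CF_cont[OF assms(2)]]]
  by (simp add: compose_def o_def)

lemma CF_map_hom:
  assumes f: "f \<in> KH_hom X Y"
  shows "CF_map F T X Y f \<in> AF_hom F (CF F T Y) (CF F T X)"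
  unfolding AF_hom_def
proof (intro CollectI conjI ballI)
  show "CF_map F T X Y f \<in> extensional (carrier (CF F T Y))" unfolding CF_map_def by simp
  have app: "CF_map F T X Y f \<phi> = (\<lambda>x\<in>topspace X. \<phi> (f x))" if "\<phi> \<in> carrier (CF F T Y)" for \<phi>
    unfolding CF_map_def compose_def using that by simp
  note fY = KH_homD(3)[OF f] and cl = CF_closed[where X = Y]
  show "CF_map F T X Y f \<in> ring_hom (CF F T Y) (CF F T X)"
  proof (rule ring_hom_memI)
    show "CF_map F T X Y f \<phi> \<in> carrier (CF F T X)" if "\<phi> \<in> carrier (CF F T Y)" for \<phi>
      unfolding CF_map_def using CF_compose[OF f that] that by simp
    fix \<phi> \<psi> assume pq: "\<phi> \<in> carrier (CF F T Y)" "\<psi> \<in> carrier (CF F T Y)"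
    show "CF_map F T X Y f (\<phi> \<otimes>\<^bsub>CF F T Y\<^esub> \<psi>) = CF_map F T X Y f \<phi> \<otimes>\<^bsub>CF F T X\<^esub> CF_map F T X Y f \<psi>"
      unfolding app[OF pq(1)] app[OF pq(2)] app[OF cl(1)[OF pq]]
      unfolding CF_simps
      by (rule restrict_ext) (use fY in simp)
    show "CF_map F T X Y f (\<phi> \<oplus>\<^bsub>CF F T Y\<^esub> \<psi>) = CF_map F T X Y f \<phi> \<oplus>\<^bsub>CF F T X\<^esub> CF_map F T X Y f \<psi>"
      unfolding app[OF pq(1)] app[OF pq(2)] app[OF cl(2)[OF pq]]
      unfolding CF_simps
      by (rule restrict_ext) (use fY in simp)
  next
    show "CF_map F T X Y f \<one>\<^bsub>CF F T Y\<^esub> = \<one>\<^bsub>CF F T X\<^esub>"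
      unfolding app[OF cl(4)] unfolding CF_simps by (rule restrict_ext) (use fY in simp)
  qed
  fix c \<phi> assume c: "c \<in> carrier F" "\<phi> \<in> carrier (CF F T Y)"
  show "CF_map F T X Y f (c \<odot>\<^bsub>CF F T Y\<^esub> \<phi>) = c \<odot>\<^bsub>CF F T X\<^esub> CF_map F T X Y f \<phi>"
    unfolding app[OF c(2)] app[OF cl(3)[OF c]] unfolding CF_simps by (rule restrict_ext) (use fY in simp)
qed

lemma CF_map_id: "CF_map F T X X (\<lambda>x\<in>topspace X. x) = (\<lambda>\<phi>\<in>carrier (CF F T X). \<phi>)"
  unfolding CF_map_def
proof (rule restrict_ext)
  fix \<phi> assume "\<phi> \<in> carrier (CF F T X)"
  then show "compose (topspace X) \<phi> (\<lambda>x\<in>topspace X. x) = \<phi>"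
    using CF_ext by (intro extensionalityI[of _ "topspace X"]) (auto simp: compose_def)
qed

lemma CF_map_compose:
  assumes f: "f \<in> KH_hom X Y" and g: "g \<in> KH_hom Y Z"
  shows "CF_map F T X Z (compose (topspace X) g f)
    = compose (carrier (CF F T Z)) (CF_map F T X Y f) (CF_map F T Y Z g)"
  unfolding CF_map_def compose_def[of "carrier (CF F T Z)"]
proof (rule restrict_ext)
  fix \<phi> assume \<phi>: "\<phi> \<in> carrier (CF F T Z)"
  have "compose (topspace X) \<phi> (compose (topspace X) g f)
      = compose (topspace X) (compose (topspace Y) \<phi> g) f"
    unfolding compose_def by (rule restrict_ext) (use KH_homD(3)[OF f] in simp)
  then show "compose (topspace X) \<phi> (compose (topspace X) g f)
      = (\<lambda>\<phi>\<in>carrier (CF F T Y). compose (topspace X) \<phi> f)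
          ((\<lambda>\<phi>\<in>carrier (CF F T Z). compose (topspace Y) \<phi> g) \<phi>)"
    using \<phi> CF_compose[OF g \<phi>] by simp
qed

text \<open>Pulling back a maximal ideal along a morphism is precomposing its character with the morphism.\<close>

lemma AF_hom_pullback:
  assumes h: "h \<in> AF_hom F A B" and A: "AF_obj F T A" and B: "AF_obj F T B" and N: "N \<in> Max_ideals B"
  shows "MF_map A B h N \<in> Max_ideals A"
    and "a \<in> carrier A \<Longrightarrow> ev F A a (MF_map A B h N) = ev F B (h a) N"
proof -
  interpret A: F_algebra F T A by (rule AF_F_algebra[OF A])
  interpret B: F_algebra F T B by (rule AF_F_algebra[OF B])
  have hom: "h \<in> ring_hom A B"
    and sm: "\<And>c a. c \<in> carrier F \<Longrightarrow> a \<in> carrier A \<Longrightarrow> h (c \<odot>\<^bsub>A\<^esub> a) = c \<odot>\<^bsub>B\<^esub> h a"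
    using h unfolding AF_hom_def by auto
  note GA = A.AF_Gelfand[OF A] and GB = B.AF_Gelfand[OF B]
  note ch = B.ev_character[OF GB N]
  have "character F A (\<lambda>a. ev F B (h a) N)"
    unfolding character_def
  proof
    show "(\<lambda>a. ev F B (h a) N) \<in> ring_hom A F"
      using ring_hom_trans[OF hom B.char_hom[OF ch]] by (simp add: o_def)
    show "\<forall>c\<in>carrier F. ev F B (h (A.scalar c)) N = c"
      using sm[OF _ A.A.one_closed] ring_hom_one[OF hom] B.char_scalar[OF ch] by simp
  qed
  moreover have "MF_map A B h N = {a \<in> carrier A. ev F B (h a) N = \<zero>}"
    unfolding MF_map_def using N B.ev_zero_iff[OF GB N ring_hom_closed[OF hom]] by auto
  ultimately show "MF_map A B h N \<in> Max_ideals A"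
    and "a \<in> carrier A \<Longrightarrow> ev F A a (MF_map A B h N) = ev F B (h a) N"
    using A.kernel_Max[OF A] A.ev_kernel[OF GA] by auto
qed

lemma MF_map_hom:
  assumes h: "h \<in> AF_hom F A B" and A: "AF_obj F T A" and B: "AF_obj F T B"
  shows "MF_map A B h \<in> KH_hom (MF B) (MF A)"
  unfolding KH_hom_def
proof (intro CollectI conjI)
  interpret A: F_algebra F T A by (rule AF_F_algebra[OF A])
  interpret B: F_algebra F T B by (rule AF_F_algebra[OF B])
  have hom: "h \<in> ring_hom A B" using h unfolding AF_hom_def by auto
  show "MF_map A B h \<in> extensional (topspace (MF B))" unfolding B.MF_topspace MF_map_def by simp
  show "continuous_map (MF B) (MF A) (MF_map A B h)"
    unfolding MF_def[of A]
  proof (rule continuous_on_generated_topo)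
    fix U assume "U \<in> (\<lambda>a. {M \<in> Max_ideals A. a \<notin> M}) ` carrier A"
    then obtain a where a: "a \<in> carrier A" "U = {M \<in> Max_ideals A. a \<notin> M}" by auto
    have "MF_map A B h -` U \<inter> topspace (MF B) = {N \<in> Max_ideals B. h a \<notin> N}"
      using AF_hom_pullback(1)[OF h A B] a by (auto simp: B.MF_topspace MF_map_def)
    then show "openin (MF B) (MF_map A B h -` U \<inter> topspace (MF B))"
      using B.MF_basic_open[OF ring_hom_closed[OF hom a(1)]] by simp
  next
    show "MF_map A B h ` topspace (MF B) \<subseteq> \<Union> ((\<lambda>a. {M \<in> Max_ideals A. a \<notin> M}) ` carrier A)"
      using AF_hom_pullback(1)[OF h A B] A.MF_topspace B.MF_topspace
      unfolding MF_def[of A] topology_generated_by_topspace by auto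
  qed
qed

lemma MF_map_id:
  assumes A: "AF_obj F T A"
  shows "MF_map A A (\<lambda>a\<in>carrier A. a) = (\<lambda>M\<in>topspace (MF A). M)"
proof -
  interpret A: F_algebra F T A by (rule AF_F_algebra[OF A])
  show ?thesis
    unfolding MF_map_def A.MF_topspace
  proof (rule restrict_ext)
    fix M assume M: "M \<in> Max_ideals A"
    have "M \<subseteq> carrier A"
      using additive_subgroup.a_subset[OF ideal.axioms(1)[OF A.Max_ideal[OF A.AF_Gelfand[OF A] M]]] .
    then show "{a \<in> carrier A. (\<lambda>a\<in>carrier A. a) a \<in> M} = M" by auto
  qed
qed

lemma MF_map_compose:
  assumes h: "h \<in> AF_hom F A B" and k: "k \<in> AF_hom F B C"
    and A: "AF_obj F T A" and B: "AF_obj F T B" and C: "AF_obj F T C"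
  shows "MF_map A C (compose (carrier A) k h) = compose (topspace (MF C)) (MF_map A B h) (MF_map B C k)"
proof -
  interpret C: F_algebra F T C by (rule AF_F_algebra[OF C])
  have hom: "h \<in> ring_hom A B" using h unfolding AF_hom_def by auto
  show ?thesis
    unfolding C.MF_topspace compose_def[of "Max_ideals C"] MF_map_def[of A C]
  proof (rule restrict_ext)
    fix N assume N: "N \<in> Max_ideals C"
    have "MF_map B C k N \<in> Max_ideals B" by (rule AF_hom_pullback(1)[OF k B C N])
    then show "{a \<in> carrier A. compose (carrier A) k h a \<in> N} = MF_map A B h (MF_map B C k N)"
      using N ring_hom_closed[OF hom] unfolding MF_map_def by (auto simp: compose_def)
  qed
qed

lemma G_unit_eq: "x \<in> topspace X \<Longrightarrow> G_unit F T X x = vanishing_ideal X x"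
  unfolding G_unit_def vanishing_ideal_def by simp

lemma G_unit_hom: "G_unit F T X \<in> KH_hom X (MF (CF F T X))"
  unfolding KH_hom_def
proof (intro CollectI conjI)
  interpret A: F_algebra F T "CF F T X" by (rule CF_F_algebra)
  show "G_unit F T X \<in> extensional (topspace X)" unfolding G_unit_def by simp
  show "continuous_map X (MF (CF F T X)) (G_unit F T X)"
    unfolding MF_def
  proof (rule continuous_on_generated_topo)
    fix U assume "U \<in> (\<lambda>a. {M \<in> Max_ideals (CF F T X). a \<notin> M}) ` carrier (CF F T X)"
    then obtain f where f: "f \<in> carrier (CF F T X)" "U = {M \<in> Max_ideals (CF F T X). f \<notin> M}" by auto
    have "G_unit F T X -` U \<inter> topspace X = {x \<in> topspace X. f x \<noteq> \<zero>}"
      using vanishing_ideal_Max f by (auto simp: G_unit_eq) (auto simp: vanishing_ideal_def)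
    then show "openin X (G_unit F T X -` U \<inter> topspace X)"
      using open_cozero[OF CF_cont[OF f(1)]] by simp
  next
    show "G_unit F T X ` topspace X
        \<subseteq> \<Union> ((\<lambda>a. {M \<in> Max_ideals (CF F T X). a \<notin> M}) ` carrier (CF F T X))"
      using vanishing_ideal_Max A.MF_topspace unfolding MF_def topology_generated_by_topspace
      by (auto simp: G_unit_eq)
  qed
qed

lemma G_unit_natural:
  assumes f: "f \<in> KH_hom X Y"
  shows "compose (topspace X) (MF_map (CF F T Y) (CF F T X) (CF_map F T X Y f)) (G_unit F T X)
    = compose (topspace X) (G_unit F T Y) f"
  unfolding compose_def[of "topspace X" "MF_map _ _ _"] compose_def[of "topspace X" "G_unit F T Y"]
proof (rule restrict_ext)
  fix x assume x: "x \<in> topspace X"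
  have fx: "f x \<in> topspace Y" using KH_homD(3)[OF f x] .
  have "MF_map (CF F T Y) (CF F T X) (CF_map F T X Y f) (vanishing_ideal X x)
      = {\<phi> \<in> carrier (CF F T Y). CF_map F T X Y f \<phi> \<in> vanishing_ideal X x}"
    unfolding MF_map_def using vanishing_ideal_Max[OF x] by simp
  also have "\<dots> = vanishing_ideal Y (f x)"
    unfolding vanishing_ideal_def CF_map_def using CF_compose[OF f] x by (auto simp: compose_def)
  finally show "MF_map (CF F T Y) (CF F T X) (CF_map F T X Y f) (G_unit F T X x) = G_unit F T Y (f x)"
    using x fx by (simp add: G_unit_eq)
qed

lemma ev_in_CF:
  assumes A: "AF_obj F T A" and a: "a \<in> carrier A"
  shows "ev F A a \<in> carrier (CF F T (MF A))"
proof -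
  interpret A: F_algebra F T A by (rule AF_F_algebra[OF A])
  show ?thesis
    unfolding CF_mem
  proof
    show "ev F A a \<in> extensional (topspace (MF A))" unfolding A.MF_topspace ev_def by simp
    show "continuous_map (MF A) T (ev F A a)" using A.ev_continuous[OF A a] .
  qed
qed

lemma I_unit_hom:
  assumes A: "AF_obj F T A"
  shows "I_unit F A \<in> AF_hom F A (CF F T (MF A))"
  unfolding AF_hom_def
proof (intro CollectI conjI ballI)
  interpret A: F_algebra F T A by (rule AF_F_algebra[OF A])
  note ch = A.ev_character[OF A.AF_Gelfand[OF A]]
  have app: "I_unit F A a = ev F A a" if "a \<in> carrier A" for a unfolding I_unit_def using that by simp
  show "I_unit F A \<in> extensional (carrier A)" unfolding I_unit_def by simp
  show "I_unit F A \<in> ring_hom A (CF F T (MF A))"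
  proof (rule ring_hom_memI)
    show "I_unit F A a \<in> carrier (CF F T (MF A))" if "a \<in> carrier A" for a
      using app[OF that] ev_in_CF[OF A that] by simp
    fix a b assume ab: "a \<in> carrier A" "b \<in> carrier A"
    note in_CF = ev_in_CF[OF A ab(1)] ev_in_CF[OF A ab(2)]
    show "I_unit F A (a \<otimes>\<^bsub>A\<^esub> b) = I_unit F A a \<otimes>\<^bsub>CF F T (MF A)\<^esub> I_unit F A b"
      unfolding app[OF ab(1)] app[OF ab(2)] app[OF A.A.m_closed[OF ab]]
      by (rule CF_eqI[OF ev_in_CF[OF A A.A.m_closed[OF ab]] CF_closed(1)[OF in_CF]])
        (use ring_hom_mult[OF A.char_hom[OF ch] ab] A.MF_topspace in \<open>simp add: CF_simps\<close>)
    show "I_unit F A (a \<oplus>\<^bsub>A\<^esub> b) = I_unit F A a \<oplus>\<^bsub>CF F T (MF A)\<^esub> I_unit F A b"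
      unfolding app[OF ab(1)] app[OF ab(2)] app[OF A.A.a_closed[OF ab]]
      by (rule CF_eqI[OF ev_in_CF[OF A A.A.a_closed[OF ab]] CF_closed(2)[OF in_CF]])
        (use ring_hom_add[OF A.char_hom[OF ch] ab] A.MF_topspace in \<open>simp add: CF_simps\<close>)
  next
    show "I_unit F A \<one>\<^bsub>A\<^esub> = \<one>\<^bsub>CF F T (MF A)\<^esub>"
      unfolding app[OF A.A.one_closed]
      by (rule CF_eqI[OF ev_in_CF[OF A A.A.one_closed] CF_closed(4)])
        (use ring_hom_one[OF A.char_hom[OF ch]] A.MF_topspace in \<open>simp add: CF_simps\<close>)
  qed
  fix c a assume ca: "c \<in> carrier F" "a \<in> carrier A"
  have cl: "c \<odot>\<^bsub>A\<^esub> a \<in> carrier A" using module.smult_closed[OF A.F_module ca] .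
  show "I_unit F A (c \<odot>\<^bsub>A\<^esub> a) = c \<odot>\<^bsub>CF F T (MF A)\<^esub> I_unit F A a"
    unfolding app[OF ca(2)] app[OF cl]
    by (rule CF_eqI[OF ev_in_CF[OF A cl] CF_closed(3)[OF ca(1) ev_in_CF[OF A ca(2)]]])
      (use A.char_smult[OF ch ca] A.MF_topspace in \<open>simp add: CF_simps\<close>)
qed

lemma I_unit_natural:
  assumes h: "h \<in> AF_hom F A B" and A: "AF_obj F T A" and B: "AF_obj F T B"
  shows "compose (carrier A) (CF_map F T (MF B) (MF A) (MF_map A B h)) (I_unit F A)
    = compose (carrier A) (I_unit F B) h"
  unfolding compose_def[of "carrier A"]
proof (rule restrict_ext)
  fix a assume a: "a \<in> carrier A"
  interpret B: F_algebra F T B by (rule AF_F_algebra[OF B])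
  have ha: "h a \<in> carrier B" using h a unfolding AF_hom_def by (auto intro: ring_hom_closed)
  have "CF_map F T (MF B) (MF A) (MF_map A B h) (I_unit F A a)
      = (\<lambda>N\<in>Max_ideals B. ev F A a (MF_map A B h N))"
    unfolding CF_map_def I_unit_def using a ev_in_CF[OF A a] by (simp add: compose_def B.MF_topspace)
  also have "\<dots> = (\<lambda>N\<in>Max_ideals B. ev F B (h a) N)"
    by (rule restrict_ext) (use AF_hom_pullback(2)[OF h A B _ a] in simp)
  also have "\<dots> = I_unit F B (h a)"
    unfolding I_unit_def using ha by (auto simp: ev_def)
  finally show "CF_map F T (MF B) (MF A) (MF_map A B h) (I_unit F A a) = I_unit F B (h a)" .
qed

lemma triangle_CF:
  assumes X: "KH_obj F T X"
  shows "compose (carrier (CF F T X)) (CF_map F T X (MF (CF F T X)) (G_unit F T X)) (I_unit F (CF F T X))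
    = (\<lambda>\<phi>\<in>carrier (CF F T X). \<phi>)"
  unfolding compose_def[of "carrier (CF F T X)"]
proof (rule restrict_ext)
  fix \<phi> assume \<phi>: "\<phi> \<in> carrier (CF F T X)"
  interpret A: F_algebra F T "CF F T X" by (rule CF_F_algebra)
  note AF = CF_obj[OF X]
  have "ev F (CF F T X) \<phi> (G_unit F T X x) = \<phi> x" if "x \<in> topspace X" for x
    unfolding G_unit_eq[OF that] vanishing_ideal_def
    using A.ev_kernel[OF A.AF_Gelfand[OF AF] CF_eval_character[OF that] \<phi>] .
  then have "compose (topspace X) (ev F (CF F T X) \<phi>) (G_unit F T X) = \<phi>"
    using CF_ext[OF \<phi>] by (intro extensionalityI[of _ "topspace X"]) (auto simp: compose_def)
  then show "CF_map F T X (MF (CF F T X)) (G_unit F T X) (I_unit F (CF F T X) \<phi>) = \<phi>"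
    unfolding CF_map_def I_unit_def using \<phi> ev_in_CF[OF AF \<phi>] by simp
qed

lemma triangle_MF:
  assumes A: "AF_obj F T A"
  shows "compose (topspace (MF A)) (MF_map A (CF F T (MF A)) (I_unit F A)) (G_unit F T (MF A))
    = (\<lambda>M\<in>topspace (MF A). M)"
  unfolding compose_def[of "topspace (MF A)"]
proof (rule restrict_ext)
  interpret A: F_algebra F T A by (rule AF_F_algebra[OF A])
  fix M assume M: "M \<in> topspace (MF A)"
  then have MM: "M \<in> Max_ideals A" using A.MF_topspace by simp
  have "MF_map A (CF F T (MF A)) (I_unit F A) (G_unit F T (MF A) M)
      = {a \<in> carrier A. I_unit F A a \<in> vanishing_ideal (MF A) M}"
    unfolding MF_map_def G_unit_eq[OF M] using vanishing_ideal_Max[OF M] by simp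
  also have "\<dots> = {a \<in> carrier A. ev F A a M = \<zero>}"
    unfolding vanishing_ideal_def I_unit_def using ev_in_CF[OF A] by auto
  also have "\<dots> = M" using A.Max_ideal_eq_kernel[OF A.AF_Gelfand[OF A] MM] by simp
  finally show "MF_map A (CF F T (MF A)) (I_unit F A) (G_unit F T (MF A) M) = M" .
qed

end

theorem proposition31:
  fixes F :: "'f ring" and T :: "'f topology"
  assumes "topological_field F T"
  shows
    \<comment> \<open>\<open>C\<^sub>F\<close> is a contravariant functor\<close>
    "(\<forall>X :: 'x topology. KH_obj F T X \<longrightarrow> AF_obj F T (CF F T X)) \<and>
     (\<forall>(X :: 'x topology) (Y :: 'y topology). \<forall>f \<in> KH_hom X Y. KH_obj F T X \<longrightarrow> KH_obj F T Y \<longrightarrow>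
        CF_map F T X Y f \<in> AF_hom F (CF F T Y) (CF F T X)) \<and>
     (\<forall>X :: 'x topology. KH_obj F T X \<longrightarrow>
        CF_map F T X X (\<lambda>x\<in>topspace X. x) = (\<lambda>\<phi>\<in>carrier (CF F T X). \<phi>)) \<and>
     (\<forall>(X :: 'x topology) (Y :: 'y topology) (Z :: 'z topology).
        \<forall>f \<in> KH_hom X Y. \<forall>g \<in> KH_hom Y Z. KH_obj F T X \<longrightarrow> KH_obj F T Y \<longrightarrow> KH_obj F T Z \<longrightarrow>
        CF_map F T X Z (compose (topspace X) g f) =
        compose (carrier (CF F T Z)) (CF_map F T X Y f) (CF_map F T Y Z g)) \<and>
     \<comment> \<open>\<open>M\<^sub>F\<close> is a contravariant functor\<close>
     (\<forall>A :: ('f, 'a) module. AF_obj F T A \<longrightarrow> KH_obj F T (MF A) \<and> topspace (MF A) = Max_ideals A) \<and>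
     (\<forall>(A :: ('f, 'a) module) (B :: ('f, 'b) module). \<forall>h \<in> AF_hom F A B. AF_obj F T A \<longrightarrow> AF_obj F T B \<longrightarrow>
        MF_map A B h \<in> KH_hom (MF B) (MF A)) \<and>
     (\<forall>A :: ('f, 'a) module. AF_obj F T A \<longrightarrow>
        MF_map A A (\<lambda>a\<in>carrier A. a) = (\<lambda>M\<in>topspace (MF A). M)) \<and>
     (\<forall>(A :: ('f, 'a) module) (B :: ('f, 'b) module) (C :: ('f, 'c) module).
        \<forall>h \<in> AF_hom F A B. \<forall>k \<in> AF_hom F B C. AF_obj F T A \<longrightarrow> AF_obj F T B \<longrightarrow> AF_obj F T C \<longrightarrow>
        MF_map A C (compose (carrier A) k h) =
        compose (topspace (MF C)) (MF_map A B h) (MF_map B C k)) \<and>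
     \<comment> \<open>\<open>G\<close> is a natural transformation\<close>
     (\<forall>X :: 'x topology. KH_obj F T X \<longrightarrow> G_unit F T X \<in> KH_hom X (MF (CF F T X))) \<and>
     (\<forall>(X :: 'x topology) (Y :: 'y topology). \<forall>f \<in> KH_hom X Y. KH_obj F T X \<longrightarrow> KH_obj F T Y \<longrightarrow>
        compose (topspace X) (MF_map (CF F T Y) (CF F T X) (CF_map F T X Y f)) (G_unit F T X) =
        compose (topspace X) (G_unit F T Y) f) \<and>
     \<comment> \<open>\<open>I\<close> is a natural transformation\<close>
     (\<forall>A :: ('f, 'a) module. AF_obj F T A \<longrightarrow> I_unit F A \<in> AF_hom F A (CF F T (MF A))) \<and>
     (\<forall>(A :: ('f, 'a) module) (B :: ('f, 'b) module). \<forall>h \<in> AF_hom F A B. AF_obj F T A \<longrightarrow> AF_obj F T B \<longrightarrow>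
        compose (carrier A) (CF_map F T (MF B) (MF A) (MF_map A B h)) (I_unit F A) =
        compose (carrier A) (I_unit F B) h) \<and>
     \<comment> \<open>the triangle identities\<close>
     (\<forall>X :: 'x topology. KH_obj F T X \<longrightarrow>
        compose (carrier (CF F T X)) (CF_map F T X (MF (CF F T X)) (G_unit F T X)) (I_unit F (CF F T X)) =
        (\<lambda>\<phi>\<in>carrier (CF F T X). \<phi>)) \<and>
     (\<forall>A :: ('f, 'a) module. AF_obj F T A \<longrightarrow>
        compose (topspace (MF A)) (MF_map A (CF F T (MF A)) (I_unit F A)) (G_unit F T (MF A)) =
        (\<lambda>M\<in>topspace (MF A). M))"
proof -
  interpret topological_field F T by (rule assms)
  have MF: "KH_obj F T (MF A)" "topspace (MF A) = Max_ideals A"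
    if "AF_obj F T A" for A :: "('f, 'a) module"
    using F_algebra.MF_obj[OF AF_F_algebra[OF that] that]
      F_algebra.MF_topspace[OF AF_F_algebra[OF that]] .
  show ?thesis
    by (intro conjI allI ballI impI)
      (rule CF_obj CF_map_hom CF_map_id CF_map_compose MF MF_map_hom MF_map_id MF_map_compose
        G_unit_hom G_unit_natural I_unit_hom I_unit_natural triangle_CF triangle_MF; assumption)+
qed

end
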